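(* Consider all orbispaces satisfying (C1) and (C2) (as described in the context), with maps of orbispaces (equivalence classes of homomorphisms, as defined in the context) as morphisms. With this notion of maps these orbispaces form a category. Explicitly: let $\Phi:X\to Y$ and $\Psi:Y\to Z$ be maps of orbispaces. Then their composition $\Psi\circ\Phi:X\to Z$, described in the context, is well defined (it exists, and is independent of all choices of representatives), and composition is associative with the classes of identity homomorphisms as identities.
   Context: **Orbispaces.** A topological groupoid $\Gamma$ with unit space $U$, source map $\alpha$ and target map $\omega$ is étale if $\alpha,\omega:\Gamma\to U$ are local homeomorphisms. An orbispace is a space $X$ with an étale topological groupoid $\Gamma$ such that $X$ is covered by open sets $U_i=\widehat{U_i}/G_i$ ($G_i$ a discrete group acting on $\widehat{U_i}$), $U=\bigsqcup_i\widehat{U_i}$, $\Gamma$ restricts on each $\widehat{U_i}$ to the product groupoid $G_i\times\widehat{U_i}$, and $X$ is the space of $\Gamma$-orbits. Conditions: (C1) $\Gamma$ is locally connected; (C2) for all $i,j$, with $\Gamma(U_i,U_j)=\{\gamma:\alpha(\gamma)\in\widehat{U_i},\omega(\gamma)\in\widehat{U_j}\}$, the restriction of $\alpha$ (resp. $\omega$) to any connected component of $\Gamma(U_i,U_j)$ is a homeomorphism onto a connected component of $\alpha(\Gamma(U_i,U_j))\subset\widehat{U_i}$ (resp. $\omega(\Gamma(U_i,U_j))\subset\widehat{U_j}$). An orbispace satisfying (C1), (C2) is equivalently given by: an atlas $\mathcal U=\{U_i\}$ of connected open sets covering $X$ with local charts $(\widehat{U_i},G_{U_i},\pi_{U_i})$,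 where $\widehat{U_i}$ is locally connected with a continuous left action of the discrete group $G_{U_i}$ and $\pi_{U_i}:\widehat{U_i}\to X$ induces a homeomorphism $\widehat{U_i}/G_{U_i}\cong U_i$; discrete sets $T(U_i,U_j)$ whenever $U_i\cap U_j\ne\emptyset$, with $T(U_i,U_i)=G_{U_i}$ and, for $i\neq j$, $T(U_i,U_j)=\bigsqcup_W T_W(U_i,U_j)$ over the connected components $W$ of $U_i\cap U_j$; for each $\xi\in T_W(U_i,U_j)$ a homeomorphism $\phi_\xi$ from a connected component of $\pi_{U_i}^{-1}(W)$ onto one of $\pi_{U_j}^{-1}(W)$ with $\pi_{U_i}=\pi_{U_j}\circ\phi_\xi$ (for $\xi\in G_{U_i}$, $\phi_\xi$ is the action of $\xi$ on $\widehat{U_i}$); compositions: if $\xi\in T(U_i,U_j)$, $\eta\in T(U_j,U_k)$, $x\in\mathrm{Domain}(\phi_\xi)$ and $\phi_\xi(x)\in\mathrm{Domain}(\phi_\eta)$, an element $\eta\circ\xi(x)\in T(U_i,U_k)$ with $\phi_{\eta\circ\xi(x)}(x)=\phi_\eta(\phi_\xi(x))$, locally constant in $x$, associative, and equal to group multiplication on $G_{U_i}$; inverses $\xi^{-1}\in T(U_j,U_i)$ with domain and range exchanged and $\xi^{-1}\circ\xi(x)=1$, $\xi\circ\xi^{-1}(x)=1$; and two points of charts have the same image in $X$ iff some $\phi_\xi$ maps one to the other. The groupoid is $\Gamma=\{(\xi,x):x\in\mathrm{Domain}(\phi_\xi)\}$ with $\alpha(\xi,x)=x$, $\omega(\xi,x)=\phi_\xi(x)$,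 $(\eta,\phi_\xi(x))\circ(\xi,x)=(\eta\circ\xi(x),x)$. For $\{U_\alpha\}\subset\mathcal U$, $\Gamma\{U_\alpha\}$ is the restriction of $\Gamma$ to $\bigsqcup_\alpha\widehat{U_\alpha}$. When $\eta\circ\xi(x)$ does not depend on $x$ it is written $\eta\circ\xi$. Conventions: each atlas has been enlarged (passing to an equivalent groupoid) so as to contain all connected open subsets of its members, and each $\widehat{U_i}$ is connected. **Homomorphisms.** A homomorphism $\Gamma\{U_\alpha\}\to\Gamma\{U'_{\alpha'}\}$ is written $(\{f_\alpha\},\{\rho_{\beta\alpha}\})$: there is an assignment $U_\alpha\mapsto U'_\alpha\in\{U'_{\alpha'}\}$, continuous maps $f_\alpha:\widehat{U_\alpha}\to\widehat{U'_\alpha}$ and maps $\rho_{\beta\alpha}:T(U_\alpha,U_\beta)\to T(U'_\alpha,U'_\beta)$ with $\phi_{\rho_{\beta\alpha}(\xi)}\circ f_\alpha=f_\beta\circ\phi_\xi$ on $\mathrm{Domain}(\phi_\xi)$ and $\rho_{\gamma\alpha}(\eta\circ\xi(x))=\rho_{\gamma\beta}(\eta)\circ\rho_{\beta\alpha}(\xi)(f_\alpha(x))$ for $x\in\phi_\xi^{-1}(\mathrm{Domain}(\phi_\eta))$; the groupoid map is $(\xi,x)\mapsto(\rho_{\beta\alpha}(\xi),f_\alpha(x))$. If $\{U_\alpha\}$ covers $X$ it induces a continuous map $f:X\to X'$ of underlying spaces. **Induced, equivalent, maps.** Let $\sigma=(\{f_\alpha\},\{\rho_{\beta\alpha}\}):\Gamma\{U_\alpha\}\to\Gamma\{U'_{\alpha'}\}$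 with $\{U_\alpha\}$ a cover of $X$ and underlying map $f$. Let $\{U_a\}\subset\mathcal U$ be a cover of $X$ refining $\{U_\alpha\}$, with an assignment $U_a\mapsto U'_a$ such that $f(U_a)\subset U'_a$. A homomorphism $(\{f_a\},\{\rho_{ba}\}):\Gamma\{U_a\}\to\Gamma\{U'_{a'}\}$ is induced by $\sigma$ if there are an index map $\theta$ with $U_a\subset U_{\theta(a)}$, and $\xi_a\in T(U_a,U_{\theta(a)})$, $\xi'_a\in T(U'_a,U'_{\theta(a)})$ with $f_{\theta(a)}\circ\phi_{\xi_a}(\widehat{U_a})\subset\mathrm{Range}(\phi_{\xi'_a})$, such that $f_a=(\phi_{\xi'_a})^{-1}\circ f_{\theta(a)}\circ\phi_{\xi_a}$ and $\rho_{ba}(\eta)=(\xi'_b)^{-1}\circ\rho_{\theta(b)\theta(a)}(\xi_b\circ\eta\circ\xi_a^{-1})\circ\xi'_a(x)$ for all $x\in f_a(\mathrm{Domain}(\phi_\eta))$, $\eta\in T(U_a,U_b)$. Two homomorphisms are equivalent if some homomorphism is induced by both; this is an equivalence relation. A map of orbispaces $X\to X'$ is an equivalence class of homomorphisms $\Gamma\{U_\alpha\}\to\Gamma\{U'_{\alpha'}\}$ with $\{U_\alpha\}$ a cover of $X$ by local charts. **Composition.** Given $\Phi:X\to Y$, $\Psi:Y\to Z$, choose a representative $\tau=(\{g_a\},\{\eta_{ba}\}):\Gamma\{V_a\}\to\Gamma\{W_{a'}\}$ of $\Psi$ ($\{V_a\}$ a cover of $Y$) and a representative $\sigma'=(\{f_i\},\{\rho_{ji}\}):\Gamma\{U_i\}\to\Gamma\{V_{i'}\}$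 of $\Phi$ such that each $U_i$ is assigned a chart $V_i=V_{\hat\theta(i)}$ belonging to $\{V_a\}$ (for some index map $\hat\theta$). Then $\Psi\circ\Phi$ is the class of the homomorphism $(\{g_{\hat\theta(i)}\circ f_i\},\{\eta_{\hat\theta(j)\hat\theta(i)}\circ\rho_{ji}\})$. *)

theory Defs
  imports "HOL-Analysis.Analysis" "HOL-Algebra.Group_Action"
begin

section \<open>Orbit spaces\<close>

definition quotient_topology :: "'p topology \<Rightarrow> ('p \<Rightarrow> 'q) \<Rightarrow> 'q topology" where
  "quotient_topology P q =
     topology (\<lambda>S. S \<subseteq> q ` topspace P \<and> openin P {x \<in> topspace P. q x \<in> S})"

lemma openin_quotient_topology:
  "openin (quotient_topology P q) S \<longleftrightarrow>
     S \<subseteq> q ` topspace P \<and> openin P {x \<in> topspace P. q x \<in> S}"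
proof -
  have "istopology (\<lambda>S. S \<subseteq> q ` topspace P \<and> openin P {x \<in> topspace P. q x \<in> S})"
    unfolding istopology_def
  proof (intro conjI allI impI)
    fix S T
    assume S: "S \<subseteq> q ` topspace P \<and> openin P {x \<in> topspace P. q x \<in> S}"
      and T: "T \<subseteq> q ` topspace P \<and> openin P {x \<in> topspace P. q x \<in> T}"
    show "S \<inter> T \<subseteq> q ` topspace P" using S by blast
    have "{x \<in> topspace P. q x \<in> S \<inter> T} =
        {x \<in> topspace P. q x \<in> S} \<inter> {x \<in> topspace P. q x \<in> T}" by blast
    then show "openin P {x \<in> topspace P. q x \<in> S \<inter> T}" using S T by (metis (lifting) openin_Int)
  next
    fix K
    assume K: "\<forall>S\<in>K. S \<subseteq> q ` topspace P \<and> openin P {x \<in> topspace P. q x \<in> S}"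
    show "\<Union>K \<subseteq> q ` topspace P" using K by blast
    have "{x \<in> topspace P. q x \<in> \<Union>K} = (\<Union>S\<in>K. {x \<in> topspace P. q x \<in> S})" by blast
    then show "openin P {x \<in> topspace P. q x \<in> \<Union>K}" using K by auto
  qed
  then show ?thesis
    by (simp add: quotient_topology_def topology_inverse')
qed

definition orbit_space :: "('t, 'm) monoid_scheme \<Rightarrow> ('t \<Rightarrow> 'p \<Rightarrow> 'p) \<Rightarrow> 'p topology \<Rightarrow> 'p set topology"
  where "orbit_space G act P = quotient_topology P (orbit G act)"


section \<open>Orbispaces satisfying (C1) and (C2), given by atlases\<close>

text \<open>
  The etale groupoid is encoded through its atlas: its arrows are the pairs \<open>(\<xi>, x)\<close> with \<open>x\<close> in the
  domain of \<open>\<xi>\<close>, each \<open>\<xi>\<close> carrying the topology of its domain.  Conditions (C1) and (C2) are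
  expressed by \<open>chart_locally_connected\<close>, \<open>arrow_component\<close> and \<open>arrow_homeomorphic\<close> below.

  Charts are named by indices: for \<open>i \<in> charts X\<close> the open set \<open>U\<^sub>i\<close> is \<open>chart_set X i\<close>
  and its local chart consists of \<open>chart_top X i\<close>, \<open>chart_group X i\<close> and \<open>chart_proj X i\<close>.
  The set \<open>T(U\<^sub>i, U\<^sub>j)\<close> is \<open>arrows X i j\<close>; the homeomorphism belonging to \<open>\<xi> \<in> T(U\<^sub>i, U\<^sub>j)\<close> is
  \<open>arrow_map X i j \<xi>\<close>, with domain \<open>arrow_dom X i j \<xi>\<close>.  The composite of
  \<open>\<xi> \<in> T(U\<^sub>i, U\<^sub>j)\<close> and \<open>\<eta> \<in> T(U\<^sub>j, U\<^sub>k)\<close> at \<open>x\<close>, usually written \<open>\<eta> \<circ> \<xi>(x)\<close>, is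
  \<open>arrow_comp X i j k \<eta> \<xi> x\<close>.  All values at arguments outside these ranges are irrelevant.
\<close>

record ('x, 'i, 'p, 't) orbi_atlas =
  orbi_top :: "'x topology"
  charts :: "'i set"
  chart_set :: "'i \<Rightarrow> 'x set"
  chart_top :: "'i \<Rightarrow> 'p topology"
  chart_group :: "'i \<Rightarrow> 't monoid"
  chart_proj :: "'i \<Rightarrow> 'p \<Rightarrow> 'x"
  arrows :: "'i \<Rightarrow> 'i \<Rightarrow> 't set"
  arrow_dom :: "'i \<Rightarrow> 'i \<Rightarrow> 't \<Rightarrow> 'p set"
  arrow_map :: "'i \<Rightarrow> 'i \<Rightarrow> 't \<Rightarrow> 'p \<Rightarrow> 'p"
  arrow_comp :: "'i \<Rightarrow> 'i \<Rightarrow> 'i \<Rightarrow> 't \<Rightarrow> 't \<Rightarrow> 'p \<Rightarrow> 't"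
  arrow_inv :: "'i \<Rightarrow> 'i \<Rightarrow> 't \<Rightarrow> 't"

definition arrow_range :: "('x, 'i, 'p, 't) orbi_atlas \<Rightarrow> 'i \<Rightarrow> 'i \<Rightarrow> 't \<Rightarrow> 'p set" where
  "arrow_range X i j \<xi> = arrow_map X i j \<xi> ` arrow_dom X i j \<xi>"

definition chart_preimage :: "('x, 'i, 'p, 't) orbi_atlas \<Rightarrow> 'i \<Rightarrow> 'x set \<Rightarrow> 'p set" where
  "chart_preimage X i W = {x \<in> topspace (chart_top X i). chart_proj X i x \<in> W}"

definition comp_dom :: "('x, 'i, 'p, 't) orbi_atlas \<Rightarrow> 'i \<Rightarrow> 'i \<Rightarrow> 'i \<Rightarrow> 't \<Rightarrow> 't \<Rightarrow> 'p set" where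
  "comp_dom X i j k \<eta> \<xi> = {x \<in> arrow_dom X i j \<xi>. arrow_map X i j \<xi> x \<in> arrow_dom X j k \<eta>}"

text \<open>
  Pitfalls.  In \<open>arrow_component\<close> the component \<open>W\<close> is determined by \<open>\<xi>\<close>, because domains are
  nonempty; so this axiom contains the decomposition of \<open>T(U\<^sub>i, U\<^sub>j)\<close> into the disjoint sets
  \<open>T\<^sub>W(U\<^sub>i, U\<^sub>j)\<close>, and it makes \<open>T(U\<^sub>i, U\<^sub>j)\<close> empty when \<open>U\<^sub>i\<close> and \<open>U\<^sub>j\<close> are disjoint.
  A map into a discrete space is continuous iff it is locally constant, so \<open>comp_locally_constant\<close>
  also says that composites lie in \<open>T(U\<^sub>i, U\<^sub>k)\<close>.  The laws \<open>comp_one_left\<close> and \<open>comp_one_right\<close>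
  say that the points \<open>(1, x)\<close> are the units of the groupoid of all \<open>(\<xi>, x)\<close>; they do not follow
  from associativity and the laws for inverses.
\<close>

locale orbispace =
  fixes X :: "('x, 'i, 'p, 't) orbi_atlas"
  assumes chart_set_open: "i \<in> charts X \<Longrightarrow> openin (orbi_top X) (chart_set X i)"
    and chart_set_connected: "i \<in> charts X \<Longrightarrow> connectedin (orbi_top X) (chart_set X i)"
    and chart_set_nonempty: "i \<in> charts X \<Longrightarrow> chart_set X i \<noteq> {}"
    and charts_cover: "(\<Union>i\<in>charts X. chart_set X i) = topspace (orbi_top X)"
    and charts_enlarged:
      "\<lbrakk>i \<in> charts X; openin (orbi_top X) V; connectedin (orbi_top X) V; V \<noteq> {}; V \<subseteq> chart_set X i\<rbrakk>
        \<Longrightarrow> \<exists>j\<in>charts X. chart_set X j = V"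
    and chart_locally_connected: "i \<in> charts X \<Longrightarrow> locally_connected_space (chart_top X i)"
    and chart_connected: "i \<in> charts X \<Longrightarrow> connected_space (chart_top X i)"
    and chart_action:
      "i \<in> charts X \<Longrightarrow> group_action (chart_group X i) (topspace (chart_top X i))
         (\<lambda>g. restrict (arrow_map X i i g) (topspace (chart_top X i)))"
    and chart_quotient:
      "i \<in> charts X \<Longrightarrow>
         \<exists>h. homeomorphic_map (orbit_space (chart_group X i) (arrow_map X i i) (chart_top X i))
               (subtopology (orbi_top X) (chart_set X i)) h \<and>
             (\<forall>x\<in>topspace (chart_top X i).
                h (orbit (chart_group X i) (arrow_map X i i) x) = chart_proj X i x)"
    and arrows_same: "i \<in> charts X \<Longrightarrow> arrows X i i = carrier (chart_group X i)"
    and arrow_dom_same: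
      "\<lbrakk>i \<in> charts X; g \<in> arrows X i i\<rbrakk> \<Longrightarrow> arrow_dom X i i g = topspace (chart_top X i)"
    and arrow_component:
      "\<lbrakk>i \<in> charts X; j \<in> charts X; \<xi> \<in> arrows X i j\<rbrakk> \<Longrightarrow>
         \<exists>W \<in> connected_components_of (subtopology (orbi_top X) (chart_set X i \<inter> chart_set X j)).
           arrow_dom X i j \<xi> \<in>
             connected_components_of (subtopology (chart_top X i) (chart_preimage X i W)) \<and>
           arrow_range X i j \<xi> \<in>
             connected_components_of (subtopology (chart_top X j) (chart_preimage X j W))"
    and arrow_homeomorphic:
      "\<lbrakk>i \<in> charts X; j \<in> charts X; \<xi> \<in> arrows X i j\<rbrakk> \<Longrightarrow>
         homeomorphic_map (subtopology (chart_top X i) (arrow_dom X i j \<xi>))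
           (subtopology (chart_top X j) (arrow_range X i j \<xi>)) (arrow_map X i j \<xi>)"
    and arrow_proj:
      "\<lbrakk>i \<in> charts X; j \<in> charts X; \<xi> \<in> arrows X i j; x \<in> arrow_dom X i j \<xi>\<rbrakk> \<Longrightarrow>
         chart_proj X j (arrow_map X i j \<xi> x) = chart_proj X i x"
    and comp_locally_constant:
      "\<lbrakk>i \<in> charts X; j \<in> charts X; k \<in> charts X; \<xi> \<in> arrows X i j; \<eta> \<in> arrows X j k\<rbrakk> \<Longrightarrow>
         continuous_map (subtopology (chart_top X i) (comp_dom X i j k \<eta> \<xi>))
           (discrete_topology (arrows X i k)) (arrow_comp X i j k \<eta> \<xi>)"
    and comp_map:
      "\<lbrakk>i \<in> charts X; j \<in> charts X; k \<in> charts X; \<xi> \<in> arrows X i j; \<eta> \<in> arrows X j k;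
         x \<in> comp_dom X i j k \<eta> \<xi>\<rbrakk> \<Longrightarrow>
         x \<in> arrow_dom X i k (arrow_comp X i j k \<eta> \<xi> x) \<and>
         arrow_map X i k (arrow_comp X i j k \<eta> \<xi> x) x = arrow_map X j k \<eta> (arrow_map X i j \<xi> x)"
    and comp_assoc:
      "\<lbrakk>i \<in> charts X; j \<in> charts X; k \<in> charts X; l \<in> charts X;
         \<xi> \<in> arrows X i j; \<eta> \<in> arrows X j k; \<zeta> \<in> arrows X k l;
         x \<in> comp_dom X i j k \<eta> \<xi>; arrow_map X i j \<xi> x \<in> comp_dom X j k l \<zeta> \<eta>\<rbrakk> \<Longrightarrow>
         arrow_comp X i j l (arrow_comp X j k l \<zeta> \<eta> (arrow_map X i j \<xi> x)) \<xi> x =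
         arrow_comp X i k l \<zeta> (arrow_comp X i j k \<eta> \<xi> x) x"
    and comp_group:
      "\<lbrakk>i \<in> charts X; g \<in> arrows X i i; h \<in> arrows X i i; x \<in> topspace (chart_top X i)\<rbrakk> \<Longrightarrow>
         arrow_comp X i i i g h x = g \<otimes>\<^bsub>chart_group X i\<^esub> h"
    and comp_one_left:
      "\<lbrakk>i \<in> charts X; j \<in> charts X; \<xi> \<in> arrows X i j; x \<in> arrow_dom X i j \<xi>\<rbrakk> \<Longrightarrow>
         arrow_comp X i j j \<one>\<^bsub>chart_group X j\<^esub> \<xi> x = \<xi>"
    and comp_one_right:
      "\<lbrakk>i \<in> charts X; j \<in> charts X; \<xi> \<in> arrows X i j; x \<in> arrow_dom X i j \<xi>\<rbrakk> \<Longrightarrow>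
         arrow_comp X i i j \<xi> \<one>\<^bsub>chart_group X i\<^esub> x = \<xi>"
    and arrow_inv:
      "\<lbrakk>i \<in> charts X; j \<in> charts X; \<xi> \<in> arrows X i j\<rbrakk> \<Longrightarrow>
         arrow_inv X i j \<xi> \<in> arrows X j i \<and>
         arrow_dom X j i (arrow_inv X i j \<xi>) = arrow_range X i j \<xi> \<and>
         arrow_range X j i (arrow_inv X i j \<xi>) = arrow_dom X i j \<xi>"
    and arrow_inv_comp_left:
      "\<lbrakk>i \<in> charts X; j \<in> charts X; \<xi> \<in> arrows X i j; x \<in> arrow_dom X i j \<xi>\<rbrakk> \<Longrightarrow>
         x \<in> comp_dom X i j i (arrow_inv X i j \<xi>) \<xi> \<and>
         arrow_comp X i j i (arrow_inv X i j \<xi>) \<xi> x = \<one>\<^bsub>chart_group X i\<^esub>"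
    and arrow_inv_comp_right:
      "\<lbrakk>i \<in> charts X; j \<in> charts X; \<xi> \<in> arrows X i j; y \<in> arrow_range X i j \<xi>\<rbrakk> \<Longrightarrow>
         y \<in> comp_dom X j i j \<xi> (arrow_inv X i j \<xi>) \<and>
         arrow_comp X j i j \<xi> (arrow_inv X i j \<xi>) y = \<one>\<^bsub>chart_group X j\<^esub>"
    and same_image_iff:
      "\<lbrakk>i \<in> charts X; j \<in> charts X; x \<in> topspace (chart_top X i); y \<in> topspace (chart_top X j)\<rbrakk> \<Longrightarrow>
         chart_proj X i x = chart_proj X j y \<longleftrightarrow>
         (\<exists>\<xi>\<in>arrows X i j. x \<in> arrow_dom X i j \<xi> \<and> arrow_map X i j \<xi> x = y)"

definition is_cover :: "('x, 'i, 'p, 't) orbi_atlas \<Rightarrow> 'i set \<Rightarrow> bool" where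
  "is_cover X A \<longleftrightarrow> A \<subseteq> charts X \<and> (\<Union>i\<in>A. chart_set X i) = topspace (orbi_top X)"


section \<open>Homomorphisms\<close>

text \<open>
  A homomorphism \<open>({f\<^sub>\<alpha>}, {\<rho>\<^sub>\<beta>\<^sub>\<alpha>}) : \<Gamma>{U\<^sub>\<alpha>} \<rightarrow> \<Gamma>{U'\<^sub>\<alpha>\<^sub>'}\<close>: the families of charts are
  \<open>hsrc\<close> and \<open>htgt\<close>, the assignment of charts is \<open>hchart\<close>, and \<open>\<rho>\<^sub>\<beta>\<^sub>\<alpha>\<close> is \<open>hrho \<sigma> \<alpha> \<beta>\<close>.
\<close>

record ('i, 'p, 't, 'j, 'q, 's) orbi_hom =
  hsrc :: "'i set"
  htgt :: "'j set"
  hchart :: "'i \<Rightarrow> 'j"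
  hmap :: "'i \<Rightarrow> 'p \<Rightarrow> 'q"
  hrho :: "'i \<Rightarrow> 'i \<Rightarrow> 't \<Rightarrow> 's"

definition is_hom :: "('x, 'i, 'p, 't) orbi_atlas \<Rightarrow> ('y, 'j, 'q, 's) orbi_atlas \<Rightarrow>
    ('i, 'p, 't, 'j, 'q, 's) orbi_hom \<Rightarrow> bool" where
  "is_hom X Y \<sigma> \<longleftrightarrow>
     hsrc \<sigma> \<subseteq> charts X \<and> htgt \<sigma> \<subseteq> charts Y \<and> hchart \<sigma> ` hsrc \<sigma> \<subseteq> htgt \<sigma> \<and>
     (\<forall>a\<in>hsrc \<sigma>. continuous_map (chart_top X a) (chart_top Y (hchart \<sigma> a)) (hmap \<sigma> a)) \<and>
     (\<forall>a\<in>hsrc \<sigma>. \<forall>b\<in>hsrc \<sigma>. \<forall>\<xi>\<in>arrows X a b.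
        hrho \<sigma> a b \<xi> \<in> arrows Y (hchart \<sigma> a) (hchart \<sigma> b) \<and>
        (\<forall>x\<in>arrow_dom X a b \<xi>.
           hmap \<sigma> a x \<in> arrow_dom Y (hchart \<sigma> a) (hchart \<sigma> b) (hrho \<sigma> a b \<xi>) \<and>
           arrow_map Y (hchart \<sigma> a) (hchart \<sigma> b) (hrho \<sigma> a b \<xi>) (hmap \<sigma> a x) =
           hmap \<sigma> b (arrow_map X a b \<xi> x))) \<and>
     (\<forall>a\<in>hsrc \<sigma>. \<forall>b\<in>hsrc \<sigma>. \<forall>c\<in>hsrc \<sigma>. \<forall>\<xi>\<in>arrows X a b. \<forall>\<eta>\<in>arrows X b c.
        \<forall>x\<in>comp_dom X a b c \<eta> \<xi>.
          hrho \<sigma> a c (arrow_comp X a b c \<eta> \<xi> x) =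
          arrow_comp Y (hchart \<sigma> a) (hchart \<sigma> b) (hchart \<sigma> c)
            (hrho \<sigma> b c \<eta>) (hrho \<sigma> a b \<xi>) (hmap \<sigma> a x))"

definition cover_homs :: "('x, 'i, 'p, 't) orbi_atlas \<Rightarrow> ('y, 'j, 'q, 's) orbi_atlas \<Rightarrow>
    ('i, 'p, 't, 'j, 'q, 's) orbi_hom set" where
  "cover_homs X Y = {\<sigma>. is_hom X Y \<sigma> \<and> is_cover X (hsrc \<sigma>)}"

definition underlying_map :: "('x, 'i, 'p, 't) orbi_atlas \<Rightarrow> ('y, 'j, 'q, 's) orbi_atlas \<Rightarrow>
    ('i, 'p, 't, 'j, 'q, 's) orbi_hom \<Rightarrow> 'x \<Rightarrow> 'y" where
  "underlying_map X Y \<sigma> p =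
     (THE q. \<exists>a\<in>hsrc \<sigma>. \<exists>x\<in>topspace (chart_top X a).
        chart_proj X a x = p \<and> q = chart_proj Y (hchart \<sigma> a) (hmap \<sigma> a x))"


section \<open>Equivalence of homomorphisms and maps of orbispaces\<close>

text \<open>
  Below, \<open>e a\<close> and \<open>e' a\<close> are the \<open>\<xi>\<^sub>a\<close> and \<open>\<xi>'\<^sub>a\<close> of the definition, and \<open>\<delta>\<close> is
  \<open>\<xi>\<^sub>b \<circ> \<eta> \<circ> \<xi>\<^sub>a\<^sup>-\<^sup>1\<close>, formed at the image under the homeomorphism of \<open>\<xi>\<^sub>a\<close> of a point \<open>z\<close> of the
  domain of \<open>\<eta>\<close>.  That domain is connected and composites are locally constant,
  so \<open>\<delta>\<close> does not depend on \<open>z\<close>.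
\<close>

definition is_induced_by :: "('x, 'i, 'p, 't) orbi_atlas \<Rightarrow> ('y, 'j, 'q, 's) orbi_atlas \<Rightarrow>
    ('i, 'p, 't, 'j, 'q, 's) orbi_hom \<Rightarrow> ('i, 'p, 't, 'j, 'q, 's) orbi_hom \<Rightarrow> bool" where
  "is_induced_by X Y \<kappa> \<sigma> \<longleftrightarrow>
     \<sigma> \<in> cover_homs X Y \<and> \<kappa> \<in> cover_homs X Y \<and>
     (\<forall>a\<in>hsrc \<kappa>. underlying_map X Y \<sigma> ` chart_set X a \<subseteq> chart_set Y (hchart \<kappa> a)) \<and>
     (\<exists>\<theta> e e'.
        (\<forall>a\<in>hsrc \<kappa>.
           \<theta> a \<in> hsrc \<sigma> \<and> chart_set X a \<subseteq> chart_set X (\<theta> a) \<and>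
           e a \<in> arrows X a (\<theta> a) \<and>
           e' a \<in> arrows Y (hchart \<kappa> a) (hchart \<sigma> (\<theta> a)) \<and>
           (\<forall>x\<in>topspace (chart_top X a).
              hmap \<sigma> (\<theta> a) (arrow_map X a (\<theta> a) (e a) x)
                \<in> arrow_range Y (hchart \<kappa> a) (hchart \<sigma> (\<theta> a)) (e' a) \<and>
              hmap \<kappa> a x =
                inv_into (arrow_dom Y (hchart \<kappa> a) (hchart \<sigma> (\<theta> a)) (e' a))
                  (arrow_map Y (hchart \<kappa> a) (hchart \<sigma> (\<theta> a)) (e' a))
                  (hmap \<sigma> (\<theta> a) (arrow_map X a (\<theta> a) (e a) x)))) \<and>
        (\<forall>a\<in>hsrc \<kappa>. \<forall>b\<in>hsrc \<kappa>. \<forall>\<eta>\<in>arrows X a b. \<forall>z\<in>arrow_dom X a b \<eta>.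
           let \<delta> = arrow_comp X (\<theta> a) a (\<theta> b)
                     (arrow_comp X a b (\<theta> b) (e b) \<eta> z)
                     (arrow_inv X a (\<theta> a) (e a))
                     (arrow_map X a (\<theta> a) (e a) z);
               x = hmap \<kappa> a z
           in hrho \<kappa> a b \<eta> =
              arrow_comp Y (hchart \<kappa> a) (hchart \<sigma> (\<theta> b)) (hchart \<kappa> b)
                (arrow_inv Y (hchart \<kappa> b) (hchart \<sigma> (\<theta> b)) (e' b))
                (arrow_comp Y (hchart \<kappa> a) (hchart \<sigma> (\<theta> a)) (hchart \<sigma> (\<theta> b))
                  (hrho \<sigma> (\<theta> a) (\<theta> b) \<delta>) (e' a) x)
                x))"

definition hom_equiv :: "('x, 'i, 'p, 't) orbi_atlas \<Rightarrow> ('y, 'j, 'q, 's) orbi_atlas \<Rightarrow>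
    (('i, 'p, 't, 'j, 'q, 's) orbi_hom \<times> ('i, 'p, 't, 'j, 'q, 's) orbi_hom) set" where
  "hom_equiv X Y = {(\<sigma>, \<tau>). \<exists>\<kappa>. is_induced_by X Y \<kappa> \<sigma> \<and> is_induced_by X Y \<kappa> \<tau>}"

definition orbi_maps :: "('x, 'i, 'p, 't) orbi_atlas \<Rightarrow> ('y, 'j, 'q, 's) orbi_atlas \<Rightarrow>
    ('i, 'p, 't, 'j, 'q, 's) orbi_hom set set" where
  "orbi_maps X Y = cover_homs X Y // hom_equiv X Y"

definition hom_class :: "('x, 'i, 'p, 't) orbi_atlas \<Rightarrow> ('y, 'j, 'q, 's) orbi_atlas \<Rightarrow>
    ('i, 'p, 't, 'j, 'q, 's) orbi_hom \<Rightarrow> ('i, 'p, 't, 'j, 'q, 's) orbi_hom set" where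
  "hom_class X Y \<sigma> = hom_equiv X Y `` {\<sigma>}"


section \<open>Identities and composition\<close>

definition id_hom :: "'i set \<Rightarrow> ('i, 'p, 't, 'i, 'p, 't) orbi_hom" where
  "id_hom A = \<lparr>hsrc = A, htgt = A, hchart = (\<lambda>a. a), hmap = (\<lambda>a x. x), hrho = (\<lambda>a b \<xi>. \<xi>)\<rparr>"

definition composable :: "('j, 'q, 's, 'k, 'r, 'u) orbi_hom \<Rightarrow>
    ('i, 'p, 't, 'j, 'q, 's) orbi_hom \<Rightarrow> bool" where
  "composable \<tau> \<sigma> \<longleftrightarrow> hchart \<sigma> ` hsrc \<sigma> \<subseteq> hsrc \<tau>"

definition hom_comp :: "('j, 'q, 's, 'k, 'r, 'u) orbi_hom \<Rightarrow>
    ('i, 'p, 't, 'j, 'q, 's) orbi_hom \<Rightarrow> ('i, 'p, 't, 'k, 'r, 'u) orbi_hom" where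
  "hom_comp \<tau> \<sigma> =
     \<lparr>hsrc = hsrc \<sigma>, htgt = htgt \<tau>,
      hchart = (\<lambda>i. hchart \<tau> (hchart \<sigma> i)),
      hmap = (\<lambda>i x. hmap \<tau> (hchart \<sigma> i) (hmap \<sigma> i x)),
      hrho = (\<lambda>i j \<xi>. hrho \<tau> (hchart \<sigma> i) (hchart \<sigma> j) (hrho \<sigma> i j \<xi>))\<rparr>"

definition orbi_comp :: "('x, 'i, 'p, 't) orbi_atlas \<Rightarrow> ('z, 'k, 'r, 'u) orbi_atlas \<Rightarrow>
    ('j, 'q, 's, 'k, 'r, 'u) orbi_hom set \<Rightarrow> ('i, 'p, 't, 'j, 'q, 's) orbi_hom set \<Rightarrow>
    ('i, 'p, 't, 'k, 'r, 'u) orbi_hom set" where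
  "orbi_comp X Z \<Psi> \<Phi> =
     (THE \<Theta>. \<exists>\<tau>\<in>\<Psi>. \<exists>\<sigma>\<in>\<Phi>. composable \<tau> \<sigma> \<and> \<Theta> = hom_class X Z (hom_comp \<tau> \<sigma>))"

text \<open>In \<open>is_category\<close>, \<open>Comp X Y Z g f\<close> is the composite of \<open>f : X \<rightarrow> Y\<close> and \<open>g : Y \<rightarrow> Z\<close>.\<close>

definition is_category :: "'o set \<Rightarrow> ('o \<Rightarrow> 'o \<Rightarrow> 'm set) \<Rightarrow> ('o \<Rightarrow> 'm) \<Rightarrow>
    ('o \<Rightarrow> 'o \<Rightarrow> 'o \<Rightarrow> 'm \<Rightarrow> 'm \<Rightarrow> 'm) \<Rightarrow> bool" where
  "is_category Obj Hom Idn Comp \<longleftrightarrow>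
     (\<forall>X\<in>Obj. Idn X \<in> Hom X X) \<and>
     (\<forall>X\<in>Obj. \<forall>Y\<in>Obj. \<forall>Z\<in>Obj. \<forall>f\<in>Hom X Y. \<forall>g\<in>Hom Y Z. Comp X Y Z g f \<in> Hom X Z) \<and>
     (\<forall>W\<in>Obj. \<forall>X\<in>Obj. \<forall>Y\<in>Obj. \<forall>Z\<in>Obj. \<forall>f\<in>Hom W X. \<forall>g\<in>Hom X Y. \<forall>h\<in>Hom Y Z.
        Comp W Y Z h (Comp W X Y g f) = Comp W X Z (Comp X Y Z h g) f) \<and>
     (\<forall>X\<in>Obj. \<forall>Y\<in>Obj. \<forall>f\<in>Hom X Y. Comp X X Y f (Idn X) = f \<and> Comp X Y Y (Idn Y) f = f)"

end

theory Submission
  imports Defs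
begin

text \<open>
  Everything rests on one notion.  A \<^emph>\<open>link\<close> between two homomorphisms \<open>\<sigma>\<close> and \<open>\<tau>\<close> from \<open>X\<close> to
  \<open>Y\<close> assigns to each \<open>\<xi> \<in> T(U\<^sub>a, U\<^sub>b)\<close>, with \<open>U\<^sub>a\<close> in the family of \<open>\<sigma>\<close> and \<open>U\<^sub>b\<close> in that of \<open>\<tau>\<close>, an
  element \<open>N(\<xi>)\<close> of the corresponding set \<open>T\<close> of \<open>Y\<close> that carries \<open>f\<^sub>a(x)\<close> to \<open>g\<^sub>b(\<phi>\<^sub>\<xi>(x))\<close> and satisfies
  \<open>N(\<xi> \<circ> \<zeta>) = N(\<xi>) \<circ> \<sigma>(\<zeta>)\<close> and \<open>N(\<eta> \<circ> \<xi>) = \<tau>(\<eta>) \<circ> N(\<xi>)\<close>.  This is a natural isomorphism of functors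
  in a form that mentions no index map, no refinement and no choice of \<open>\<xi>\<^sub>a\<close>, \<open>\<xi>'\<^sub>a\<close>.

  Two homomorphisms are equivalent iff they are linked (\<open>hom_equiv_iff_linked\<close>).  If \<open>\<kappa>\<close> is
  induced by \<open>\<sigma>\<close>, then \<open>N(\<xi>) = \<sigma>(\<xi> \<circ> \<xi>\<^sub>a\<^sup>-\<^sup>1) \<circ> \<xi>'\<^sub>a\<close> is a link from \<open>\<kappa>\<close> to \<open>\<sigma>\<close>; conversely, if \<open>\<kappa>\<close> is linked to
  \<open>\<tau>\<close> and its cover refines that of \<open>\<tau>\<close>, then \<open>\<xi>'\<^sub>a = N(\<xi>\<^sub>a)\<close> shows that \<open>\<kappa>\<close> is induced by \<open>\<tau>\<close>.  So it
  remains to see that links can be inverted (\<open>link_sym\<close>) and composed (\<open>link_trans\<close>), and that each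
  homomorphism can be restricted to a common refinement of two covers.  Several elements of
  sets \<open>T\<close> are constructed here one point at a time; they do not depend on the point because
  composites are locally constant and domains are connected.

  Links can also be composed horizontally: if \<open>N\<close> links \<open>\<sigma>\<close> to \<open>\<sigma>'\<close> and \<open>M\<close> links \<open>\<tau>\<close> to \<open>\<tau>'\<close>, then
  \<open>\<xi> \<mapsto> M(N(\<xi>))\<close> links \<open>\<tau> \<circ> \<sigma>\<close> to \<open>\<tau>' \<circ> \<sigma>'\<close> (\<open>link_hom_comp\<close>).  Hence composition is independent of
  representatives.  Associativity and the unit laws then hold because suitably chosen
  representatives satisfy them on the nose, or up to the family of target charts.

  For the existence of the composite, let \<open>\<sigma>\<close> represent the first map and let \<open>B\<close> be a cover of
  the target by charts.  The domain of an element of \<open>T(U\<^sub>i, U\<^sub>j)\<close> is a whole connected component of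
  the part of the chart of \<open>U\<^sub>i\<close> that lies over \<open>U\<^sub>i \<inter> U\<^sub>j\<close>.  If \<open>U\<^sub>c\<close> lies in a member \<open>U\<^sub>a\<close> of the
  cover of \<open>\<sigma>\<close> and is so small that the underlying map carries it into some member \<open>V\<close> of \<open>B\<close>,
  then \<open>f\<^sub>a\<close> maps the chart of \<open>U\<^sub>c\<close>, placed inside that of \<open>U\<^sub>a\<close>, onto a connected set lying over \<open>V\<close>.  So a
  single element of \<open>T\<close> moves all of this set into the chart of \<open>V\<close>
  (\<open>subordinate_chart_exists\<close>).
\<close>


section \<open>Topology of charts and arrows\<close>

lemma topspace_quotient_topology: "topspace (quotient_topology P q) = q ` topspace P"
proof
  show "topspace (quotient_topology P q) \<subseteq> q ` topspace P"
    unfolding topspace_def[of "quotient_topology P q"] by (auto simp: openin_quotient_topology)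
  have "{x \<in> topspace P. q x \<in> q ` topspace P} = topspace P" by blast
  then have "openin (quotient_topology P q) (q ` topspace P)"
    by (simp add: openin_quotient_topology)
  then show "q ` topspace P \<subseteq> topspace (quotient_topology P q)" by (rule openin_subset)
qed

context orbispace
begin

lemma chart_proj_surj:
  assumes "i \<in> charts X"
  shows "chart_proj X i ` topspace (chart_top X i) = chart_set X i"
proof -
  let ?P = "chart_top X i" and ?q = "orbit (chart_group X i) (arrow_map X i i)"
  obtain h where h: "homeomorphic_map (quotient_topology ?P ?q)
      (subtopology (orbi_top X) (chart_set X i)) h"
    and hq: "\<And>x. x \<in> topspace ?P \<Longrightarrow> h (?q x) = chart_proj X i x"
    using chart_quotient[OF assms] unfolding orbit_space_def by blast
  show ?thesis
    using homeomorphic_imp_surjective_map[OF h] chart_set_open[OF assms] hq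
    by (simp add: topspace_quotient_topology openin_subset inf_absorb2 image_image)
qed

text \<open>
  A chart projection is the quotient map of a group acting by homeomorphisms: the saturation of an
  open set \<open>S\<close> is the union of the open sets of points that some group element carries into \<open>S\<close>.
\<close>

lemma chart_proj_quotient:
  assumes i: "i \<in> charts X"
  shows "continuous_map (chart_top X i) (orbi_top X) (chart_proj X i)"
    and "open_map (chart_top X i) (orbi_top X) (chart_proj X i)"
proof -
  let ?P = "chart_top X i" and ?q = "orbit (chart_group X i) (arrow_map X i i)"
  let ?Q = "quotient_topology ?P ?q"
  obtain h where h: "homeomorphic_map ?Q (subtopology (orbi_top X) (chart_set X i)) h"
    and hq: "\<And>x. x \<in> topspace ?P \<Longrightarrow> h (?q x) = chart_proj X i x"
    using chart_quotient[OF i] unfolding orbit_space_def by blast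
  have topQ: "topspace ?Q = ?q ` topspace ?P" by (rule topspace_quotient_topology)
  have "continuous_map ?P ?Q ?q"
    unfolding continuous_map_def by (auto simp: topQ openin_quotient_topology)
  then have "continuous_map ?P (orbi_top X) (h \<circ> ?q)"
    using continuous_map_compose[OF _ homeomorphic_imp_continuous_map[OF h]]
      continuous_map_into_fulltopology by blast
  then show "continuous_map ?P (orbi_top X) (chart_proj X i)"
    by (rule continuous_map_eq) (simp add: hq)
  show "open_map ?P (orbi_top X) (chart_proj X i)"
    unfolding open_map_def
  proof (intro allI impI)
    fix S assume S: "openin ?P S"
    have sub: "S \<subseteq> topspace ?P" using S by (rule openin_subset)
    have inj: "inj_on h (?q ` topspace ?P)"
      using homeomorphic_imp_injective_map[OF h] topQ by simp
    \<comment> \<open>Orbits are the fibres of the projection, so the saturation can be read off from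
      \<open>same_image_iff\<close>, whose arrows from a chart to itself are the group elements.\<close>
    have "{x \<in> topspace ?P. ?q x \<in> ?q ` S} =
        (\<Union>g\<in>arrows X i i. {x \<in> topspace ?P. arrow_map X i i g x \<in> S})" (is "?L = ?R")
    proof (rule Set.set_eqI)
      fix x
      have "x \<in> ?L \<longleftrightarrow> x \<in> topspace ?P \<and> (\<exists>y\<in>S. chart_proj X i x = chart_proj X i y)"
        using inj sub hq by (smt (verit, best) image_iff inj_on_def mem_Collect_eq subsetD)
      also have "\<dots> \<longleftrightarrow> x \<in> ?R"
      proof (cases "x \<in> topspace ?P")
        case True
        then have "(\<exists>y\<in>S. chart_proj X i x = chart_proj X i y) \<longleftrightarrow>
            (\<exists>y\<in>S. \<exists>g\<in>arrows X i i. arrow_map X i i g x = y)"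
          using same_image_iff[OF i i True] arrow_dom_same[OF i] sub True
          by (intro bex_cong refl) (metis subsetD)
        then show ?thesis using True by blast
      qed simp
      finally show "x \<in> ?L \<longleftrightarrow> x \<in> ?R" .
    qed
    moreover have "openin ?P {x \<in> topspace ?P. arrow_map X i i g x \<in> S}"
      if g: "g \<in> arrows X i i" for g
    proof -
      have "continuous_map ?P ?P (arrow_map X i i g)"
        using homeomorphic_imp_continuous_map[OF arrow_homeomorphic[OF i i g]]
        by (simp add: arrow_dom_same[OF i g] continuous_map_in_subtopology)
      then show ?thesis using S by (rule openin_continuous_map_preimage)
    qed
    ultimately have "openin ?Q (?q ` S)"
      using sub by (auto simp: openin_quotient_topology)
    then have "openin (subtopology (orbi_top X) (chart_set X i)) (h ` ?q ` S)"
      using homeomorphic_imp_open_map[OF h] by (simp add: open_map_def)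
    then have "openin (orbi_top X) (h ` ?q ` S)"
      using chart_set_open[OF i] openin_trans_full by blast
    moreover have "h ` ?q ` S = chart_proj X i ` S"
      using hq sub by (force simp: image_image)
    ultimately show "openin (orbi_top X) (chart_proj X i ` S)" by simp
  qed
qed

lemma chart_proj_in: "\<lbrakk>i \<in> charts X; x \<in> topspace (chart_top X i)\<rbrakk> \<Longrightarrow> chart_proj X i x \<in> chart_set X i"
  using chart_proj_surj by blast

lemma chart_lift:
  assumes "i \<in> charts X" "p \<in> chart_set X i"
  obtains x where "x \<in> topspace (chart_top X i)" "chart_proj X i x = p"
  using assms chart_proj_surj by (metis imageE)

lemma chart_nonempty: "i \<in> charts X \<Longrightarrow> topspace (chart_top X i) \<noteq> {}"
  using chart_proj_surj chart_set_nonempty by (metis image_empty)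

text \<open>
  Local connectedness provides a connected open neighbourhood of \<open>x\<close> inside \<open>S\<close>; its projection is
  open and connected, hence a member of the enlarged atlas.
\<close>

lemma small_chart_exists:
  assumes i: "i \<in> charts X" and S: "openin (chart_top X i) S" and x: "x \<in> S"
  shows "\<exists>c\<in>charts X. chart_proj X i x \<in> chart_set X c \<and> chart_set X c \<subseteq> chart_proj X i ` S"
proof -
  let ?P = "chart_top X i"
  have xP: "x \<in> topspace ?P" using S x openin_subset by blast
  obtain V where V: "openin ?P V" "connectedin ?P V" "x \<in> V" "V \<subseteq> S"
    using chart_locally_connected[OF i] S x unfolding locally_connected_space by blast
  have "openin (orbi_top X) (chart_proj X i ` V)" "connectedin (orbi_top X) (chart_proj X i ` V)"
    using chart_proj_quotient[OF i] V connectedin_continuous_map_image by (auto simp: open_map_def)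
  moreover have "chart_proj X i ` V \<noteq> {}" using V by blast
  moreover have "chart_proj X i ` V \<subseteq> chart_set X i"
    using V(1) openin_subset chart_proj_in[OF i] by blast
  ultimately obtain c where "c \<in> charts X" "chart_set X c = chart_proj X i ` V"
    using charts_enlarged[OF i] by meson
  then show ?thesis using V by (metis image_eqI image_mono)
qed

text \<open>
  Domains of arrows are components of the preimage of the whole intersection \<open>U\<^sub>i \<inter> U\<^sub>j\<close>, not only
  of the preimage of one component \<open>W\<close> of it: a connected set of chart points that lie over the
  intersection has connected image, hence lies over a single \<open>W\<close>.
\<close>

lemma component_over_component:
  assumes i: "i \<in> charts X"
    and W: "W \<in> connected_components_of (subtopology (orbi_top X) S)"
    and D: "D \<in> connected_components_of (subtopology (chart_top X i) (chart_preimage X i W))"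
  shows "D \<in> connected_components_of (subtopology (chart_top X i) (chart_preimage X i S))"
proof -
  have WS: "W \<subseteq> S" using connected_components_of_subset[OF W] by auto
  have DW: "connectedin (chart_top X i) D" "D \<subseteq> chart_preimage X i W" "D \<noteq> {}"
    using connectedin_connected_components_of[OF D] nonempty_connected_components_of[OF D]
    by (auto simp: connectedin_subtopology)
  have D': "connectedin (subtopology (chart_top X i) (chart_preimage X i S)) D"
    using DW WS by (force simp: connectedin_subtopology chart_preimage_def)
  then obtain E where E: "E \<in> connected_components_of (subtopology (chart_top X i) (chart_preimage X i S))"
    and DE: "D \<subseteq> E"
    using exists_connected_component_of_superset[OF D'] DW(3) connectedin_subset_topspace[OF D']
    by (metis subset_empty topspace_discrete_topology)
  have conE: "connectedin (chart_top X i) E" and ES: "E \<subseteq> chart_preimage X i S"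
    using connectedin_connected_components_of[OF E] by (auto simp: connectedin_subtopology)
  have "connectedin (subtopology (orbi_top X) S) (chart_proj X i ` E)"
    using connectedin_continuous_map_image[OF chart_proj_quotient(1)[OF i] conE] ES
    by (auto simp: connectedin_subtopology chart_preimage_def)
  moreover have "\<not> disjnt W (chart_proj X i ` E)"
    using DE DW by (auto simp: disjnt_iff chart_preimage_def)
  ultimately have "chart_proj X i ` E \<subseteq> W"
    using connected_components_of_maximal[OF W] by blast
  then have "connectedin (subtopology (chart_top X i) (chart_preimage X i W)) E"
    using conE ES by (auto simp: connectedin_subtopology chart_preimage_def)
  then have "E \<subseteq> D"
    using connected_components_of_maximal[OF D] DE DW(3) by (meson disjnt_subset1 disjnt_self_iff_empty disjnt_subset2)
  then show ?thesis using E DE by simp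
qed

lemma arrow_dom_component:
  assumes "i \<in> charts X" "j \<in> charts X" "\<xi> \<in> arrows X i j"
  shows "arrow_dom X i j \<xi> \<in> connected_components_of
      (subtopology (chart_top X i) (chart_preimage X i (chart_set X i \<inter> chart_set X j)))"
    and "arrow_range X i j \<xi> \<in> connected_components_of
      (subtopology (chart_top X j) (chart_preimage X j (chart_set X i \<inter> chart_set X j)))"
  using arrow_component[OF assms] component_over_component assms by blast+

lemma
  assumes i: "i \<in> charts X" and j: "j \<in> charts X" and \<xi>: "\<xi> \<in> arrows X i j"
  shows arrow_dom_connected: "connectedin (chart_top X i) (arrow_dom X i j \<xi>)"
    and arrow_dom_open: "openin (chart_top X i) (arrow_dom X i j \<xi>)"
    and arrow_dom_nonempty: "arrow_dom X i j \<xi> \<noteq> {}"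
proof -
  let ?S = "chart_preimage X i (chart_set X i \<inter> chart_set X j)"
  note D = arrow_dom_component(1)[OF assms]
  show "connectedin (chart_top X i) (arrow_dom X i j \<xi>)"
    using connectedin_connected_components_of[OF D] by (simp add: connectedin_subtopology)
  show "arrow_dom X i j \<xi> \<noteq> {}" by (rule nonempty_connected_components_of[OF D])
  have S: "openin (chart_top X i) ?S"
    unfolding chart_preimage_def
    by (intro openin_continuous_map_preimage[OF chart_proj_quotient(1)[OF i]] openin_Int
        chart_set_open i j)
  then have "openin (subtopology (chart_top X i) ?S) (arrow_dom X i j \<xi>)"
    using openin_connected_components_of_locally_connected_space D
      locally_connected_space_open_subset[OF chart_locally_connected[OF i]] by blast
  then show "openin (chart_top X i) (arrow_dom X i j \<xi>)"
    using S openin_trans_full by blast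
qed

lemma arrow_dom_subset:
  "\<lbrakk>i \<in> charts X; j \<in> charts X; \<xi> \<in> arrows X i j\<rbrakk> \<Longrightarrow> arrow_dom X i j \<xi> \<subseteq> topspace (chart_top X i)"
  using arrow_dom_open openin_subset by blast

text \<open>
  This is how a single arrow is made to serve a whole connected set: that set meets the range and
  lies over \<open>U\<^sub>i\<close>, and the range is a component of the part of the chart over \<open>U\<^sub>i \<inter> U\<^sub>j\<close>.
\<close>

lemma arrow_range_maximal:
  assumes "i \<in> charts X" "j \<in> charts X" "\<xi> \<in> arrows X i j"
    and "connectedin (chart_top X j) S" "S \<inter> arrow_range X i j \<xi> \<noteq> {}"
    and "chart_proj X j ` S \<subseteq> chart_set X i"
  shows "S \<subseteq> arrow_range X i j \<xi>"
proof (rule connected_components_of_maximal[OF arrow_dom_component(2)[OF assms(1-3)]])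
  have "S \<subseteq> topspace (chart_top X j)" using assms(4) connectedin_subset_topspace by blast
  then have "S \<subseteq> chart_preimage X j (chart_set X i \<inter> chart_set X j)"
    using assms(6) chart_proj_in[OF assms(2)] by (auto simp: chart_preimage_def)
  then show "connectedin (subtopology (chart_top X j)
      (chart_preimage X j (chart_set X i \<inter> chart_set X j))) S"
    using assms(4) by (simp add: connectedin_subtopology)
  show "\<not> disjnt (arrow_range X i j \<xi>) S" using assms(5) by (auto simp: disjnt_def)
qed

text \<open>
  When \<open>U\<^sub>i \<subseteq> U\<^sub>j\<close>, the chart of \<open>U\<^sub>i\<close> lies over \<open>U\<^sub>i \<inter> U\<^sub>j\<close> entirely and is connected, so it is its
  own only component.
\<close>

lemma arrow_dom_total:
  assumes i: "i \<in> charts X" and j: "j \<in> charts X" and \<xi>: "\<xi> \<in> arrows X i j"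
    and sub: "chart_set X i \<subseteq> chart_set X j"
  shows "arrow_dom X i j \<xi> = topspace (chart_top X i)"
proof
  show "arrow_dom X i j \<xi> \<subseteq> topspace (chart_top X i)" by (rule arrow_dom_subset[OF i j \<xi>])
  have "topspace (chart_top X i) = chart_preimage X i (chart_set X i \<inter> chart_set X j)"
    using chart_proj_in[OF i] sub by (auto simp: chart_preimage_def)
  then have "connectedin (subtopology (chart_top X i) (chart_preimage X i (chart_set X i \<inter> chart_set X j)))
      (topspace (chart_top X i))"
    using chart_connected[OF i] by (metis connectedin_topspace subtopology_topspace)
  moreover have "\<not> disjnt (arrow_dom X i j \<xi>) (topspace (chart_top X i))"
    using arrow_dom_subset[OF i j \<xi>] arrow_dom_nonempty[OF i j \<xi>] by (auto simp: disjnt_def)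
  ultimately show "topspace (chart_top X i) \<subseteq> arrow_dom X i j \<xi>"
    using connected_components_of_maximal[OF arrow_dom_component(1)[OF i j \<xi>]] by blast
qed

lemma arrow_map_continuous:
  assumes "i \<in> charts X" "j \<in> charts X" "\<xi> \<in> arrows X i j"
  shows "continuous_map (subtopology (chart_top X i) (arrow_dom X i j \<xi>)) (chart_top X j)
      (arrow_map X i j \<xi>)"
  using homeomorphic_imp_continuous_map[OF arrow_homeomorphic[OF assms]]
  by (simp add: continuous_map_in_subtopology)

lemma arrow_map_inj:
  assumes "i \<in> charts X" "j \<in> charts X" "\<xi> \<in> arrows X i j"
  shows "inj_on (arrow_map X i j \<xi>) (arrow_dom X i j \<xi>)"
  using homeomorphic_imp_injective_map[OF arrow_homeomorphic[OF assms]] arrow_dom_subset[OF assms]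
  by (simp add: inf_absorb2)

lemma arrow_map_in:
  assumes "i \<in> charts X" "j \<in> charts X" "\<xi> \<in> arrows X i j" "x \<in> arrow_dom X i j \<xi>"
  shows "arrow_map X i j \<xi> x \<in> topspace (chart_top X j)"
  using continuous_map_image_subset_topspace[OF arrow_map_continuous[OF assms(1-3)]]
    arrow_dom_subset[OF assms(1-3)] assms(4) by auto

lemma openin_arrow_preimage:
  assumes "i \<in> charts X" "j \<in> charts X" "\<xi> \<in> arrows X i j" "openin (chart_top X j) V"
  shows "openin (chart_top X i) {x \<in> arrow_dom X i j \<xi>. arrow_map X i j \<xi> x \<in> V}"
proof -
  have "openin (subtopology (chart_top X i) (arrow_dom X i j \<xi>))
      {x \<in> topspace (subtopology (chart_top X i) (arrow_dom X i j \<xi>)). arrow_map X i j \<xi> x \<in> V}"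
    by (rule openin_continuous_map_preimage[OF arrow_map_continuous[OF assms(1-3)] assms(4)])
  then show ?thesis
    using openin_trans_full[OF _ arrow_dom_open[OF assms(1-3)]] arrow_dom_subset[OF assms(1-3)]
    by (simp add: inf_absorb2)
qed

lemma comp_dom_open:
  assumes "i \<in> charts X" "j \<in> charts X" "k \<in> charts X" "\<xi> \<in> arrows X i j" "\<eta> \<in> arrows X j k"
  shows "openin (chart_top X i) (comp_dom X i j k \<eta> \<xi>)"
  unfolding comp_dom_def using assms by (intro openin_arrow_preimage arrow_dom_open)

lemma arrow_comp_in:
  assumes "i \<in> charts X" "j \<in> charts X" "k \<in> charts X" "\<xi> \<in> arrows X i j" "\<eta> \<in> arrows X j k"
    and "x \<in> comp_dom X i j k \<eta> \<xi>"
  shows "arrow_comp X i j k \<eta> \<xi> x \<in> arrows X i k"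
proof -
  have "comp_dom X i j k \<eta> \<xi> \<subseteq> topspace (chart_top X i)"
    using comp_dom_open[OF assms(1-5)] openin_subset by blast
  then show ?thesis
    using continuous_map_image_subset_topspace[OF comp_locally_constant[OF assms(1-5)]] assms(6)
    by auto
qed

lemma arrow_comp_locally_constant:
  assumes "i \<in> charts X" "j \<in> charts X" "k \<in> charts X" "\<xi> \<in> arrows X i j" "\<eta> \<in> arrows X j k"
    and x: "x \<in> comp_dom X i j k \<eta> \<xi>"
  shows "\<exists>U. openin (chart_top X i) U \<and> x \<in> U \<and>
    (\<forall>y\<in>U. arrow_comp X i j k \<eta> \<xi> y = arrow_comp X i j k \<eta> \<xi> x)"
proof -
  let ?C = "comp_dom X i j k \<eta> \<xi>" and ?c = "arrow_comp X i j k \<eta> \<xi>"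
  have C: "openin (chart_top X i) ?C" by (rule comp_dom_open[OF assms(1-5)])
  have top: "topspace (subtopology (chart_top X i) ?C) = ?C"
    using openin_subset[OF C] by (simp add: inf_absorb2)
  have "openin (discrete_topology (arrows X i k)) {?c x}"
    using arrow_comp_in[OF assms] by simp
  then have "openin (subtopology (chart_top X i) ?C) {y \<in> ?C. ?c y \<in> {?c x}}"
    using openin_continuous_map_preimage[OF comp_locally_constant[OF assms(1-5)], unfolded top] by blast
  then have "openin (chart_top X i) {y \<in> ?C. ?c y = ?c x}"
    using openin_trans_full[OF _ C] by simp
  then show ?thesis using x by (intro exI[of _ "{y \<in> ?C. ?c y = ?c x}"]) simp
qed

lemma arrow_exists:
  assumes "i \<in> charts X" "j \<in> charts X" "x \<in> topspace (chart_top X i)"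
    and "chart_proj X i x \<in> chart_set X j"
  obtains \<xi> where "\<xi> \<in> arrows X i j" "x \<in> arrow_dom X i j \<xi>"
proof -
  obtain y where "y \<in> topspace (chart_top X j)" "chart_proj X j y = chart_proj X i x"
    using chart_lift[OF assms(2,4)] .
  then show ?thesis using that same_image_iff assms by metis
qed

end

text \<open>
  Local constancy is the only continuity property of arrows as elements of the discrete sets
  \<open>T(U\<^sub>i, U\<^sub>j)\<close>; together with connectedness of domains it makes pointwise constructions of arrows
  independent of the point.
\<close>

lemma locally_constant_on_connected:
  assumes S: "connectedin T S"
    and loc: "\<And>x. x \<in> S \<Longrightarrow> \<exists>U. openin T U \<and> x \<in> U \<and> (\<forall>y\<in>U \<inter> S. F y = F x)"
    and xy: "x \<in> S" "y \<in> S"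
  shows "F x = F y"
proof -
  have "continuous_map (subtopology T S) (discrete_topology (F ` S)) F"
    unfolding continuous_map_def
  proof (intro conjI allI impI)
    show "F \<in> topspace (subtopology T S) \<rightarrow> topspace (discrete_topology (F ` S))" by auto
    fix V
    show "openin (subtopology T S) {x \<in> topspace (subtopology T S). F x \<in> V}"
    proof (subst openin_subopen, intro ballI)
      fix x assume "x \<in> {x \<in> topspace (subtopology T S). F x \<in> V}"
      then have x: "x \<in> topspace T" "x \<in> S" "F x \<in> V" by auto
      obtain U where U: "openin T U" "x \<in> U" "\<forall>y\<in>U \<inter> S. F y = F x" using loc[OF x(2)] by blast
      have "openin (subtopology T S) (U \<inter> S)" using U(1) by (auto simp: openin_subtopology)
      moreover have "U \<inter> S \<subseteq> {x \<in> topspace (subtopology T S). F x \<in> V}"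
      proof
        fix y assume "y \<in> U \<inter> S"
        moreover from this have "F y \<in> V" using U(3) x(3) by metis
        ultimately show "y \<in> {x \<in> topspace (subtopology T S). F x \<in> V}"
          using openin_subset[OF U(1)] by auto
      qed
      ultimately show "\<exists>T'. openin (subtopology T S) T' \<and> x \<in> T' \<and>
          T' \<subseteq> {x \<in> topspace (subtopology T S). F x \<in> V}"
        using x U(2) by (intro exI[of _ "U \<inter> S"]) simp
    qed
  qed
  then have "connectedin (discrete_topology (F ` S)) (F ` S)"
    using S connectedin_continuous_map_image by (metis connectedin_subtopology subset_refl)
  then show ?thesis using xy by (auto simp: connectedin_discrete_topology)
qed


section \<open>The groupoid of germs\<close>

text \<open>
  The arrows \<open>(\<xi>, x)\<close> of the etale groupoid, as tuples that also record the chart of the source and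
  that of the target.  In this form the pointwise composites \<open>\<eta> \<circ> \<xi>(x)\<close> obey the laws of a
  groupoid, and the conditions on domains become equality of a source and a target.
\<close>

type_synonym ('i, 'p, 't) germ = "'i \<times> 'p \<times> 't \<times> 'i"

definition germs :: "('x, 'i, 'p, 't) orbi_atlas \<Rightarrow> ('i, 'p, 't) germ set" where
  "germs X = {(i, x, \<xi>, j). i \<in> charts X \<and> j \<in> charts X \<and> \<xi> \<in> arrows X i j \<and> x \<in> arrow_dom X i j \<xi>}"

definition germ_points :: "('x, 'i, 'p, 't) orbi_atlas \<Rightarrow> ('i \<times> 'p) set" where
  "germ_points X = {(i, x). i \<in> charts X \<and> x \<in> topspace (chart_top X i)}"

fun germ_src :: "('i, 'p, 't) germ \<Rightarrow> 'i \<times> 'p" where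
  "germ_src (i, x, \<xi>, j) = (i, x)"

fun germ_tgt :: "('x, 'i, 'p, 't) orbi_atlas \<Rightarrow> ('i, 'p, 't) germ \<Rightarrow> 'i \<times> 'p" where
  "germ_tgt X (i, x, \<xi>, j) = (j, arrow_map X i j \<xi> x)"

fun germ_arrow :: "('i, 'p, 't) germ \<Rightarrow> 't" where
  "germ_arrow (i, x, \<xi>, j) = \<xi>"

text \<open>
  Meaningful when the left factor starts where the right one ends; the laws below carry this condition.
\<close>

fun germ_comp :: "('i, 'p, 't) germ \<Rightarrow> ('x, 'i, 'p, 't) orbi_atlas \<Rightarrow> ('i, 'p, 't) germ \<Rightarrow> ('i, 'p, 't) germ"
  ("(_ \<cdot>\<^bsub>_\<^esub>/ _)" [71, 0, 70] 70)
  where "(j', y, \<eta>, k) \<cdot>\<^bsub>X\<^esub> (i, x, \<xi>, j) = (i, x, arrow_comp X i j k \<eta> \<xi> x, k)"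

fun germ_inv :: "('x, 'i, 'p, 't) orbi_atlas \<Rightarrow> ('i, 'p, 't) germ \<Rightarrow> ('i, 'p, 't) germ" where
  "germ_inv X (i, x, \<xi>, j) = (j, arrow_map X i j \<xi> x, arrow_inv X i j \<xi>, i)"

fun germ_id :: "('x, 'i, 'p, 't) orbi_atlas \<Rightarrow> 'i \<times> 'p \<Rightarrow> ('i, 'p, 't) germ" where
  "germ_id X (i, x) = (i, x, \<one>\<^bsub>chart_group X i\<^esub>, i)"

lemma germ_eqI:
  "\<lbrakk>germ_src g = germ_src h; germ_arrow g = germ_arrow h; fst (germ_tgt X g) = fst (germ_tgt X h)\<rbrakk> \<Longrightarrow> g = h"
  by (cases g; cases h) simp

lemma germ_src_comp [simp]: "germ_src (h \<cdot>\<^bsub>X\<^esub> g) = germ_src g"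
  by (cases g; cases h) simp

lemma fst_germ_tgt_comp [simp]: "fst (germ_tgt X (h \<cdot>\<^bsub>X\<^esub> g)) = fst (germ_tgt X h)"
  by (cases g; cases h) simp

lemma germ_src_inv [simp]: "germ_src (germ_inv X g) = germ_tgt X g"
  by (cases g) simp

lemma germ_src_id [simp]: "germ_src (germ_id X p) = p"
  by (cases p) simp

context orbispace
begin

lemma one_arrow:
  assumes i: "i \<in> charts X"
  shows "\<one>\<^bsub>chart_group X i\<^esub> \<in> arrows X i i"
    and "x \<in> topspace (chart_top X i) \<Longrightarrow> arrow_map X i i \<one>\<^bsub>chart_group X i\<^esub> x = x"
proof -
  interpret group_action "chart_group X i" "topspace (chart_top X i)"
    "\<lambda>g. restrict (arrow_map X i i g) (topspace (chart_top X i))"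
    by (rule chart_action[OF i])
  interpret group "chart_group X i" using group_hom group_hom.axioms(1) by blast
  show "\<one>\<^bsub>chart_group X i\<^esub> \<in> arrows X i i" using arrows_same[OF i] by simp
  show "x \<in> topspace (chart_top X i) \<Longrightarrow> arrow_map X i i \<one>\<^bsub>chart_group X i\<^esub> x = x"
    using id_eq_one by (metis restrict_apply')
qed

lemma germ_src_point [simp]: "g \<in> germs X \<Longrightarrow> germ_src g \<in> germ_points X"
  using arrow_dom_subset by (cases g) (auto simp: germs_def germ_points_def)

lemma germ_tgt_point [simp]: "g \<in> germs X \<Longrightarrow> germ_tgt X g \<in> germ_points X"
  using arrow_map_in by (cases g) (auto simp: germs_def germ_points_def)

lemma germ_comp_germ:
  assumes "g \<in> germs X" "h \<in> germs X" "germ_tgt X g = germ_src h"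
  shows "h \<cdot>\<^bsub>X\<^esub> g \<in> germs X" and "germ_tgt X (h \<cdot>\<^bsub>X\<^esub> g) = germ_tgt X h"
proof -
  obtain i x \<xi> j y \<eta> k where "g = (i, x, \<xi>, j)" "h = (j, y, \<eta>, k)"
    using assms(3) by (cases g; cases h) auto
  then show "h \<cdot>\<^bsub>X\<^esub> g \<in> germs X" "germ_tgt X (h \<cdot>\<^bsub>X\<^esub> g) = germ_tgt X h"
    using assms arrow_comp_in[of i j k \<xi> \<eta> x] comp_map[of i j k \<xi> \<eta> x]
    by (auto simp: germs_def comp_dom_def)
qed

lemma germ_inv_germ:
  assumes "g \<in> germs X"
  shows "germ_inv X g \<in> germs X"
    and "germ_tgt X (germ_inv X g) = germ_src g"
    and "germ_inv X g \<cdot>\<^bsub>X\<^esub> g = germ_id X (germ_src g)"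
    and "g \<cdot>\<^bsub>X\<^esub> germ_inv X g = germ_id X (germ_tgt X g)"
proof -
  obtain i x \<xi> j where g: "g = (i, x, \<xi>, j)" by (cases g) auto
  have a: "i \<in> charts X" "j \<in> charts X" "\<xi> \<in> arrows X i j" "x \<in> arrow_dom X i j \<xi>"
    using assms g by (auto simp: germs_def)
  let ?y = "arrow_map X i j \<xi> x"
  have y: "?y \<in> arrow_range X i j \<xi>" using a by (simp add: arrow_range_def)
  note inv = arrow_inv[OF a(1-3)]
  have x: "x \<in> topspace (chart_top X i)" using arrow_dom_subset a by blast
  note l = arrow_inv_comp_left[OF a]
  note r = arrow_inv_comp_right[OF a(1-3) y]
  have ret: "arrow_map X j i (arrow_inv X i j \<xi>) ?y = x"
    using comp_map[OF a(1,2,1,3) _ conjunct1[OF l]] inv l one_arrow(2)[OF a(1) x] by metis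
  show "germ_inv X g \<in> germs X" using a y inv by (simp add: g germs_def)
  show "germ_tgt X (germ_inv X g) = germ_src g" using ret by (simp add: g)
  show "germ_inv X g \<cdot>\<^bsub>X\<^esub> g = germ_id X (germ_src g)" using l by (simp add: g)
  show "g \<cdot>\<^bsub>X\<^esub> germ_inv X g = germ_id X (germ_tgt X g)" using r by (simp add: g)
qed

lemma germ_id_germ:
  assumes "p \<in> germ_points X"
  shows "germ_id X p \<in> germs X" and "germ_tgt X (germ_id X p) = p"
  using assms one_arrow arrow_dom_same by (cases p; auto simp: germs_def germ_points_def)+

lemma germ_id_left:
  "\<lbrakk>g \<in> germs X; p = germ_tgt X g\<rbrakk> \<Longrightarrow> germ_id X p \<cdot>\<^bsub>X\<^esub> g = g"
  using comp_one_left by (cases g) (auto simp: germs_def)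

lemma germ_id_right:
  "\<lbrakk>g \<in> germs X; p = germ_src g\<rbrakk> \<Longrightarrow> g \<cdot>\<^bsub>X\<^esub> germ_id X p = g"
  using comp_one_right by (cases g) (auto simp: germs_def)

lemma germ_assoc:
  assumes "g \<in> germs X" "h \<in> germs X" "k \<in> germs X" "germ_tgt X g = germ_src h" "germ_tgt X h = germ_src k"
  shows "(k \<cdot>\<^bsub>X\<^esub> h) \<cdot>\<^bsub>X\<^esub> g = k \<cdot>\<^bsub>X\<^esub> (h \<cdot>\<^bsub>X\<^esub> g)"
proof -
  obtain a x \<xi> b y \<eta> c z \<zeta> d where "g = (a, x, \<xi>, b)" "h = (b, y, \<eta>, c)" "k = (c, z, \<zeta>, d)"
    using assms(4,5) by (cases g; cases h; cases k) auto
  then show ?thesis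
    using assms comp_assoc[of a b c d \<xi> \<eta> \<zeta> x] by (auto simp: germs_def comp_dom_def)
qed

lemma germ_inv_cancel:
  "\<lbrakk>g \<in> germs X; k \<in> germs X; germ_tgt X k = germ_src g\<rbrakk> \<Longrightarrow> germ_inv X g \<cdot>\<^bsub>X\<^esub> (g \<cdot>\<^bsub>X\<^esub> k) = k"
  "\<lbrakk>g \<in> germs X; k \<in> germs X; germ_tgt X k = germ_tgt X g\<rbrakk> \<Longrightarrow> g \<cdot>\<^bsub>X\<^esub> (germ_inv X g \<cdot>\<^bsub>X\<^esub> k) = k"
  "\<lbrakk>g \<in> germs X; k \<in> germs X; germ_src k = germ_src g\<rbrakk> \<Longrightarrow> (k \<cdot>\<^bsub>X\<^esub> germ_inv X g) \<cdot>\<^bsub>X\<^esub> g = k"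
  "\<lbrakk>g \<in> germs X; k \<in> germs X; germ_src k = germ_tgt X g\<rbrakk> \<Longrightarrow> (k \<cdot>\<^bsub>X\<^esub> g) \<cdot>\<^bsub>X\<^esub> germ_inv X g = k"
  by (metis germ_assoc germ_inv_germ germ_id_left germ_src_inv,
      metis germ_assoc germ_inv_germ germ_id_left germ_src_inv,
      metis germ_assoc germ_inv_germ germ_id_right germ_src_inv,
      metis germ_assoc germ_inv_germ germ_id_right germ_src_inv)

lemma germ_left_cancel:
  assumes "k \<cdot>\<^bsub>X\<^esub> g = k \<cdot>\<^bsub>X\<^esub> h" "g \<in> germs X" "h \<in> germs X" "k \<in> germs X"
    "germ_tgt X g = germ_src k" "germ_tgt X h = germ_src k"
  shows "g = h"
  by (metis assms germ_inv_cancel(1))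

lemma germ_inv_unique:
  assumes "h \<cdot>\<^bsub>X\<^esub> g = germ_id X (germ_src g)" "g \<in> germs X" "h \<in> germs X" "germ_src h = germ_tgt X g"
  shows "h = germ_inv X g"
  by (metis assms germ_id_left germ_inv_cancel(4) germ_inv_germ(1,2))

lemma germ_inv_inv: "g \<in> germs X \<Longrightarrow> germ_inv X (germ_inv X g) = g"
  by (metis germ_inv_germ germ_inv_unique germ_src_inv)

lemma germ_inv_comp:
  assumes "g \<in> germs X" "h \<in> germs X" "germ_tgt X g = germ_src h"
  shows "germ_inv X (h \<cdot>\<^bsub>X\<^esub> g) = germ_inv X g \<cdot>\<^bsub>X\<^esub> germ_inv X h"
proof (rule germ_inv_unique[symmetric])
  show "(germ_inv X g \<cdot>\<^bsub>X\<^esub> germ_inv X h) \<cdot>\<^bsub>X\<^esub> (h \<cdot>\<^bsub>X\<^esub> g) = germ_id X (germ_src (h \<cdot>\<^bsub>X\<^esub> g))"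
    using assms by (simp add: germ_assoc germ_inv_germ germ_comp_germ germ_inv_cancel)
qed (use assms in \<open>simp_all add: germ_inv_germ germ_comp_germ\<close>)

text \<open>
  Used for units: the definition of a homomorphism asks for compatibility with composition, and an
  idempotent is the image that this allows for a unit.
\<close>

lemma idempotent_germ:
  assumes "g \<in> germs X" "g \<cdot>\<^bsub>X\<^esub> g = g" "germ_tgt X g = germ_src g"
  shows "g = germ_id X (germ_src g)"
  by (metis assms germ_inv_cancel(1) germ_inv_germ(3))

lemma germ_to_chart_exists:
  assumes "p \<in> germ_points X" "a \<in> charts X" "chart_proj X (fst p) (snd p) \<in> chart_set X a"
  obtains \<zeta> where "(fst p, snd p, \<zeta>, a) \<in> germs X"
proof -
  have p: "fst p \<in> charts X" "snd p \<in> topspace (chart_top X (fst p))"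
    using assms(1) by (auto simp: germ_points_def)
  obtain \<zeta> where "\<zeta> \<in> arrows X (fst p) a" "snd p \<in> arrow_dom X (fst p) a \<zeta>"
    using arrow_exists[OF p(1) assms(2) p(2) assms(3)] .
  then show ?thesis using that[of \<zeta>] p assms(2) by (auto simp: germs_def)
qed

lemma germ_to_cover_exists:
  assumes "p \<in> germ_points X" "is_cover X A"
  obtains a \<zeta> where "a \<in> A" "(fst p, snd p, \<zeta>, a) \<in> germs X"
proof -
  have p: "fst p \<in> charts X" "snd p \<in> topspace (chart_top X (fst p))"
    using assms(1) by (auto simp: germ_points_def)
  have "chart_proj X (fst p) (snd p) \<in> topspace (orbi_top X)"
    using chart_proj_in[OF p] openin_subset[OF chart_set_open[OF p(1)]] by blast
  then obtain a where a: "a \<in> A" "chart_proj X (fst p) (snd p) \<in> chart_set X a"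
    using assms(2) unfolding is_cover_def by blast
  then have "a \<in> charts X" using assms(2) by (auto simp: is_cover_def)
  then show ?thesis using germ_to_chart_exists[OF assms(1) _ a(2)] that a(1) by blast
qed

end


section \<open>Links between homomorphisms\<close>

definition germs_between :: "('x, 'i, 'p, 't) orbi_atlas \<Rightarrow> 'i set \<Rightarrow> 'i set \<Rightarrow> ('i, 'p, 't) germ set" where
  "germs_between X A B = {g \<in> germs X. fst (germ_src g) \<in> A \<and> fst (germ_tgt X g) \<in> B}"

definition hom_point :: "('i, 'p, 't, 'j, 'q, 's) orbi_hom \<Rightarrow> 'i \<times> 'p \<Rightarrow> 'j \<times> 'q" where
  "hom_point \<sigma> p = (hchart \<sigma> (fst p), hmap \<sigma> (fst p) (snd p))"

text \<open>
  A family \<open>N\<close> of maps between the sets \<open>T\<close> acts on germs whose source chart belongs to \<open>\<sigma>\<close> and whose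
  target chart belongs to \<open>\<tau>\<close>.  For \<open>\<sigma> = \<tau>\<close> and \<open>N = hrho \<sigma>\<close> this is the map of groupoids given by \<open>\<sigma>\<close>.
\<close>

fun transport :: "('i, 'p, 't, 'j, 'q, 's) orbi_hom \<Rightarrow> ('i, 'p, 't, 'j, 'q, 's) orbi_hom \<Rightarrow>
    ('i \<Rightarrow> 'i \<Rightarrow> 't \<Rightarrow> 's) \<Rightarrow> ('i, 'p, 't) germ \<Rightarrow> ('j, 'q, 's) germ" where
  "transport \<sigma> \<tau> N (i, x, \<xi>, j) = (hchart \<sigma> i, hmap \<sigma> i x, N i j \<xi>, hchart \<tau> j)"

abbreviation hom_germ :: "('i, 'p, 't, 'j, 'q, 's) orbi_hom \<Rightarrow> ('i, 'p, 't) germ \<Rightarrow> ('j, 'q, 's) germ" where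
  "hom_germ \<sigma> \<equiv> transport \<sigma> \<sigma> (hrho \<sigma>)"

text \<open>
  A link is what is missing in order to combine \<open>\<sigma>\<close> and \<open>\<tau>\<close> into one homomorphism on the disjoint
  union of their families of charts.  Since \<open>N\<close> takes elements of \<open>T\<close> and not germs as arguments, it
  is constant along the domain of each \<open>\<xi>\<close>; this makes links composable horizontally without any
  argument about continuity.
\<close>

definition is_link :: "('x, 'i, 'p, 't) orbi_atlas \<Rightarrow> ('y, 'j, 'q, 's) orbi_atlas \<Rightarrow>
    ('i, 'p, 't, 'j, 'q, 's) orbi_hom \<Rightarrow> ('i, 'p, 't, 'j, 'q, 's) orbi_hom \<Rightarrow>
    ('i \<Rightarrow> 'i \<Rightarrow> 't \<Rightarrow> 's) \<Rightarrow> bool" where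
  "is_link X Y \<sigma> \<tau> N \<longleftrightarrow>
     (\<forall>g\<in>germs_between X (hsrc \<sigma>) (hsrc \<tau>).
        transport \<sigma> \<tau> N g \<in> germs Y \<and> germ_tgt Y (transport \<sigma> \<tau> N g) = hom_point \<tau> (germ_tgt X g)) \<and>
     (\<forall>g\<in>germs_between X (hsrc \<sigma>) (hsrc \<sigma>). \<forall>h\<in>germs_between X (hsrc \<sigma>) (hsrc \<tau>).
        germ_tgt X g = germ_src h \<longrightarrow>
        transport \<sigma> \<tau> N (h \<cdot>\<^bsub>X\<^esub> g) = transport \<sigma> \<tau> N h \<cdot>\<^bsub>Y\<^esub> hom_germ \<sigma> g) \<and>
     (\<forall>g\<in>germs_between X (hsrc \<sigma>) (hsrc \<tau>). \<forall>h\<in>germs_between X (hsrc \<tau>) (hsrc \<tau>).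
        germ_tgt X g = germ_src h \<longrightarrow>
        transport \<sigma> \<tau> N (h \<cdot>\<^bsub>X\<^esub> g) = hom_germ \<tau> h \<cdot>\<^bsub>Y\<^esub> transport \<sigma> \<tau> N g)"

definition linked :: "('x, 'i, 'p, 't) orbi_atlas \<Rightarrow> ('y, 'j, 'q, 's) orbi_atlas \<Rightarrow>
    ('i, 'p, 't, 'j, 'q, 's) orbi_hom \<Rightarrow> ('i, 'p, 't, 'j, 'q, 's) orbi_hom \<Rightarrow> bool" where
  "linked X Y \<sigma> \<tau> \<longleftrightarrow> (\<exists>N. is_link X Y \<sigma> \<tau> N)"

lemma germ_src_transport [simp]: "germ_src (transport \<sigma> \<tau> N g) = hom_point \<sigma> (germ_src g)"
  by (cases g) (simp add: hom_point_def)

lemma fst_germ_tgt_transport [simp]: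
  "fst (germ_tgt Y (transport \<sigma> \<tau> N g)) = hchart \<tau> (fst (germ_tgt X g))"
  by (cases g) simp

lemma fst_hom_point [simp]: "fst (hom_point \<sigma> p) = hchart \<sigma> (fst p)"
  by (simp add: hom_point_def)

locale orbispace_pair = X: orbispace X + Y: orbispace Y
  for X :: "('x, 'i, 'p, 't) orbi_atlas" and Y :: "('y, 'j, 'q, 's) orbi_atlas"
begin

lemma germs_between_comp:
  "\<lbrakk>g \<in> germs_between X A B; h \<in> germs_between X B C; germ_tgt X g = germ_src h\<rbrakk>
    \<Longrightarrow> h \<cdot>\<^bsub>X\<^esub> g \<in> germs_between X A C"
  by (auto simp: germs_between_def X.germ_comp_germ)

lemma germs_between_inv:
  "g \<in> germs_between X A B \<Longrightarrow> germ_inv X g \<in> germs_between X B A"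
  by (auto simp: germs_between_def X.germ_inv_germ)

lemma germs_between_germ: "g \<in> germs_between X A B \<Longrightarrow> g \<in> germs X"
  by (simp add: germs_between_def)

lemma linkD:
  assumes "is_link X Y \<sigma> \<tau> N"
  shows "g \<in> germs_between X (hsrc \<sigma>) (hsrc \<tau>) \<Longrightarrow> transport \<sigma> \<tau> N g \<in> germs Y"
    and "g \<in> germs_between X (hsrc \<sigma>) (hsrc \<tau>) \<Longrightarrow>
      germ_tgt Y (transport \<sigma> \<tau> N g) = hom_point \<tau> (germ_tgt X g)"
    and "\<lbrakk>g \<in> germs_between X (hsrc \<sigma>) (hsrc \<sigma>); h \<in> germs_between X (hsrc \<sigma>) (hsrc \<tau>);
        germ_tgt X g = germ_src h\<rbrakk> \<Longrightarrow>
      transport \<sigma> \<tau> N (h \<cdot>\<^bsub>X\<^esub> g) = transport \<sigma> \<tau> N h \<cdot>\<^bsub>Y\<^esub> hom_germ \<sigma> g"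
    and "\<lbrakk>g \<in> germs_between X (hsrc \<sigma>) (hsrc \<tau>); h \<in> germs_between X (hsrc \<tau>) (hsrc \<tau>);
        germ_tgt X g = germ_src h\<rbrakk> \<Longrightarrow>
      transport \<sigma> \<tau> N (h \<cdot>\<^bsub>X\<^esub> g) = hom_germ \<tau> h \<cdot>\<^bsub>Y\<^esub> transport \<sigma> \<tau> N g"
  using assms unfolding is_link_def by blast+

lemma germs_betweenI:
  assumes "A \<subseteq> charts X" "B \<subseteq> charts X" "a \<in> A" "b \<in> B" "\<xi> \<in> arrows X a b" "x \<in> arrow_dom X a b \<xi>"
  shows "(a, x, \<xi>, b) \<in> germs_between X A B"
  using assms by (auto simp: germs_between_def germs_def)

text \<open>
  Germs only see pairs \<open>(\<xi>, x)\<close>, but every \<open>\<xi>\<close> occurs in one of them because domains are nonempty.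
\<close>

lemma link_arrow:
  assumes "is_link X Y \<sigma> \<tau> N" "hsrc \<sigma> \<subseteq> charts X" "hsrc \<tau> \<subseteq> charts X"
    and "a \<in> hsrc \<sigma>" "b \<in> hsrc \<tau>" "\<xi> \<in> arrows X a b"
  shows "N a b \<xi> \<in> arrows Y (hchart \<sigma> a) (hchart \<tau> b)"
    and "x \<in> arrow_dom X a b \<xi> \<Longrightarrow> hmap \<sigma> a x \<in> arrow_dom Y (hchart \<sigma> a) (hchart \<tau> b) (N a b \<xi>)"
    and "x \<in> arrow_dom X a b \<xi> \<Longrightarrow>
      arrow_map Y (hchart \<sigma> a) (hchart \<tau> b) (N a b \<xi>) (hmap \<sigma> a x) = hmap \<tau> b (arrow_map X a b \<xi> x)"
proof -
  have *: "N a b \<xi> \<in> arrows Y (hchart \<sigma> a) (hchart \<tau> b) \<and>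
      hmap \<sigma> a x \<in> arrow_dom Y (hchart \<sigma> a) (hchart \<tau> b) (N a b \<xi>) \<and>
      arrow_map Y (hchart \<sigma> a) (hchart \<tau> b) (N a b \<xi>) (hmap \<sigma> a x) = hmap \<tau> b (arrow_map X a b \<xi> x)"
    if "x \<in> arrow_dom X a b \<xi>" for x
    using linkD(1,2)[OF assms(1) germs_betweenI[OF assms(2-6) that]]
    by (auto simp: germs_def hom_point_def)
  have "a \<in> charts X" "b \<in> charts X" using assms by blast+
  then show "N a b \<xi> \<in> arrows Y (hchart \<sigma> a) (hchart \<tau> b)"
    using * X.arrow_dom_nonempty assms(6) by blast
  show "x \<in> arrow_dom X a b \<xi> \<Longrightarrow> hmap \<sigma> a x \<in> arrow_dom Y (hchart \<sigma> a) (hchart \<tau> b) (N a b \<xi>)"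
    "x \<in> arrow_dom X a b \<xi> \<Longrightarrow>
      arrow_map Y (hchart \<sigma> a) (hchart \<tau> b) (N a b \<xi>) (hmap \<sigma> a x) = hmap \<tau> b (arrow_map X a b \<xi> x)"
    using * by blast+
qed

text \<open>
  A homomorphism is a link from itself to itself, so that statements about links specialise to the
  functoriality of homomorphisms.
\<close>

lemma is_hom_iff_link:
  "is_hom X Y \<sigma> \<longleftrightarrow>
     hsrc \<sigma> \<subseteq> charts X \<and> htgt \<sigma> \<subseteq> charts Y \<and> hchart \<sigma> ` hsrc \<sigma> \<subseteq> htgt \<sigma> \<and>
     (\<forall>a\<in>hsrc \<sigma>. continuous_map (chart_top X a) (chart_top Y (hchart \<sigma> a)) (hmap \<sigma> a)) \<and>
     is_link X Y \<sigma> \<sigma> (hrho \<sigma>)" (is "_ \<longleftrightarrow> ?R")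
proof
  assume h: "is_hom X Y \<sigma>"
  have sub: "hsrc \<sigma> \<subseteq> charts X" "\<And>a. a \<in> hsrc \<sigma> \<Longrightarrow> hchart \<sigma> a \<in> charts Y"
    using h unfolding is_hom_def by blast+
  have arr: "hrho \<sigma> a b \<xi> \<in> arrows Y (hchart \<sigma> a) (hchart \<sigma> b) \<and>
      (x \<in> arrow_dom X a b \<xi> \<longrightarrow>
           hmap \<sigma> a x \<in> arrow_dom Y (hchart \<sigma> a) (hchart \<sigma> b) (hrho \<sigma> a b \<xi>) \<and>
           arrow_map Y (hchart \<sigma> a) (hchart \<sigma> b) (hrho \<sigma> a b \<xi>) (hmap \<sigma> a x) =
           hmap \<sigma> b (arrow_map X a b \<xi> x))"
    if "a \<in> hsrc \<sigma>" "b \<in> hsrc \<sigma>" "\<xi> \<in> arrows X a b" for a b \<xi> x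
    using h that unfolding is_hom_def by blast
  have 1: "hom_germ \<sigma> g \<in> germs Y \<and> germ_tgt Y (hom_germ \<sigma> g) = hom_point \<sigma> (germ_tgt X g)"
    if "g \<in> germs_between X (hsrc \<sigma>) (hsrc \<sigma>)" for g
    using that sub arr by (cases g) (auto simp: germs_between_def germs_def hom_point_def)
  have 2: "hom_germ \<sigma> (k \<cdot>\<^bsub>X\<^esub> g) = hom_germ \<sigma> k \<cdot>\<^bsub>Y\<^esub> hom_germ \<sigma> g"
    if g: "g \<in> germs_between X (hsrc \<sigma>) (hsrc \<sigma>)" and k: "k \<in> germs_between X (hsrc \<sigma>) (hsrc \<sigma>)"
      and gk: "germ_tgt X g = germ_src k" for g k
  proof -
    obtain a x \<xi> b y \<eta> c where e: "g = (a, x, \<xi>, b)" "k = (b, y, \<eta>, c)"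
      using gk by (cases g; cases k) auto
    have m: "a \<in> hsrc \<sigma>" "b \<in> hsrc \<sigma>" "c \<in> hsrc \<sigma>" "\<xi> \<in> arrows X a b" "\<eta> \<in> arrows X b c"
      "x \<in> comp_dom X a b c \<eta> \<xi>"
      using e g k gk by (auto simp: germs_between_def germs_def comp_dom_def)
    then have "hrho \<sigma> a c (arrow_comp X a b c \<eta> \<xi> x) =
        arrow_comp Y (hchart \<sigma> a) (hchart \<sigma> b) (hchart \<sigma> c) (hrho \<sigma> b c \<eta>) (hrho \<sigma> a b \<xi>) (hmap \<sigma> a x)"
      using h unfolding is_hom_def by blast
    then show ?thesis by (simp add: e)
  qed
  show ?R using h 1 2 unfolding is_hom_def is_link_def by auto
next
  assume R: ?R
  then have l: "is_link X Y \<sigma> \<sigma> (hrho \<sigma>)" and s: "hsrc \<sigma> \<subseteq> charts X" by auto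
  have "hrho \<sigma> a c (arrow_comp X a b c \<eta> \<xi> x) =
      arrow_comp Y (hchart \<sigma> a) (hchart \<sigma> b) (hchart \<sigma> c) (hrho \<sigma> b c \<eta>) (hrho \<sigma> a b \<xi>) (hmap \<sigma> a x)"
    if "a \<in> hsrc \<sigma>" "b \<in> hsrc \<sigma>" "c \<in> hsrc \<sigma>" "\<xi> \<in> arrows X a b" "\<eta> \<in> arrows X b c"
      "x \<in> comp_dom X a b c \<eta> \<xi>" for a b c \<xi> \<eta> x
    using linkD(3)[OF l germs_betweenI[OF s s that(1,2,4)] germs_betweenI[OF s s that(2,3,5)]] that(6)
    by (auto simp: comp_dom_def)
  then show "is_hom X Y \<sigma>"
    using R link_arrow[OF l s s] unfolding is_hom_def by simp
qed

lemma hom_link: "is_hom X Y \<sigma> \<Longrightarrow> is_link X Y \<sigma> \<sigma> (hrho \<sigma>)"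
  by (simp add: is_hom_iff_link)

lemma hom_charts:
  "is_hom X Y \<sigma> \<Longrightarrow> hsrc \<sigma> \<subseteq> charts X"
  "is_hom X Y \<sigma> \<Longrightarrow> a \<in> hsrc \<sigma> \<Longrightarrow> hchart \<sigma> a \<in> charts Y"
  unfolding is_hom_def by auto

lemma hom_germ_inv:
  assumes h: "is_hom X Y \<sigma>" and g: "g \<in> germs_between X (hsrc \<sigma>) (hsrc \<sigma>)"
  shows "hom_germ \<sigma> (germ_inv X g) = germ_inv Y (hom_germ \<sigma> g)"
proof -
  note l = hom_link[OF h]
  have g': "germ_inv X g \<in> germs_between X (hsrc \<sigma>) (hsrc \<sigma>)" using germs_between_inv g by blast
  have G: "g \<in> germs X" using g germs_between_germ by blast
  let ?e = "germ_id X (germ_src g)"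
  have e: "?e \<in> germs_between X (hsrc \<sigma>) (hsrc \<sigma>)"
    using g G by (auto simp: germs_between_def X.germ_id_germ)
  have ee: "?e \<cdot>\<^bsub>X\<^esub> ?e = ?e" "germ_tgt X ?e = germ_src ?e"
    using G by (simp_all add: X.germ_id_germ X.germ_id_left)
  have "hom_germ \<sigma> ?e = germ_id Y (hom_point \<sigma> (germ_src g))"
    using Y.idempotent_germ[OF linkD(1)[OF l e]] linkD(2)[OF l e] linkD(3)[OF l e e ee(2)] ee
    by simp
  then have "hom_germ \<sigma> (germ_inv X g) \<cdot>\<^bsub>Y\<^esub> hom_germ \<sigma> g = germ_id Y (germ_src (hom_germ \<sigma> g))"
    using linkD(3)[OF l g g'] X.germ_inv_germ[OF G] by simp
  then show ?thesis
    by (rule Y.germ_inv_unique) (simp_all add: linkD[OF l] g g')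
qed

text \<open>
  The continuity argument shared by the pointwise constructions below.  There an element of \<open>T\<close> is
  obtained by travelling from \<open>x\<close> along a fixed \<open>\<zeta>\<close> into an auxiliary chart and returning along
  \<open>\<xi> \<circ> \<zeta>\<^sup>-\<^sup>1\<close>: the composite is first constant near \<open>\<phi>\<^sub>\<zeta>(x\<^sub>0)\<close> in the source, and then its image under
  \<open>P\<close>, being fixed, has a locally constant composite with \<open>\<epsilon>\<close> in the target.
\<close>

lemma composite_locally_constant:
  fixes P :: "'t \<Rightarrow> 's" and \<xi> \<zeta> i j a
  defines "\<omega> \<equiv> \<lambda>x. arrow_comp X a i j \<xi> (arrow_inv X i a \<zeta>) (arrow_map X i a \<zeta> x)"
  assumes ch: "i \<in> charts X" "j \<in> charts X" "a \<in> charts X" "u \<in> charts Y" "v \<in> charts Y" "w \<in> charts Y"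
    and \<xi>: "\<xi> \<in> arrows X i j" "x0 \<in> arrow_dom X i j \<xi>"
    and \<zeta>: "\<zeta> \<in> arrows X i a" "x0 \<in> arrow_dom X i a \<zeta>"
    and f: "continuous_map (chart_top X i) (chart_top Y w) f"
    and \<epsilon>: "\<epsilon> \<in> arrows Y w u" and P: "P (\<omega> x0) \<in> arrows Y u v"
    and dom: "f x0 \<in> comp_dom Y w u v (P (\<omega> x0)) \<epsilon>"
  shows "\<exists>U. openin (chart_top X i) U \<and> x0 \<in> U \<and> (\<forall>x\<in>U. x \<in> arrow_dom X i a \<zeta> \<and>
      arrow_comp Y w u v (P (\<omega> x)) \<epsilon> (f x) = arrow_comp Y w u v (P (\<omega> x0)) \<epsilon> (f x0))"
proof -
  let ?\<zeta>' = "arrow_inv X i a \<zeta>"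
  note inv = X.arrow_inv[OF ch(1,3) \<zeta>(1)]
  have \<zeta>': "?\<zeta>' \<in> arrows X a i" using inv by simp
  have g: "(i, x0, \<zeta>, a) \<in> germs X" using ch \<zeta> by (simp add: germs_def)
  have "arrow_map X a i ?\<zeta>' (arrow_map X i a \<zeta> x0) = x0"
    using X.germ_inv_germ(2)[OF g] by simp
  then have "arrow_map X i a \<zeta> x0 \<in> comp_dom X a i j \<xi> ?\<zeta>'"
    using inv \<zeta> \<xi> by (simp add: comp_dom_def arrow_range_def)
  then obtain V where V: "openin (chart_top X a) V" "arrow_map X i a \<zeta> x0 \<in> V"
    "\<And>y. y \<in> V \<Longrightarrow> arrow_comp X a i j \<xi> ?\<zeta>' y = \<omega> x0"
    using X.arrow_comp_locally_constant[OF ch(3,1,2) \<zeta>' \<xi>(1)] unfolding \<omega>_def by metis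
  let ?U1 = "{x \<in> arrow_dom X i a \<zeta>. arrow_map X i a \<zeta> x \<in> V}"
  have U1: "openin (chart_top X i) ?U1" by (rule X.openin_arrow_preimage[OF ch(1,3) \<zeta>(1) V(1)])
  obtain V' where V': "openin (chart_top Y w) V'" "f x0 \<in> V'"
    "\<And>y. y \<in> V' \<Longrightarrow> arrow_comp Y w u v (P (\<omega> x0)) \<epsilon> y = arrow_comp Y w u v (P (\<omega> x0)) \<epsilon> (f x0)"
    using Y.arrow_comp_locally_constant[OF ch(6,4,5) \<epsilon> P dom] by metis
  let ?U = "{x \<in> ?U1. f x \<in> V'}"
  have "openin (chart_top X i) ?U" by (rule openin_continuous_map_preimage_gen[OF f U1 V'(1)])
  moreover have "x0 \<in> ?U" using \<zeta>(2) V(2) V'(2) by simp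
  moreover have "x \<in> arrow_dom X i a \<zeta> \<and>
      arrow_comp Y w u v (P (\<omega> x)) \<epsilon> (f x) = arrow_comp Y w u v (P (\<omega> x0)) \<epsilon> (f x0)" if x: "x \<in> ?U" for x
  proof -
    have "\<omega> x = \<omega> x0" using V(3)[of "arrow_map X i a \<zeta> x"] x unfolding \<omega>_def by blast
    then show ?thesis using V'(3)[of "f x"] x by simp
  qed
  ultimately show ?thesis by blast
qed

lemma link_sym:
  assumes \<sigma>: "is_hom X Y \<sigma>" and \<tau>: "is_hom X Y \<tau>" and N: "is_link X Y \<sigma> \<tau> N"
  shows "is_link X Y \<tau> \<sigma> (\<lambda>i j \<xi>. arrow_inv Y (hchart \<sigma> j) (hchart \<tau> i) (N j i (arrow_inv X i j \<xi>)))"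
    (is "is_link X Y \<tau> \<sigma> ?N")
proof -
  let ?B = "\<lambda>\<sigma> \<tau>. germs_between X (hsrc \<sigma>) (hsrc \<tau>)"
  have eq: "transport \<tau> \<sigma> ?N g = germ_inv Y (transport \<sigma> \<tau> N (germ_inv X g))"
    if g: "g \<in> ?B \<tau> \<sigma>" for g
  proof -
    obtain i x \<xi> j where e: "g = (i, x, \<xi>, j)" by (cases g) auto
    have "germ_tgt Y (transport \<sigma> \<tau> N (germ_inv X g)) = hom_point \<tau> (germ_src g)"
      using linkD(2)[OF N germs_between_inv[OF g]] X.germ_inv_germ(2)[OF germs_between_germ[OF g]] by simp
    then show ?thesis by (simp add: e hom_point_def)
  qed
  have T: "transport \<sigma> \<tau> N (germ_inv X g) \<in> germs Y"
    "germ_tgt Y (transport \<sigma> \<tau> N (germ_inv X g)) = hom_point \<tau> (germ_src g)"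
    if "g \<in> ?B \<tau> \<sigma>" for g
    using linkD(1,2)[OF N germs_between_inv[OF that]] X.germ_inv_germ(2)[OF germs_between_germ[OF that]]
    by simp_all
  note \<sigma>l = hom_link[OF \<sigma>] and \<tau>l = hom_link[OF \<tau>]
  show ?thesis unfolding is_link_def
  proof (intro conjI ballI impI)
    fix g assume g: "g \<in> ?B \<tau> \<sigma>"
    show "transport \<tau> \<sigma> ?N g \<in> germs Y" using T(1)[OF g] by (simp add: eq g Y.germ_inv_germ)
    show "germ_tgt Y (transport \<tau> \<sigma> ?N g) = hom_point \<sigma> (germ_tgt X g)"
      using Y.germ_inv_germ(2)[OF T(1)[OF g]] by (simp add: eq g)
  next
    fix g h assume g: "g \<in> ?B \<tau> \<tau>" and h: "h \<in> ?B \<tau> \<sigma>" and gh: "germ_tgt X g = germ_src h"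
    note G = germs_between_germ[OF g] and H = germs_between_germ[OF h]
    have "transport \<tau> \<sigma> ?N (h \<cdot>\<^bsub>X\<^esub> g) =
        germ_inv Y (transport \<sigma> \<tau> N (germ_inv X g \<cdot>\<^bsub>X\<^esub> germ_inv X h))"
      using germs_between_comp[OF g h gh] by (simp add: eq X.germ_inv_comp[OF G H gh])
    also have "\<dots> = germ_inv Y (germ_inv Y (hom_germ \<tau> g) \<cdot>\<^bsub>Y\<^esub> transport \<sigma> \<tau> N (germ_inv X h))"
      using linkD(4)[OF N germs_between_inv[OF h] germs_between_inv[OF g]] X.germ_inv_germ[OF H] gh
      by (simp add: hom_germ_inv[OF \<tau> g])
    also have "\<dots> = transport \<tau> \<sigma> ?N h \<cdot>\<^bsub>Y\<^esub> hom_germ \<tau> g"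
      using T[OF h] linkD(1,2)[OF \<tau>l g] gh
      by (simp add: eq h Y.germ_inv_comp Y.germ_inv_germ Y.germ_inv_inv)
    finally show "transport \<tau> \<sigma> ?N (h \<cdot>\<^bsub>X\<^esub> g) = transport \<tau> \<sigma> ?N h \<cdot>\<^bsub>Y\<^esub> hom_germ \<tau> g" .
  next
    fix g h assume g: "g \<in> ?B \<tau> \<sigma>" and h: "h \<in> ?B \<sigma> \<sigma>" and gh: "germ_tgt X g = germ_src h"
    note G = germs_between_germ[OF g] and H = germs_between_germ[OF h]
    have "transport \<tau> \<sigma> ?N (h \<cdot>\<^bsub>X\<^esub> g) =
        germ_inv Y (transport \<sigma> \<tau> N (germ_inv X g \<cdot>\<^bsub>X\<^esub> germ_inv X h))"
      using germs_between_comp[OF g h gh] by (simp add: eq X.germ_inv_comp[OF G H gh])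
    also have "\<dots> = germ_inv Y (transport \<sigma> \<tau> N (germ_inv X g) \<cdot>\<^bsub>Y\<^esub> germ_inv Y (hom_germ \<sigma> h))"
      using linkD(3)[OF N germs_between_inv[OF h] germs_between_inv[OF g]] X.germ_inv_germ[OF H] gh
      by (simp add: hom_germ_inv[OF \<sigma> h])
    also have "\<dots> = hom_germ \<sigma> h \<cdot>\<^bsub>Y\<^esub> transport \<tau> \<sigma> ?N g"
      using T[OF g] linkD(1,2)[OF \<sigma>l h] gh
      by (simp add: eq g Y.germ_inv_comp Y.germ_inv_germ Y.germ_inv_inv)
    finally show "transport \<tau> \<sigma> ?N (h \<cdot>\<^bsub>X\<^esub> g) = hom_germ \<sigma> h \<cdot>\<^bsub>Y\<^esub> transport \<tau> \<sigma> ?N g" .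
  qed
qed

text \<open>
  A germ \<open>g\<close> from a chart of \<open>\<sigma>\<close> to a chart of \<open>\<tau>\<close> factors through the family of \<open>\<kappa>\<close>, because that
  family covers \<open>X\<close>: for a germ \<open>k\<close> that starts where \<open>g\<close> starts and ends in a chart of \<open>\<kappa>\<close>, the
  composite link sends \<open>g\<close> to \<open>N\<^sub>2(g \<circ> k\<^sup>-\<^sup>1) \<circ> N\<^sub>1(k)\<close>.  This depends neither on \<open>k\<close> nor on the point at
  which \<open>g\<close> is taken.
\<close>

lemma link_trans:
  assumes \<sigma>: "is_hom X Y \<sigma>" and \<kappa>: "is_hom X Y \<kappa>" and \<tau>: "is_hom X Y \<tau>"
    and cover: "is_cover X (hsrc \<kappa>)"
    and N1: "is_link X Y \<sigma> \<kappa> N1" and N2: "is_link X Y \<kappa> \<tau> N2"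
  shows "linked X Y \<sigma> \<tau>"
proof -
  let ?B = "\<lambda>\<sigma> \<tau>. germs_between X (hsrc \<sigma>) (hsrc \<tau>)"
  let ?T1 = "transport \<sigma> \<kappa> N1" and ?T2 = "transport \<kappa> \<tau> N2"
  define P where "P g k = ?T2 (g \<cdot>\<^bsub>X\<^esub> germ_inv X k) \<cdot>\<^bsub>Y\<^esub> ?T1 k" for g k
  note \<sigma>l = hom_link[OF \<sigma>] and \<tau>l = hom_link[OF \<tau>] and \<kappa>l = hom_link[OF \<kappa>]
  have gk: "g \<cdot>\<^bsub>X\<^esub> germ_inv X k \<in> ?B \<kappa> \<tau>" "germ_tgt X (g \<cdot>\<^bsub>X\<^esub> germ_inv X k) = germ_tgt X g"
    if "g \<in> ?B \<sigma> \<tau>" "k \<in> ?B \<sigma> \<kappa>" "germ_src k = germ_src g" for g k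
    using germs_between_comp[OF germs_between_inv[OF that(2)] that(1)] that
      germs_between_germ[OF that(1)] germs_between_germ[OF that(2)]
    by (simp_all add: X.germ_inv_germ X.germ_comp_germ)
  have k: "\<exists>k\<in>?B \<sigma> \<kappa>. germ_src k = germ_src g" if g: "g \<in> ?B \<sigma> \<tau>" for g
  proof -
    obtain a \<zeta> where "a \<in> hsrc \<kappa>" "(fst (germ_src g), snd (germ_src g), \<zeta>, a) \<in> germs X"
      using X.germ_to_cover_exists[OF X.germ_src_point[OF germs_between_germ[OF g]] cover] .
    then show ?thesis using g
      by (intro bexI[of _ "(fst (germ_src g), snd (germ_src g), \<zeta>, a)"])
        (auto simp: germs_between_def)
  qed
  have P: "P g k \<in> germs Y" "germ_src (P g k) = hom_point \<sigma> (germ_src g)"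
    "germ_tgt Y (P g k) = hom_point \<tau> (germ_tgt X g)"
    "germ_src (?T2 (g \<cdot>\<^bsub>X\<^esub> germ_inv X k)) = germ_tgt Y (?T1 k)"
    if "g \<in> ?B \<sigma> \<tau>" "k \<in> ?B \<sigma> \<kappa>" "germ_src k = germ_src g" for g k
    using linkD(1,2)[OF N2 gk(1)[OF that]] linkD(1,2)[OF N1 that(2)] gk(2)[OF that] that(3)
    by (simp_all add: P_def Y.germ_comp_germ)
  \<comment> \<open>Two choices of the intermediate point differ by a germ \<open>m\<close> between charts of \<open>\<kappa>\<close>, which both
    links turn into \<open>hom_germ \<kappa> m\<close>.\<close>
  have indep: "P g k = P g k'"
    if g: "g \<in> ?B \<sigma> \<tau>" and k: "k \<in> ?B \<sigma> \<kappa>" "germ_src k = germ_src g"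
      and k': "k' \<in> ?B \<sigma> \<kappa>" "germ_src k' = germ_src g" for g k k'
  proof -
    let ?m = "k' \<cdot>\<^bsub>X\<^esub> germ_inv X k"
    note G = germs_between_germ[OF g] and K = germs_between_germ[OF k(1)] and K' = germs_between_germ[OF k'(1)]
    have m: "?m \<in> ?B \<kappa> \<kappa>" "germ_tgt X ?m = germ_tgt X k'"
      using germs_between_comp[OF germs_between_inv[OF k(1)] k'(1)] k(2) k'(2) K K'
      by (simp_all add: X.germ_inv_germ X.germ_comp_germ)
    have k'_eq: "k' = ?m \<cdot>\<^bsub>X\<^esub> k" using X.germ_inv_cancel(3)[OF K K'] k(2) k'(2) by simp
    have "g \<cdot>\<^bsub>X\<^esub> germ_inv X k = (g \<cdot>\<^bsub>X\<^esub> germ_inv X k') \<cdot>\<^bsub>X\<^esub> ?m"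
      using G K K' k(2) k'(2) by (simp add: X.germ_inv_germ X.germ_comp_germ X.germ_assoc X.germ_inv_cancel)
    then have "P g k = (?T2 (g \<cdot>\<^bsub>X\<^esub> germ_inv X k') \<cdot>\<^bsub>Y\<^esub> hom_germ \<kappa> ?m) \<cdot>\<^bsub>Y\<^esub> ?T1 k"
      using linkD(3)[OF N2 m(1) gk(1)[OF g k']] m(2) by (simp add: P_def)
    also have "\<dots> = ?T2 (g \<cdot>\<^bsub>X\<^esub> germ_inv X k') \<cdot>\<^bsub>Y\<^esub> (hom_germ \<kappa> ?m \<cdot>\<^bsub>Y\<^esub> ?T1 k)"
      using linkD(1,2)[OF N2 gk(1)[OF g k']] linkD(1,2)[OF N1 k(1)] linkD(1,2)[OF \<kappa>l m(1)] m(2)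
      by (intro Y.germ_assoc) simp_all
    also have "hom_germ \<kappa> ?m \<cdot>\<^bsub>Y\<^esub> ?T1 k = ?T1 k'"
      using linkD(4)[OF N1 k(1) m(1)] k'_eq by simp
    finally show ?thesis by (simp add: P_def)
  qed
  define K where "K g = (SOME k. k \<in> ?B \<sigma> \<kappa> \<and> germ_src k = germ_src g)" for g :: "('i, 'p, 't) germ"
  have K: "K g \<in> ?B \<sigma> \<kappa>" "germ_src (K g) = germ_src g" if "g \<in> ?B \<sigma> \<tau>" for g
    using someI_ex[of "\<lambda>k. k \<in> ?B \<sigma> \<kappa> \<and> germ_src k = germ_src g"] k[OF that] unfolding K_def by blast+
  define N where "N i j \<xi> = germ_arrow (let g = (i, SOME x. x \<in> arrow_dom X i j \<xi>, \<xi>, j) in P g (K g))" for i j \<xi>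
  \<comment> \<open>The chosen \<open>k\<close> may jump from point to point.  Near \<open>x0\<close> it is replaced by the germs of one fixed
    \<open>\<zeta>\<close>, which does not change \<open>P\<close>.\<close>
  have const: "germ_arrow (P (i, x, \<xi>, j) (K (i, x, \<xi>, j))) = germ_arrow (P (i, y, \<xi>, j) (K (i, y, \<xi>, j)))"
    if x: "(i, x, \<xi>, j) \<in> ?B \<sigma> \<tau>" and y: "(i, y, \<xi>, j) \<in> ?B \<sigma> \<tau>" for i j \<xi> x y
  proof (rule locally_constant_on_connected[where S = "arrow_dom X i j \<xi>" and
        F = "\<lambda>x. germ_arrow (P (i, x, \<xi>, j) (K (i, x, \<xi>, j)))"])
    have ij: "i \<in> charts X" "j \<in> charts X" "\<xi> \<in> arrows X i j" "i \<in> hsrc \<sigma>" "j \<in> hsrc \<tau>"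
      using x by (auto simp: germs_between_def germs_def)
    show "connectedin (chart_top X i) (arrow_dom X i j \<xi>)" by (rule X.arrow_dom_connected[OF ij(1-3)])
    show "x \<in> arrow_dom X i j \<xi>" "y \<in> arrow_dom X i j \<xi>"
      using x y by (auto simp: germs_between_def germs_def)
    fix x0 assume x0: "x0 \<in> arrow_dom X i j \<xi>"
    have g: "(i, x, \<xi>, j) \<in> ?B \<sigma> \<tau>" if "x \<in> arrow_dom X i j \<xi>" for x
      using that ij by (simp add: germs_between_def germs_def)
    obtain \<zeta> a where k0: "K (i, x0, \<xi>, j) = (i, x0, \<zeta>, a)"
      using K(2)[OF g[OF x0]] by (cases "K (i, x0, \<xi>, j)") auto
    have \<zeta>: "a \<in> charts X" "a \<in> hsrc \<kappa>" "\<zeta> \<in> arrows X i a" "x0 \<in> arrow_dom X i a \<zeta>"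
      using K(1)[OF g[OF x0]] by (auto simp: k0 germs_between_def germs_def)
    let ?F = "\<lambda>x. germ_arrow (P (i, x, \<xi>, j) (i, x, \<zeta>, a))"
    have kx: "(i, x, \<zeta>, a) \<in> ?B \<sigma> \<kappa>" if "x \<in> arrow_dom X i a \<zeta>" for x
      using that ij \<zeta> by (simp add: germs_between_def germs_def)
    have hc: "hchart \<sigma> i \<in> charts Y" "hchart \<kappa> a \<in> charts Y" "hchart \<tau> j \<in> charts Y"
      using hom_charts \<sigma> \<kappa> \<tau> ij \<zeta> by blast+
    let ?g0 = "(i, x0, \<xi>, j) \<cdot>\<^bsub>X\<^esub> germ_inv X (i, x0, \<zeta>, a)"
    have T0: "?T2 ?g0 \<in> germs Y" "?T1 (i, x0, \<zeta>, a) \<in> germs Y"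
      "germ_src (?T2 ?g0) = germ_tgt Y (?T1 (i, x0, \<zeta>, a))"
      using linkD(1)[OF N2 gk(1)[OF g[OF x0] kx[OF \<zeta>(4)]]] linkD(1)[OF N1 kx[OF \<zeta>(4)]]
        P(4)[OF g[OF x0] kx[OF \<zeta>(4)]] by simp_all
    have "\<exists>U. openin (chart_top X i) U \<and> x0 \<in> U \<and> (\<forall>x\<in>U. x \<in> arrow_dom X i a \<zeta> \<and> ?F x = ?F x0)"
      unfolding P_def germ_inv.simps germ_comp.simps transport.simps germ_arrow.simps
    proof (rule composite_locally_constant[OF ij(1,2) \<zeta>(1) hc(2,3,1) ij(3) x0 \<zeta>(3,4)])
      show "continuous_map (chart_top X i) (chart_top Y (hchart \<sigma> i)) (hmap \<sigma> i)"
        using \<sigma> ij by (simp add: is_hom_iff_link)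
    qed (use T0 in \<open>simp_all add: germs_def comp_dom_def\<close>)
    then obtain U where U: "openin (chart_top X i) U" "x0 \<in> U"
      "\<And>x. x \<in> U \<Longrightarrow> x \<in> arrow_dom X i a \<zeta> \<and> ?F x = ?F x0" by blast
    have "germ_arrow (P (i, x, \<xi>, j) (K (i, x, \<xi>, j))) = germ_arrow (P (i, x0, \<xi>, j) (K (i, x0, \<xi>, j)))"
      if x: "x \<in> U" "x \<in> arrow_dom X i j \<xi>" for x
    proof -
      have "P (i, x, \<xi>, j) (K (i, x, \<xi>, j)) = P (i, x, \<xi>, j) (i, x, \<zeta>, a)"
        using U(3)[OF x(1)] by (intro indep g x K kx) simp_all
      then show ?thesis using U(3)[OF x(1)] k0 by simp
    qed
    then show "\<exists>U. openin (chart_top X i) U \<and> x0 \<in> U \<and> (\<forall>x\<in>U \<inter> arrow_dom X i j \<xi>.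
        germ_arrow (P (i, x, \<xi>, j) (K (i, x, \<xi>, j))) = germ_arrow (P (i, x0, \<xi>, j) (K (i, x0, \<xi>, j))))"
      using U(1,2) by blast
  qed
  have N: "transport \<sigma> \<tau> N g = P g k" if g: "g \<in> ?B \<sigma> \<tau>" and k: "k \<in> ?B \<sigma> \<kappa>" "germ_src k = germ_src g" for g k
  proof -
    obtain i x \<xi> j where e: "g = (i, x, \<xi>, j)" by (cases g) auto
    let ?y = "SOME x. x \<in> arrow_dom X i j \<xi>"
    have "x \<in> arrow_dom X i j \<xi>" using g by (auto simp: e germs_between_def germs_def)
    then have "?y \<in> arrow_dom X i j \<xi>" by (rule someI[of "\<lambda>x. x \<in> arrow_dom X i j \<xi>"])
    then have "(i, ?y, \<xi>, j) \<in> ?B \<sigma> \<tau>" using g by (auto simp: e germs_between_def germs_def)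
    then have "N i j \<xi> = germ_arrow (P g (K g))"
      using const[of i ?y \<xi> j x] g by (simp add: e N_def Let_def)
    then have "germ_arrow (transport \<sigma> \<tau> N g) = germ_arrow (P g k)"
      using indep[OF g K[OF g] k] by (simp add: e)
    moreover have "fst (germ_tgt Y (transport \<sigma> \<tau> N g)) = fst (germ_tgt Y (P g k))"
      using P(3)[OF g k] by simp
    ultimately show ?thesis
      using P(2)[OF g k] by (intro germ_eqI[where X = Y]) simp_all
  qed
  have "is_link X Y \<sigma> \<tau> N" unfolding is_link_def
  proof (intro conjI ballI impI)
    fix g assume g: "g \<in> ?B \<sigma> \<tau>"
    show "transport \<sigma> \<tau> N g \<in> germs Y" "germ_tgt Y (transport \<sigma> \<tau> N g) = hom_point \<tau> (germ_tgt X g)"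
      using N[OF g K[OF g]] P[OF g K[OF g]] by simp_all
  next
    fix g h assume g: "g \<in> ?B \<sigma> \<sigma>" and h: "h \<in> ?B \<sigma> \<tau>" and gh: "germ_tgt X g = germ_src h"
    let ?k = "K h"
    note k = K[OF h]
    note G = germs_between_germ[OF g] and H = germs_between_germ[OF h] and K' = germs_between_germ[OF k(1)]
    have kg: "?k \<cdot>\<^bsub>X\<^esub> g \<in> ?B \<sigma> \<kappa>" "germ_tgt X g = germ_src ?k"
      using germs_between_comp[OF g k(1)] k(2) gh by simp_all
    have hg: "h \<cdot>\<^bsub>X\<^esub> g \<in> ?B \<sigma> \<tau>" by (rule germs_between_comp[OF g h gh])
    have "(h \<cdot>\<^bsub>X\<^esub> g) \<cdot>\<^bsub>X\<^esub> germ_inv X (?k \<cdot>\<^bsub>X\<^esub> g) = h \<cdot>\<^bsub>X\<^esub> germ_inv X ?k"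
      using G H K' kg(2) gh k(2)
      by (simp add: X.germ_inv_comp X.germ_inv_germ X.germ_comp_germ X.germ_assoc X.germ_inv_cancel)
    then have "transport \<sigma> \<tau> N (h \<cdot>\<^bsub>X\<^esub> g) =
        ?T2 (h \<cdot>\<^bsub>X\<^esub> germ_inv X ?k) \<cdot>\<^bsub>Y\<^esub> (?T1 ?k \<cdot>\<^bsub>Y\<^esub> hom_germ \<sigma> g)"
      using N[OF hg kg(1)] linkD(3)[OF N1 g k(1) kg(2)] by (simp add: P_def)
    also have "\<dots> = P h ?k \<cdot>\<^bsub>Y\<^esub> hom_germ \<sigma> g"
      unfolding P_def
      using linkD(1,2)[OF N2 gk(1)[OF h k]] linkD(1,2)[OF N1 k(1)] linkD(1,2)[OF \<sigma>l g] kg(2) P(4)[OF h k]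
      by (intro Y.germ_assoc[symmetric]) simp_all
    finally show "transport \<sigma> \<tau> N (h \<cdot>\<^bsub>X\<^esub> g) = transport \<sigma> \<tau> N h \<cdot>\<^bsub>Y\<^esub> hom_germ \<sigma> g"
      using N[OF h k] by simp
  next
    fix g h assume g: "g \<in> ?B \<sigma> \<tau>" and h: "h \<in> ?B \<tau> \<tau>" and gh: "germ_tgt X g = germ_src h"
    let ?k = "K g"
    note k = K[OF g]
    note G = germs_between_germ[OF g] and H = germs_between_germ[OF h] and K' = germs_between_germ[OF k(1)]
    have hg: "h \<cdot>\<^bsub>X\<^esub> g \<in> ?B \<sigma> \<tau>" by (rule germs_between_comp[OF g h gh])
    have "(h \<cdot>\<^bsub>X\<^esub> g) \<cdot>\<^bsub>X\<^esub> germ_inv X ?k = h \<cdot>\<^bsub>X\<^esub> (g \<cdot>\<^bsub>X\<^esub> germ_inv X ?k)"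
      using G H K' gh k(2) by (simp add: X.germ_assoc X.germ_inv_germ)
    then have "transport \<sigma> \<tau> N (h \<cdot>\<^bsub>X\<^esub> g) =
        (hom_germ \<tau> h \<cdot>\<^bsub>Y\<^esub> ?T2 (g \<cdot>\<^bsub>X\<^esub> germ_inv X ?k)) \<cdot>\<^bsub>Y\<^esub> ?T1 ?k"
      using N[OF hg k(1)] k(2) linkD(4)[OF N2 gk(1)[OF g k] h] gk(2)[OF g k] gh by (simp add: P_def)
    also have "\<dots> = hom_germ \<tau> h \<cdot>\<^bsub>Y\<^esub> P g ?k"
      unfolding P_def
      using linkD(1,2)[OF N2 gk(1)[OF g k]] linkD(1,2)[OF N1 k(1)] linkD(1,2)[OF \<tau>l h] P(4)[OF g k]
        gk(2)[OF g k] gh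
      by (intro Y.germ_assoc) simp_all
    finally show "transport \<sigma> \<tau> N (h \<cdot>\<^bsub>X\<^esub> g) = hom_germ \<tau> h \<cdot>\<^bsub>Y\<^esub> transport \<sigma> \<tau> N g"
      using N[OF g k] by simp
  qed
  then show ?thesis unfolding linked_def by blast
qed

end


section \<open>Restricting homomorphisms to finer covers\<close>

context orbispace
begin

lemma arrow_comp_constant:
  assumes "i \<in> charts X" "j \<in> charts X" "k \<in> charts X" "\<xi> \<in> arrows X i j" "\<eta> \<in> arrows X j k"
    and "connectedin (chart_top X i) S" "S \<subseteq> comp_dom X i j k \<eta> \<xi>" "x \<in> S" "y \<in> S"
  shows "arrow_comp X i j k \<eta> \<xi> x = arrow_comp X i j k \<eta> \<xi> y"
proof (rule locally_constant_on_connected[OF assms(6) _ assms(8,9)])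
  fix z assume "z \<in> S"
  then show "\<exists>U. openin (chart_top X i) U \<and> z \<in> U \<and>
      (\<forall>y\<in>U \<inter> S. arrow_comp X i j k \<eta> \<xi> y = arrow_comp X i j k \<eta> \<xi> z)"
    using arrow_comp_locally_constant[OF assms(1-5)] assms(7) by (metis IntE subsetD)
qed

end

text \<open>
  The data that make \<open>\<kappa>\<close> induced by \<open>\<sigma>\<close>, except for the formula for \<open>hrho \<kappa>\<close>: \<open>e a\<close> and \<open>e' a\<close> are the
  \<open>\<xi>\<^sub>a\<close> and \<open>\<xi>'\<^sub>a\<close> of the definition.  The component \<open>hrho \<kappa>\<close> is left free, so that the locale applies
  both to induced homomorphisms and to the construction of new ones.
\<close>

locale restriction_data = orbispace_pair X Y
  for X :: "('x, 'i, 'p, 't) orbi_atlas" and Y :: "('y, 'j, 'q, 's) orbi_atlas" +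
  fixes \<sigma> \<kappa> :: "('i, 'p, 't, 'j, 'q, 's) orbi_hom"
    and \<theta> :: "'i \<Rightarrow> 'i" and e :: "'i \<Rightarrow> 't" and e' :: "'i \<Rightarrow> 's"
  assumes \<sigma>: "is_hom X Y \<sigma>"
    and src: "hsrc \<kappa> \<subseteq> charts X"
    and tgt: "a \<in> hsrc \<kappa> \<Longrightarrow> hchart \<kappa> a \<in> charts Y"
    and \<theta>: "a \<in> hsrc \<kappa> \<Longrightarrow> \<theta> a \<in> hsrc \<sigma>" "a \<in> hsrc \<kappa> \<Longrightarrow> chart_set X a \<subseteq> chart_set X (\<theta> a)"
    and e: "a \<in> hsrc \<kappa> \<Longrightarrow> e a \<in> arrows X a (\<theta> a)"
    and e': "a \<in> hsrc \<kappa> \<Longrightarrow> e' a \<in> arrows Y (hchart \<kappa> a) (hchart \<sigma> (\<theta> a))"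
    and map: "\<lbrakk>a \<in> hsrc \<kappa>; x \<in> topspace (chart_top X a)\<rbrakk> \<Longrightarrow>
        hmap \<kappa> a x \<in> arrow_dom Y (hchart \<kappa> a) (hchart \<sigma> (\<theta> a)) (e' a) \<and>
        arrow_map Y (hchart \<kappa> a) (hchart \<sigma> (\<theta> a)) (e' a) (hmap \<kappa> a x) =
        hmap \<sigma> (\<theta> a) (arrow_map X a (\<theta> a) (e a) x)"
begin

definition src_germ :: "'i \<times> 'p \<Rightarrow> ('i, 'p, 't) germ" where
  "src_germ p = (fst p, snd p, e (fst p), \<theta> (fst p))"

definition tgt_germ :: "'i \<times> 'p \<Rightarrow> ('j, 'q, 's) germ" where
  "tgt_germ p = (hchart \<kappa> (fst p), hmap \<kappa> (fst p) (snd p), e' (fst p), hchart \<sigma> (\<theta> (fst p)))"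

text \<open>
  The \<open>\<xi>\<^sub>b \<circ> \<eta> \<circ> \<xi>\<^sub>a\<^sup>-\<^sup>1\<close> in the definition of induced homomorphisms.
\<close>

definition conj_germ :: "('i, 'p, 't) germ \<Rightarrow> ('i, 'p, 't) germ" where
  "conj_germ g = (src_germ (germ_tgt X g) \<cdot>\<^bsub>X\<^esub> g) \<cdot>\<^bsub>X\<^esub> germ_inv X (src_germ (germ_src g))"

definition restricted_germ :: "('i, 'p, 't) germ \<Rightarrow> ('j, 'q, 's) germ" where
  "restricted_germ g = germ_inv Y (tgt_germ (germ_tgt X g)) \<cdot>\<^bsub>Y\<^esub>
     (hom_germ \<sigma> (conj_germ g) \<cdot>\<^bsub>Y\<^esub> tgt_germ (germ_src g))"

text \<open>
  The future link from \<open>\<kappa>\<close> to \<open>\<sigma>\<close>, \<open>N(\<xi>) = \<sigma>(\<xi> \<circ> \<xi>\<^sub>a\<^sup>-\<^sup>1) \<circ> \<xi>'\<^sub>a\<close>.  It is available before \<open>\<kappa>\<close> is known to be a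
  homomorphism, and \<open>N(\<xi>\<^sub>b \<circ> \<eta>) = \<xi>'\<^sub>b \<circ> \<kappa>(\<eta>)\<close> determines what \<open>\<kappa>\<close> has to do on \<open>\<eta>\<close>.
\<close>

definition half_link_germ :: "('i, 'p, 't) germ \<Rightarrow> ('j, 'q, 's) germ" where
  "half_link_germ g = hom_germ \<sigma> (g \<cdot>\<^bsub>X\<^esub> germ_inv X (src_germ (germ_src g))) \<cdot>\<^bsub>Y\<^esub> tgt_germ (germ_src g)"

lemma \<theta>_chart: "a \<in> hsrc \<kappa> \<Longrightarrow> \<theta> a \<in> charts X" "a \<in> hsrc \<kappa> \<Longrightarrow> hchart \<sigma> (\<theta> a) \<in> charts Y"
  using \<theta>(1) hom_charts[OF \<sigma>] by blast+

lemma src_dom: "a \<in> hsrc \<kappa> \<Longrightarrow> arrow_dom X a (\<theta> a) (e a) = topspace (chart_top X a)"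
  using X.arrow_dom_total src \<theta>_chart(1) e \<theta>(2) by blast

text \<open>
  The map \<open>f\<^sub>a\<close> is the composite of \<open>f\<^sub>\<theta>\<^sub>(\<^sub>a\<^sub>) \<circ> \<phi>\<close> for \<open>\<xi>\<^sub>a\<close> with the homeomorphism inverse to that of \<open>\<xi>'\<^sub>a\<close>.
\<close>

lemma hmap_continuous:
  assumes a: "a \<in> hsrc \<kappa>"
  shows "continuous_map (chart_top X a) (chart_top Y (hchart \<kappa> a)) (hmap \<kappa> a)"
proof -
  have aX: "a \<in> charts X" using src a by blast
  note E' = tgt[OF a] \<theta>_chart(2)[OF a] e'[OF a]
  note inv = Y.arrow_inv[OF E']
  let ?D = "arrow_range Y (hchart \<kappa> a) (hchart \<sigma> (\<theta> a)) (e' a)"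
  let ?f = "\<lambda>x. hmap \<sigma> (\<theta> a) (arrow_map X a (\<theta> a) (e a) x)"
  have "continuous_map (chart_top X a) (chart_top X (\<theta> a)) (arrow_map X a (\<theta> a) (e a))"
    using X.arrow_map_continuous[OF aX \<theta>_chart(1)[OF a] e[OF a]] src_dom[OF a] by simp
  moreover have "continuous_map (chart_top X (\<theta> a)) (chart_top Y (hchart \<sigma> (\<theta> a))) (hmap \<sigma> (\<theta> a))"
    using \<sigma> \<theta>(1)[OF a] by (simp add: is_hom_iff_link)
  ultimately have "continuous_map (chart_top X a) (chart_top Y (hchart \<sigma> (\<theta> a))) ?f"
    using continuous_map_compose by (fastforce simp: o_def)
  moreover have "?f x \<in> ?D" if "x \<in> topspace (chart_top X a)" for x
    unfolding arrow_range_def using map[OF a that] by (metis imageI)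
  ultimately have "continuous_map (chart_top X a) (subtopology (chart_top Y (hchart \<sigma> (\<theta> a))) ?D) ?f"
    by (simp add: continuous_map_in_subtopology image_subset_iff)
  moreover have "continuous_map (subtopology (chart_top Y (hchart \<sigma> (\<theta> a))) ?D) (chart_top Y (hchart \<kappa> a))
      (arrow_map Y (hchart \<sigma> (\<theta> a)) (hchart \<kappa> a) (arrow_inv Y (hchart \<kappa> a) (hchart \<sigma> (\<theta> a)) (e' a)))"
    using Y.arrow_map_continuous[OF E'(2,1) conjunct1[OF inv]] inv by simp
  ultimately have "continuous_map (chart_top X a) (chart_top Y (hchart \<kappa> a))
      (arrow_map Y (hchart \<sigma> (\<theta> a)) (hchart \<kappa> a) (arrow_inv Y (hchart \<kappa> a) (hchart \<sigma> (\<theta> a)) (e' a)) \<circ> ?f)"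
    by (rule continuous_map_compose)
  then show ?thesis
  proof (rule continuous_map_eq)
    fix x assume x: "x \<in> topspace (chart_top X a)"
    have g: "(hchart \<kappa> a, hmap \<kappa> a x, e' a, hchart \<sigma> (\<theta> a)) \<in> germs Y"
      using map[OF a x] E' by (simp add: germs_def)
    show "(arrow_map Y (hchart \<sigma> (\<theta> a)) (hchart \<kappa> a) (arrow_inv Y (hchart \<kappa> a) (hchart \<sigma> (\<theta> a)) (e' a)) \<circ> ?f) x
        = hmap \<kappa> a x"
      using Y.germ_inv_germ(2)[OF g] map[OF a x] by simp
  qed
qed

lemma src_germ_facts:
  assumes "p \<in> germ_points X" "fst p \<in> hsrc \<kappa>"
  shows "src_germ p \<in> germs_between X (hsrc \<kappa>) (hsrc \<sigma>)" "src_germ p \<in> germs X" "germ_src (src_germ p) = p"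
    "tgt_germ p \<in> germs Y" "germ_src (tgt_germ p) = hom_point \<kappa> p"
    "germ_tgt Y (tgt_germ p) = hom_point \<sigma> (germ_tgt X (src_germ p))"
proof -
  obtain a x where p: "p = (a, x)" by (cases p)
  have a: "a \<in> hsrc \<kappa>" "a \<in> charts X" "x \<in> topspace (chart_top X a)"
    using assms by (auto simp: p germ_points_def)
  show "src_germ p \<in> germs_between X (hsrc \<kappa>) (hsrc \<sigma>)" "src_germ p \<in> germs X" "germ_src (src_germ p) = p"
    using a e \<theta> \<theta>_chart src_dom by (auto simp: p src_germ_def germs_between_def germs_def)
  show "tgt_germ p \<in> germs Y" "germ_src (tgt_germ p) = hom_point \<kappa> p"
    "germ_tgt Y (tgt_germ p) = hom_point \<sigma> (germ_tgt X (src_germ p))"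
    using a e' tgt \<theta>_chart map[OF a(1,3)]
    by (auto simp: p src_germ_def tgt_germ_def germs_def hom_point_def)
qed

lemma src_germ_points:
  assumes "g \<in> germs_between X (hsrc \<kappa>) B"
  shows "germ_src g \<in> germ_points X" "fst (germ_src g) \<in> hsrc \<kappa>"
    "B = hsrc \<kappa> \<Longrightarrow> germ_tgt X g \<in> germ_points X" "B = hsrc \<kappa> \<Longrightarrow> fst (germ_tgt X g) \<in> hsrc \<kappa>"
  using assms by (auto simp: germs_between_def)

lemma half_link_germ_facts:
  assumes g: "g \<in> germs_between X (hsrc \<kappa>) (hsrc \<sigma>)"
  defines "s \<equiv> g \<cdot>\<^bsub>X\<^esub> germ_inv X (src_germ (germ_src g))"
  shows "s \<in> germs_between X (hsrc \<sigma>) (hsrc \<sigma>)" "germ_tgt X s = germ_tgt X g"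
    "germ_src s = germ_tgt X (src_germ (germ_src g))"
    "hom_germ \<sigma> s \<in> germs Y" "germ_tgt Y (hom_germ \<sigma> s) = hom_point \<sigma> (germ_tgt X g)"
    "half_link_germ g \<in> germs Y" "germ_src (half_link_germ g) = hom_point \<kappa> (germ_src g)"
    "germ_tgt Y (half_link_germ g) = hom_point \<sigma> (germ_tgt X g)"
proof -
  note E = src_germ_facts[OF src_germ_points(1,2)[OF g]]
  show s: "s \<in> germs_between X (hsrc \<sigma>) (hsrc \<sigma>)"
    unfolding s_def using germs_between_comp[OF germs_between_inv[OF E(1)] g] E
    by (simp add: X.germ_inv_germ)
  show t: "germ_tgt X s = germ_tgt X g" and u: "germ_src s = germ_tgt X (src_germ (germ_src g))"
    using E germs_between_germ[OF g] by (simp_all add: s_def X.germ_inv_germ X.germ_comp_germ)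
  show v: "hom_germ \<sigma> s \<in> germs Y" "germ_tgt Y (hom_germ \<sigma> s) = hom_point \<sigma> (germ_tgt X g)"
    using linkD(1,2)[OF hom_link[OF \<sigma>] s] t by simp_all
  have *: "half_link_germ g = hom_germ \<sigma> s \<cdot>\<^bsub>Y\<^esub> tgt_germ (germ_src g)"
    by (simp add: half_link_germ_def s_def)
  show "half_link_germ g \<in> germs Y" "germ_src (half_link_germ g) = hom_point \<kappa> (germ_src g)"
    "germ_tgt Y (half_link_germ g) = hom_point \<sigma> (germ_tgt X g)"
    unfolding * using v E u by (simp_all add: Y.germ_comp_germ)
qed

lemma half_link_exists:
  obtains N where "\<And>g. g \<in> germs_between X (hsrc \<kappa>) (hsrc \<sigma>) \<Longrightarrow> transport \<kappa> \<sigma> N g = half_link_germ g"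
proof
  let ?B = "germs_between X (hsrc \<kappa>) (hsrc \<sigma>)"
  define N where "N a b \<xi> = germ_arrow (half_link_germ (a, SOME x. x \<in> arrow_dom X a b \<xi>, \<xi>, b))" for a b \<xi>
  have const: "germ_arrow (half_link_germ (a, x, \<xi>, b)) = germ_arrow (half_link_germ (a, y, \<xi>, b))"
    if x: "(a, x, \<xi>, b) \<in> ?B" and y: "(a, y, \<xi>, b) \<in> ?B" for a b \<xi> x y
  proof (rule locally_constant_on_connected[where S = "arrow_dom X a b \<xi>" and
        F = "\<lambda>x. germ_arrow (half_link_germ (a, x, \<xi>, b))"])
    have ab: "a \<in> charts X" "b \<in> charts X" "\<xi> \<in> arrows X a b" "a \<in> hsrc \<kappa>" "b \<in> hsrc \<sigma>"
      using x by (auto simp: germs_between_def germs_def)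
    show "connectedin (chart_top X a) (arrow_dom X a b \<xi>)" by (rule X.arrow_dom_connected[OF ab(1-3)])
    show "x \<in> arrow_dom X a b \<xi>" "y \<in> arrow_dom X a b \<xi>"
      using x y by (auto simp: germs_between_def germs_def)
    fix x0 assume x0: "x0 \<in> arrow_dom X a b \<xi>"
    then have g: "(a, x0, \<xi>, b) \<in> ?B" using ab by (simp add: germs_between_def germs_def)
    have ea: "x0 \<in> arrow_dom X a (\<theta> a) (e a)"
      using src_dom[OF ab(4)] X.arrow_dom_subset[OF ab(1-3)] x0 by blast
    note H = half_link_germ_facts[OF g]
    note E = src_germ_facts[OF src_germ_points(1,2)[OF g]]
    have hb: "hchart \<sigma> b \<in> charts Y" using hom_charts[OF \<sigma>] ab by blast
    have "\<exists>U. openin (chart_top X a) U \<and> x0 \<in> U \<and> (\<forall>x\<in>U. x \<in> arrow_dom X a (\<theta> a) (e a) \<and>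
        germ_arrow (half_link_germ (a, x, \<xi>, b)) = germ_arrow (half_link_germ (a, x0, \<xi>, b)))"
      unfolding half_link_germ_def src_germ_def tgt_germ_def germ_src.simps fst_conv snd_conv
        germ_inv.simps germ_comp.simps transport.simps germ_arrow.simps
    proof (rule composite_locally_constant[OF ab(1,2) \<theta>_chart(1)[OF ab(4)] \<theta>_chart(2)[OF ab(4)] hb
          tgt[OF ab(4)] ab(3) x0 e[OF ab(4)] ea hmap_continuous[OF ab(4)] e'[OF ab(4)]])
    qed (use H(3,4) E(4,6) in \<open>simp_all add: germs_def comp_dom_def src_germ_def tgt_germ_def hom_point_def\<close>)
    then show "\<exists>U. openin (chart_top X a) U \<and> x0 \<in> U \<and> (\<forall>x\<in>U \<inter> arrow_dom X a b \<xi>.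
        germ_arrow (half_link_germ (a, x, \<xi>, b)) = germ_arrow (half_link_germ (a, x0, \<xi>, b)))"
      by (metis IntE)
  qed
  show "transport \<kappa> \<sigma> N g = half_link_germ g" if g: "g \<in> ?B" for g
  proof -
    obtain a x \<xi> b where eq: "g = (a, x, \<xi>, b)" by (cases g) auto
    let ?y = "SOME x. x \<in> arrow_dom X a b \<xi>"
    have "x \<in> arrow_dom X a b \<xi>" using g by (auto simp: eq germs_between_def germs_def)
    then have "?y \<in> arrow_dom X a b \<xi>" by (rule someI[of "\<lambda>x. x \<in> arrow_dom X a b \<xi>"])
    then have "(a, ?y, \<xi>, b) \<in> ?B" using g by (auto simp: eq germs_between_def germs_def)
    then have "germ_arrow (transport \<kappa> \<sigma> N g) = germ_arrow (half_link_germ g)"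
      using const[of a ?y \<xi> b x] g by (simp add: eq N_def)
    moreover have "fst (germ_tgt Y (transport \<kappa> \<sigma> N g)) = fst (germ_tgt Y (half_link_germ g))"
      using half_link_germ_facts(8)[OF g] by simp
    ultimately show ?thesis
      using half_link_germ_facts(7)[OF g] by (intro germ_eqI[where X = Y]) simp_all
  qed
qed

lemma restricted_germ_facts:
  assumes g: "g \<in> germs_between X (hsrc \<kappa>) (hsrc \<kappa>)"
  defines "h \<equiv> src_germ (germ_tgt X g) \<cdot>\<^bsub>X\<^esub> g"
  shows "h \<in> germs_between X (hsrc \<kappa>) (hsrc \<sigma>)" "germ_tgt X h = germ_tgt X (src_germ (germ_tgt X g))"
    "restricted_germ g = germ_inv Y (tgt_germ (germ_tgt X g)) \<cdot>\<^bsub>Y\<^esub> half_link_germ h"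
    "restricted_germ g \<in> germs Y" "germ_src (restricted_germ g) = hom_point \<kappa> (germ_src g)"
    "germ_tgt Y (restricted_germ g) = hom_point \<kappa> (germ_tgt X g)"
    "half_link_germ h = tgt_germ (germ_tgt X g) \<cdot>\<^bsub>Y\<^esub> restricted_germ g"
proof -
  note E = src_germ_facts[OF src_germ_points(3,4)[OF g refl]]
  show h: "h \<in> germs_between X (hsrc \<kappa>) (hsrc \<sigma>)"
    unfolding h_def using germs_between_comp[OF g E(1)] E by simp
  show t: "germ_tgt X h = germ_tgt X (src_germ (germ_tgt X g))"
    using E germs_between_germ[OF g] by (simp add: h_def X.germ_comp_germ)
  show r: "restricted_germ g = germ_inv Y (tgt_germ (germ_tgt X g)) \<cdot>\<^bsub>Y\<^esub> half_link_germ h"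
    by (simp add: restricted_germ_def half_link_germ_def conj_germ_def h_def)
  note H = half_link_germ_facts[OF h]
  have s: "germ_src h = germ_src g" by (simp add: h_def)
  show "restricted_germ g \<in> germs Y" "germ_src (restricted_germ g) = hom_point \<kappa> (germ_src g)"
    "germ_tgt Y (restricted_germ g) = hom_point \<kappa> (germ_tgt X g)"
    unfolding r using H E t s by (simp_all add: Y.germ_comp_germ Y.germ_inv_germ)
  show "half_link_germ h = tgt_germ (germ_tgt X g) \<cdot>\<^bsub>Y\<^esub> restricted_germ g"
    unfolding r using H E t by (simp add: Y.germ_inv_cancel)
qed

lemma half_link_comp_left:
  assumes g: "g \<in> germs_between X (hsrc \<kappa>) (hsrc \<sigma>)" and h: "h \<in> germs_between X (hsrc \<sigma>) (hsrc \<sigma>)"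
    and gh: "germ_tgt X g = germ_src h"
  shows "half_link_germ (h \<cdot>\<^bsub>X\<^esub> g) = hom_germ \<sigma> h \<cdot>\<^bsub>Y\<^esub> half_link_germ g"
proof -
  let ?s = "g \<cdot>\<^bsub>X\<^esub> germ_inv X (src_germ (germ_src g))"
  note E = src_germ_facts[OF src_germ_points(1,2)[OF g]]
  note H = half_link_germ_facts[OF g]
  have "(h \<cdot>\<^bsub>X\<^esub> g) \<cdot>\<^bsub>X\<^esub> germ_inv X (src_germ (germ_src g)) = h \<cdot>\<^bsub>X\<^esub> ?s"
    using E germs_between_germ[OF g] germs_between_germ[OF h] gh
    by (simp add: X.germ_assoc X.germ_inv_germ)
  then have "half_link_germ (h \<cdot>\<^bsub>X\<^esub> g) = (hom_germ \<sigma> h \<cdot>\<^bsub>Y\<^esub> hom_germ \<sigma> ?s) \<cdot>\<^bsub>Y\<^esub> tgt_germ (germ_src g)"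
    using linkD(3)[OF hom_link[OF \<sigma>] H(1) h] H(2) gh by (simp add: half_link_germ_def)
  also have "\<dots> = hom_germ \<sigma> h \<cdot>\<^bsub>Y\<^esub> half_link_germ g"
    unfolding half_link_germ_def using E H linkD(1,2)[OF hom_link[OF \<sigma>] h] gh
    by (intro Y.germ_assoc) simp_all
  finally show ?thesis .
qed

lemma half_link_comp_right:
  assumes k: "k \<in> germs_between X (hsrc \<kappa>) (hsrc \<kappa>)" and g: "g \<in> germs_between X (hsrc \<kappa>) (hsrc \<sigma>)"
    and kg: "germ_tgt X k = germ_src g"
  shows "half_link_germ (g \<cdot>\<^bsub>X\<^esub> k) = half_link_germ g \<cdot>\<^bsub>Y\<^esub> restricted_germ k"
proof -
  let ?s = "g \<cdot>\<^bsub>X\<^esub> germ_inv X (src_germ (germ_src g))" and ?h = "src_germ (germ_tgt X k) \<cdot>\<^bsub>X\<^esub> k"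
  note E = src_germ_facts[OF src_germ_points(1,2)[OF g]]
  note H = half_link_germ_facts[OF g] and C = restricted_germ_facts[OF k]
  have "g \<cdot>\<^bsub>X\<^esub> k = ?s \<cdot>\<^bsub>X\<^esub> ?h"
    using E germs_between_germ[OF g] germs_between_germ[OF k] kg
    by (simp add: X.germ_assoc X.germ_inv_germ X.germ_comp_germ X.germ_inv_cancel)
  then have "half_link_germ (g \<cdot>\<^bsub>X\<^esub> k) = hom_germ \<sigma> ?s \<cdot>\<^bsub>Y\<^esub> (tgt_germ (germ_tgt X k) \<cdot>\<^bsub>Y\<^esub> restricted_germ k)"
    using half_link_comp_left[OF C(1) H(1)] C(2,7) H(3) kg by simp
  also have "\<dots> = half_link_germ g \<cdot>\<^bsub>Y\<^esub> restricted_germ k"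
    unfolding half_link_germ_def using E H C kg
    by (subst Y.germ_assoc) simp_all
  finally show ?thesis .
qed

text \<open>
  Left cancellation of \<open>\<xi>'\<^sub>c\<close> reduces functoriality of the restriction to the law
  \<open>N(\<xi> \<circ> \<zeta>) = N(\<xi>) \<circ> \<kappa>(\<zeta>)\<close> for the half link, applied to \<open>\<xi> = \<xi>\<^sub>c \<circ> h\<close>.
\<close>

lemma restricted_germ_comp:
  assumes g: "g \<in> germs_between X (hsrc \<kappa>) (hsrc \<kappa>)" and h: "h \<in> germs_between X (hsrc \<kappa>) (hsrc \<kappa>)"
    and gh: "germ_tgt X g = germ_src h"
  shows "restricted_germ (h \<cdot>\<^bsub>X\<^esub> g) = restricted_germ h \<cdot>\<^bsub>Y\<^esub> restricted_germ g"
proof -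
  let ?E = "src_germ (germ_tgt X h)" and ?E' = "tgt_germ (germ_tgt X h)"
  note G = germs_between_germ[OF g] and H = germs_between_germ[OF h]
  note E = src_germ_facts[OF src_germ_points(3,4)[OF h refl]]
  have t: "germ_tgt X (h \<cdot>\<^bsub>X\<^esub> g) = germ_tgt X h" using G H gh by (simp add: X.germ_comp_germ)
  have "?E \<cdot>\<^bsub>X\<^esub> (h \<cdot>\<^bsub>X\<^esub> g) = (?E \<cdot>\<^bsub>X\<^esub> h) \<cdot>\<^bsub>X\<^esub> g"
    using G H gh E by (simp add: X.germ_assoc)
  then have "?E' \<cdot>\<^bsub>Y\<^esub> restricted_germ (h \<cdot>\<^bsub>X\<^esub> g) = half_link_germ (?E \<cdot>\<^bsub>X\<^esub> h) \<cdot>\<^bsub>Y\<^esub> restricted_germ g"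
    using half_link_comp_right[OF g restricted_germ_facts(1)[OF h]] restricted_germ_facts(7)[OF germs_between_comp[OF g h gh]] t gh
    by simp
  also have "\<dots> = ?E' \<cdot>\<^bsub>Y\<^esub> (restricted_germ h \<cdot>\<^bsub>Y\<^esub> restricted_germ g)"
    unfolding restricted_germ_facts(7)[OF h] using restricted_germ_facts[OF h] restricted_germ_facts[OF g] E gh
    by (intro Y.germ_assoc) simp_all
  finally show ?thesis
    by (rule Y.germ_left_cancel)
      (use restricted_germ_facts(4-6)[OF germs_between_comp[OF g h gh]] restricted_germ_facts(4-6)[OF h] restricted_germ_facts(4-6)[OF g] E t gh
        in \<open>simp_all add: Y.germ_comp_germ\<close>)
qed

lemma restricted_link:
  assumes "\<And>g. g \<in> germs_between X (hsrc \<kappa>) (hsrc \<kappa>) \<Longrightarrow> hom_germ \<kappa> g = restricted_germ g"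
  shows "is_link X Y \<kappa> \<kappa> (hrho \<kappa>)" and "linked X Y \<kappa> \<sigma>"
proof -
  show "is_link X Y \<kappa> \<kappa> (hrho \<kappa>)"
    unfolding is_link_def
    using restricted_germ_facts(4,6) restricted_germ_comp germs_between_comp by (simp add: assms)
  obtain N where N: "\<And>g. g \<in> germs_between X (hsrc \<kappa>) (hsrc \<sigma>) \<Longrightarrow> transport \<kappa> \<sigma> N g = half_link_germ g"
    using half_link_exists by blast
  have "is_link X Y \<kappa> \<sigma> N"
    unfolding is_link_def
    using half_link_germ_facts(6,8) half_link_comp_left half_link_comp_right germs_between_comp
    by (simp add: assms N)
  then show "linked X Y \<kappa> \<sigma>" unfolding linked_def by blast
qed

text \<open>
  For \<open>\<eta> \<in> T(U\<^sub>a, U\<^sub>b)\<close> the composite \<open>\<xi>\<^sub>b \<circ> \<eta>\<close> is formed on the whole connected domain of \<open>\<eta>\<close>, since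
  \<open>\<xi>\<^sub>b\<close> is defined on its whole chart; so it is a single element \<open>\<omega>\<close> of \<open>T\<close>.  Likewise the composite of
  \<open>\<xi>'\<^sub>b\<^sup>-\<^sup>1\<close> and \<open>N(\<omega>)\<close> is constant on the connected image of that domain.
\<close>

lemma restriction_exists:
  obtains R where "\<And>a b \<xi> x. (a, x, \<xi>, b) \<in> germs_between X (hsrc \<kappa>) (hsrc \<kappa>) \<Longrightarrow>
    (hchart \<kappa> a, hmap \<kappa> a x, R a b \<xi>, hchart \<kappa> b) = restricted_germ (a, x, \<xi>, b)"
proof
  let ?B = "germs_between X (hsrc \<kappa>) (hsrc \<kappa>)"
  obtain N where N: "\<And>g. g \<in> germs_between X (hsrc \<kappa>) (hsrc \<sigma>) \<Longrightarrow> transport \<kappa> \<sigma> N g = half_link_germ g"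
    using half_link_exists by blast
  define R where "R a b \<xi> = germ_arrow (restricted_germ (a, SOME x. x \<in> arrow_dom X a b \<xi>, \<xi>, b))" for a b \<xi>
  have const: "germ_arrow (restricted_germ (a, x, \<xi>, b)) = germ_arrow (restricted_germ (a, y, \<xi>, b))"
    if x: "(a, x, \<xi>, b) \<in> ?B" and y: "(a, y, \<xi>, b) \<in> ?B" for a b \<xi> x y
  proof -
    have ab: "a \<in> charts X" "b \<in> charts X" "\<xi> \<in> arrows X a b" "a \<in> hsrc \<kappa>" "b \<in> hsrc \<kappa>"
      using x by (auto simp: germs_between_def germs_def)
    have xy: "x \<in> arrow_dom X a b \<xi>" "y \<in> arrow_dom X a b \<xi>"
      using x y by (auto simp: germs_between_def germs_def)
    let ?D = "arrow_dom X a b \<xi>"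
    let ?\<omega> = "arrow_comp X a b (\<theta> b) (e b) \<xi>"
    note conn = X.arrow_dom_connected[OF ab(1-3)]
    have "?D \<subseteq> comp_dom X a b (\<theta> b) (e b) \<xi>"
      using src_dom[OF ab(5)] X.arrow_map_in[OF ab(1-3)] by (auto simp: comp_dom_def)
    then have \<omega>: "?\<omega> z = ?\<omega> x" if "z \<in> ?D" for z
      using X.arrow_comp_constant[OF ab(1,2) \<theta>_chart(1)[OF ab(5)] ab(3) e[OF ab(5)] conn _ that xy(1)]
      by blast
    let ?N = "N a (\<theta> b) (?\<omega> x)" and ?i = "arrow_inv Y (hchart \<kappa> b) (hchart \<sigma> (\<theta> b)) (e' b)"
    have g: "(a, z, \<xi>, b) \<in> ?B" if "z \<in> ?D" for z
      using that ab by (simp add: germs_between_def germs_def)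
    have h: "half_link_germ (src_germ (germ_tgt X (a, z, \<xi>, b)) \<cdot>\<^bsub>X\<^esub> (a, z, \<xi>, b)) =
        (hchart \<kappa> a, hmap \<kappa> a z, ?N, hchart \<sigma> (\<theta> b))" if "z \<in> ?D" for z
      using N[OF restricted_germ_facts(1)[OF g[OF that]]] \<omega>[OF that] by (simp add: src_germ_def)
    have r: "germ_arrow (restricted_germ (a, z, \<xi>, b)) =
        arrow_comp Y (hchart \<kappa> a) (hchart \<sigma> (\<theta> b)) (hchart \<kappa> b) ?i ?N (hmap \<kappa> a z)" if "z \<in> ?D" for z
      unfolding restricted_germ_facts(3)[OF g[OF that]] h[OF that] by (simp add: tgt_germ_def)
    have n: "(hchart \<kappa> a, hmap \<kappa> a z, ?N, hchart \<sigma> (\<theta> b)) \<in> germs Y"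
      "arrow_map Y (hchart \<kappa> a) (hchart \<sigma> (\<theta> b)) ?N (hmap \<kappa> a z) \<in>
         arrow_dom Y (hchart \<sigma> (\<theta> b)) (hchart \<kappa> b) ?i" if "z \<in> ?D" for z
    proof -
      note C = restricted_germ_facts[OF g[OF that]]
      show "(hchart \<kappa> a, hmap \<kappa> a z, ?N, hchart \<sigma> (\<theta> b)) \<in> germs Y"
        using half_link_germ_facts(6)[OF C(1)] h[OF that] by simp
      note E = src_germ_facts[OF src_germ_points(3,4)[OF g[OF that] refl]]
      have "germ_inv Y (tgt_germ (germ_tgt X (a, z, \<xi>, b))) \<in> germs Y"
        using E by (simp add: Y.germ_inv_germ)
      moreover have "germ_src (germ_inv Y (tgt_germ (germ_tgt X (a, z, \<xi>, b)))) =
          (hchart \<sigma> (\<theta> b), arrow_map Y (hchart \<kappa> a) (hchart \<sigma> (\<theta> b)) ?N (hmap \<kappa> a z))"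
        using half_link_germ_facts(8)[OF C(1)] C(2) E(6) unfolding h[OF that] by simp
      ultimately show "arrow_map Y (hchart \<kappa> a) (hchart \<sigma> (\<theta> b)) ?N (hmap \<kappa> a z) \<in>
         arrow_dom Y (hchart \<sigma> (\<theta> b)) (hchart \<kappa> b) ?i"
        by (auto simp: tgt_germ_def germs_def)
    qed
    have "arrow_comp Y (hchart \<kappa> a) (hchart \<sigma> (\<theta> b)) (hchart \<kappa> b) ?i ?N (hmap \<kappa> a x) =
        arrow_comp Y (hchart \<kappa> a) (hchart \<sigma> (\<theta> b)) (hchart \<kappa> b) ?i ?N (hmap \<kappa> a y)"
    proof (rule Y.arrow_comp_constant[where S = "hmap \<kappa> a ` ?D"])
      show "hchart \<kappa> a \<in> charts Y" "hchart \<sigma> (\<theta> b) \<in> charts Y" "hchart \<kappa> b \<in> charts Y"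
        using tgt \<theta>_chart ab by blast+
      show "?N \<in> arrows Y (hchart \<kappa> a) (hchart \<sigma> (\<theta> b))" using n(1)[OF xy(1)] by (simp add: germs_def)
      show "?i \<in> arrows Y (hchart \<sigma> (\<theta> b)) (hchart \<kappa> b)"
        using Y.arrow_inv[OF tgt[OF ab(5)] \<theta>_chart(2)[OF ab(5)] e'[OF ab(5)]] by simp
      show "connectedin (chart_top Y (hchart \<kappa> a)) (hmap \<kappa> a ` ?D)"
        by (rule connectedin_continuous_map_image[OF hmap_continuous[OF ab(4)] conn])
      show "hmap \<kappa> a ` ?D \<subseteq> comp_dom Y (hchart \<kappa> a) (hchart \<sigma> (\<theta> b)) (hchart \<kappa> b) ?i ?N"
      proof (rule image_subsetI)
        fix z assume "z \<in> ?D"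
        then show "hmap \<kappa> a z \<in> comp_dom Y (hchart \<kappa> a) (hchart \<sigma> (\<theta> b)) (hchart \<kappa> b) ?i ?N"
          using n[of z] unfolding comp_dom_def germs_def by blast
      qed
    qed (use xy in auto)
    then show ?thesis unfolding r[OF xy(1)] r[OF xy(2)] .
  qed
  show "(hchart \<kappa> a, hmap \<kappa> a x, R a b \<xi>, hchart \<kappa> b) = restricted_germ (a, x, \<xi>, b)"
    if g: "(a, x, \<xi>, b) \<in> ?B" for a b \<xi> x
  proof -
    let ?y = "SOME x. x \<in> arrow_dom X a b \<xi>"
    have "x \<in> arrow_dom X a b \<xi>" using g by (auto simp: germs_between_def germs_def)
    then have "?y \<in> arrow_dom X a b \<xi>" by (rule someI[of "\<lambda>x. x \<in> arrow_dom X a b \<xi>"])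
    then have "(a, ?y, \<xi>, b) \<in> ?B" using g by (auto simp: germs_between_def germs_def)
    then have "R a b \<xi> = germ_arrow (restricted_germ (a, x, \<xi>, b))"
      using const[of a ?y \<xi> b x] g by (simp add: R_def)
    then show ?thesis
      using restricted_germ_facts(5,6)[OF g] by (intro germ_eqI[where X = Y]) (simp_all add: hom_point_def)
  qed
qed

end


section \<open>Equivalence of homomorphisms means being linked\<close>

lemma (in restriction_data) restricted_germ_eq:
  "restricted_germ (a, z, \<eta>, b) =
    (hchart \<kappa> a, hmap \<kappa> a z,
     arrow_comp Y (hchart \<kappa> a) (hchart \<sigma> (\<theta> b)) (hchart \<kappa> b)
       (arrow_inv Y (hchart \<kappa> b) (hchart \<sigma> (\<theta> b)) (e' b))
       (arrow_comp Y (hchart \<kappa> a) (hchart \<sigma> (\<theta> a)) (hchart \<sigma> (\<theta> b))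
         (hrho \<sigma> (\<theta> a) (\<theta> b)
           (arrow_comp X (\<theta> a) a (\<theta> b) (arrow_comp X a b (\<theta> b) (e b) \<eta> z)
             (arrow_inv X a (\<theta> a) (e a)) (arrow_map X a (\<theta> a) (e a) z)))
         (e' a) (hmap \<kappa> a z))
       (hmap \<kappa> a z),
     hchart \<kappa> b)"
  by (simp add: restricted_germ_def conj_germ_def src_germ_def tgt_germ_def)

context orbispace_pair
begin

lemma cover_homsD:
  "\<sigma> \<in> cover_homs X Y \<Longrightarrow> is_hom X Y \<sigma>"
  "\<sigma> \<in> cover_homs X Y \<Longrightarrow> is_cover X (hsrc \<sigma>)"
  by (simp_all add: cover_homs_def)

lemma link_proj:
  assumes \<sigma>: "is_hom X Y \<sigma>" and \<tau>: "is_hom X Y \<tau>" and N: "is_link X Y \<sigma> \<tau> N"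
    and ab: "a \<in> hsrc \<sigma>" "b \<in> hsrc \<tau>"
    and xy: "x \<in> topspace (chart_top X a)" "y \<in> topspace (chart_top X b)"
    and eq: "chart_proj X a x = chart_proj X b y"
  shows "chart_proj Y (hchart \<sigma> a) (hmap \<sigma> a x) = chart_proj Y (hchart \<tau> b) (hmap \<tau> b y)"
proof -
  have c: "a \<in> charts X" "b \<in> charts X" "hchart \<sigma> a \<in> charts Y" "hchart \<tau> b \<in> charts Y"
    using hom_charts \<sigma> \<tau> ab by blast+
  obtain \<xi> where \<xi>: "\<xi> \<in> arrows X a b" "x \<in> arrow_dom X a b \<xi>" "arrow_map X a b \<xi> x = y"
    using X.same_image_iff[OF c(1,2) xy] eq by blast
  note l = link_arrow[OF N hom_charts(1)[OF \<sigma>] hom_charts(1)[OF \<tau>] ab \<xi>(1)]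
  show ?thesis
    using Y.arrow_proj[OF c(3,4) l(1) l(2)[OF \<xi>(2)]] l(3)[OF \<xi>(2)] \<xi>(3) by simp
qed

lemma underlying_map_chart:
  assumes \<sigma>: "is_hom X Y \<sigma>" and a: "a \<in> hsrc \<sigma>" and x: "x \<in> topspace (chart_top X a)"
  shows "underlying_map X Y \<sigma> (chart_proj X a x) = chart_proj Y (hchart \<sigma> a) (hmap \<sigma> a x)"
  unfolding underlying_map_def
proof (rule the_equality)
  show "\<exists>b\<in>hsrc \<sigma>. \<exists>y\<in>topspace (chart_top X b). chart_proj X b y = chart_proj X a x \<and>
      chart_proj Y (hchart \<sigma> a) (hmap \<sigma> a x) = chart_proj Y (hchart \<sigma> b) (hmap \<sigma> b y)"
    using a x by blast
  show "q = chart_proj Y (hchart \<sigma> a) (hmap \<sigma> a x)"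
    if "\<exists>b\<in>hsrc \<sigma>. \<exists>y\<in>topspace (chart_top X b). chart_proj X b y = chart_proj X a x \<and>
      q = chart_proj Y (hchart \<sigma> b) (hmap \<sigma> b y)" for q
    using that link_proj[OF \<sigma> \<sigma> hom_link[OF \<sigma>] _ a _ x] by blast
qed

lemma induced_linked:
  assumes "is_induced_by X Y \<kappa> \<sigma>"
  shows "linked X Y \<kappa> \<sigma>"
proof -
  have hom: "is_hom X Y \<sigma>" "is_hom X Y \<kappa>"
    using assms cover_homsD by (auto simp: is_induced_by_def)
  obtain \<theta> e e' where d: "\<forall>a\<in>hsrc \<kappa>.
           \<theta> a \<in> hsrc \<sigma> \<and> chart_set X a \<subseteq> chart_set X (\<theta> a) \<and>
           e a \<in> arrows X a (\<theta> a) \<and>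
           e' a \<in> arrows Y (hchart \<kappa> a) (hchart \<sigma> (\<theta> a)) \<and>
           (\<forall>x\<in>topspace (chart_top X a).
              hmap \<sigma> (\<theta> a) (arrow_map X a (\<theta> a) (e a) x)
                \<in> arrow_range Y (hchart \<kappa> a) (hchart \<sigma> (\<theta> a)) (e' a) \<and>
              hmap \<kappa> a x =
                inv_into (arrow_dom Y (hchart \<kappa> a) (hchart \<sigma> (\<theta> a)) (e' a))
                  (arrow_map Y (hchart \<kappa> a) (hchart \<sigma> (\<theta> a)) (e' a))
                  (hmap \<sigma> (\<theta> a) (arrow_map X a (\<theta> a) (e a) x)))"
    and F: "\<forall>a\<in>hsrc \<kappa>. \<forall>b\<in>hsrc \<kappa>. \<forall>\<eta>\<in>arrows X a b. \<forall>z\<in>arrow_dom X a b \<eta>.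
           hrho \<kappa> a b \<eta> =
     arrow_comp Y (hchart \<kappa> a) (hchart \<sigma> (\<theta> b)) (hchart \<kappa> b)
       (arrow_inv Y (hchart \<kappa> b) (hchart \<sigma> (\<theta> b)) (e' b))
       (arrow_comp Y (hchart \<kappa> a) (hchart \<sigma> (\<theta> a)) (hchart \<sigma> (\<theta> b))
         (hrho \<sigma> (\<theta> a) (\<theta> b)
           (arrow_comp X (\<theta> a) a (\<theta> b) (arrow_comp X a b (\<theta> b) (e b) \<eta> z)
             (arrow_inv X a (\<theta> a) (e a)) (arrow_map X a (\<theta> a) (e a) z)))
         (e' a) (hmap \<kappa> a z))
       (hmap \<kappa> a z)"
    using assms unfolding is_induced_by_def Let_def by blast
  interpret restriction_data X Y \<sigma> \<kappa> \<theta> e e'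
  proof
    fix a x assume a: "a \<in> hsrc \<kappa>" and x: "x \<in> topspace (chart_top X a)"
    let ?D = "arrow_dom Y (hchart \<kappa> a) (hchart \<sigma> (\<theta> a)) (e' a)"
    let ?m = "arrow_map Y (hchart \<kappa> a) (hchart \<sigma> (\<theta> a)) (e' a)"
    let ?y = "hmap \<sigma> (\<theta> a) (arrow_map X a (\<theta> a) (e a) x)"
    have "?y \<in> ?m ` ?D" "hmap \<kappa> a x = inv_into ?D ?m ?y"
      using d a x by (auto simp: arrow_range_def)
    then show "hmap \<kappa> a x \<in> ?D \<and> ?m (hmap \<kappa> a x) = ?y"
      by (simp add: inv_into_into f_inv_into_f)
  qed (use d hom hom_charts[OF hom(2)] in blast)+
  show ?thesis
  proof (rule restricted_link(2))
    fix g assume "g \<in> germs_between X (hsrc \<kappa>) (hsrc \<kappa>)"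
    moreover obtain a z \<eta> b where "g = (a, z, \<eta>, b)" by (cases g) auto
    ultimately have "g = (a, z, \<eta>, b)" "a \<in> hsrc \<kappa>" "b \<in> hsrc \<kappa>" "\<eta> \<in> arrows X a b" "z \<in> arrow_dom X a b \<eta>"
      by (auto simp: germs_between_def germs_def)
    then show "hom_germ \<kappa> g = restricted_germ g"
      using F by (simp add: restricted_germ_eq)
  qed
qed

text \<open>
  Take any \<open>\<xi>\<^sub>a \<in> T(U\<^sub>a, U\<^sub>\<theta>\<^sub>(\<^sub>a\<^sub>))\<close> and let \<open>\<xi>'\<^sub>a\<close> be its value under the link.  Then the half link of these
  data is the given link, and
  \<open>N(\<xi>\<^sub>b)\<^sup>-\<^sup>1 \<circ> \<tau>(\<xi>\<^sub>b \<circ> \<eta> \<circ> \<xi>\<^sub>a\<^sup>-\<^sup>1) \<circ> N(\<xi>\<^sub>a) = N(\<xi>\<^sub>b)\<^sup>-\<^sup>1 \<circ> N(\<xi>\<^sub>b \<circ> \<eta>) = \<kappa>(\<eta>)\<close>.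
\<close>

lemma linked_induced:
  assumes \<kappa>: "\<kappa> \<in> cover_homs X Y" and \<tau>: "\<tau> \<in> cover_homs X Y" and link: "linked X Y \<kappa> \<tau>"
    and refines: "\<And>a. a \<in> hsrc \<kappa> \<Longrightarrow> \<exists>b\<in>hsrc \<tau>. chart_set X a \<subseteq> chart_set X b"
  shows "is_induced_by X Y \<kappa> \<tau>"
proof -
  have hom: "is_hom X Y \<kappa>" "is_hom X Y \<tau>" using \<kappa> \<tau> cover_homsD by blast+
  obtain N where N: "is_link X Y \<kappa> \<tau> N" using link unfolding linked_def by blast
  obtain \<theta> where \<theta>: "\<And>a. a \<in> hsrc \<kappa> \<Longrightarrow> \<theta> a \<in> hsrc \<tau> \<and> chart_set X a \<subseteq> chart_set X (\<theta> a)"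
    using refines by metis
  have \<theta>c: "\<theta> a \<in> charts X" "a \<in> charts X" if "a \<in> hsrc \<kappa>" for a
    using hom_charts(1)[OF hom(2)] hom_charts(1)[OF hom(1)] \<theta>[OF that] that by auto
  have "\<exists>\<xi>. \<xi> \<in> arrows X a (\<theta> a)" if a: "a \<in> hsrc \<kappa>" for a
  proof -
    obtain x where x: "x \<in> topspace (chart_top X a)" using X.chart_nonempty[OF \<theta>c(2)[OF a]] by blast
    have "chart_proj X a x \<in> chart_set X (\<theta> a)" using X.chart_proj_in[OF \<theta>c(2)[OF a] x] \<theta>[OF a] by blast
    then show ?thesis using X.arrow_exists[OF \<theta>c(2,1)[OF a] x] by metis
  qed
  then obtain e where e: "\<And>a. a \<in> hsrc \<kappa> \<Longrightarrow> e a \<in> arrows X a (\<theta> a)" by metis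
  define e' where "e' a = N a (\<theta> a) (e a)" for a
  have dom: "arrow_dom X a (\<theta> a) (e a) = topspace (chart_top X a)" if "a \<in> hsrc \<kappa>" for a
    using X.arrow_dom_total \<theta>c e \<theta> that by blast
  note l = link_arrow[OF N hom_charts(1)[OF hom(1)] hom_charts(1)[OF hom(2)] _ conjunct1[OF \<theta>] e]
  interpret restriction_data X Y \<tau> \<kappa> \<theta> e e'
  proof
    fix a x assume "a \<in> hsrc \<kappa>" "x \<in> topspace (chart_top X a)"
    then show "hmap \<kappa> a x \<in> arrow_dom Y (hchart \<kappa> a) (hchart \<tau> (\<theta> a)) (e' a) \<and>
        arrow_map Y (hchart \<kappa> a) (hchart \<tau> (\<theta> a)) (e' a) (hmap \<kappa> a x) =
        hmap \<tau> (\<theta> a) (arrow_map X a (\<theta> a) (e a) x)"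
      using l(2,3) dom by (simp add: e'_def)
  next
    show "e' a \<in> arrows Y (hchart \<kappa> a) (hchart \<tau> (\<theta> a))" if "a \<in> hsrc \<kappa>" for a
      using l(1) that by (simp add: e'_def)
  qed (use hom hom_charts[OF hom(1)] \<theta> e in blast)+
  let ?T = "transport \<kappa> \<tau> N"
  have tgt: "tgt_germ p = ?T (src_germ p)" for p
    by (simp add: tgt_germ_def src_germ_def e'_def)
  have half: "half_link_germ h = ?T h" if h: "h \<in> germs_between X (hsrc \<kappa>) (hsrc \<tau>)" for h
  proof -
    note E = src_germ_facts[OF src_germ_points(1,2)[OF h]]
    note H = half_link_germ_facts[OF h]
    have "half_link_germ h = ?T ((h \<cdot>\<^bsub>X\<^esub> germ_inv X (src_germ (germ_src h))) \<cdot>\<^bsub>X\<^esub> src_germ (germ_src h))"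
      unfolding half_link_germ_def tgt using linkD(4)[OF N E(1) H(1)] H(3) by simp
    then show ?thesis using X.germ_inv_cancel(3)[OF E(2) germs_between_germ[OF h]] E(3) by simp
  qed
  have F: "hom_germ \<kappa> g = restricted_germ g" if g: "g \<in> germs_between X (hsrc \<kappa>) (hsrc \<kappa>)" for g
  proof -
    note E = src_germ_facts[OF src_germ_points(3,4)[OF g refl]]
    note C = restricted_germ_facts[OF g]
    have "restricted_germ g = germ_inv Y (?T (src_germ (germ_tgt X g))) \<cdot>\<^bsub>Y\<^esub>
        (?T (src_germ (germ_tgt X g)) \<cdot>\<^bsub>Y\<^esub> hom_germ \<kappa> g)"
      unfolding C(3) half[OF C(1)] tgt using linkD(3)[OF N g E(1)] E(3) by simp
    also have "\<dots> = hom_germ \<kappa> g"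
      using linkD(1,2)[OF N E(1)] linkD(1,2)[OF hom_link[OF hom(1)] g] E(3)
      by (simp add: Y.germ_inv_cancel)
    finally show ?thesis by simp
  qed
  have under: "underlying_map X Y \<tau> ` chart_set X a \<subseteq> chart_set Y (hchart \<kappa> a)" if a: "a \<in> hsrc \<kappa>" for a
  proof (rule image_subsetI)
    fix p assume "p \<in> chart_set X a"
    then obtain x where x: "x \<in> topspace (chart_top X a)" "chart_proj X a x = p"
      using X.chart_lift[OF \<theta>c(2)[OF a]] by metis
    let ?y = "arrow_map X a (\<theta> a) (e a) x"
    have xd: "x \<in> arrow_dom X a (\<theta> a) (e a)" using dom[OF a] x by simp
    have y: "?y \<in> topspace (chart_top X (\<theta> a))" "chart_proj X (\<theta> a) ?y = p"
      using X.arrow_map_in[OF \<theta>c(2,1)[OF a] e[OF a] xd] X.arrow_proj[OF \<theta>c(2,1)[OF a] e[OF a] xd] x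
      by simp_all
    have "underlying_map X Y \<tau> p = chart_proj Y (hchart \<tau> (\<theta> a)) (hmap \<tau> (\<theta> a) ?y)"
      using underlying_map_chart[OF hom(2) _ y(1)] y(2) \<theta>[OF a] by simp
    also have "\<dots> = chart_proj Y (hchart \<kappa> a) (hmap \<kappa> a x)"
      using link_proj[OF hom N a _ x(1) y(1)] y(2) x(2) \<theta>[OF a] by simp
    also have "\<dots> \<in> chart_set Y (hchart \<kappa> a)"
      using hmap_continuous[OF a] x(1) hom_charts(2)[OF hom(1) a]
      by (intro Y.chart_proj_in) (auto simp: continuous_map_def)
    finally show "underlying_map X Y \<tau> p \<in> chart_set Y (hchart \<kappa> a)" .
  qed
  have data: "\<theta> a \<in> hsrc \<tau> \<and> chart_set X a \<subseteq> chart_set X (\<theta> a) \<and> e a \<in> arrows X a (\<theta> a) \<and>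
      e' a \<in> arrows Y (hchart \<kappa> a) (hchart \<tau> (\<theta> a)) \<and>
      (\<forall>x\<in>topspace (chart_top X a).
              hmap \<tau> (\<theta> a) (arrow_map X a (\<theta> a) (e a) x)
                \<in> arrow_range Y (hchart \<kappa> a) (hchart \<tau> (\<theta> a)) (e' a) \<and>
              hmap \<kappa> a x =
                inv_into (arrow_dom Y (hchart \<kappa> a) (hchart \<tau> (\<theta> a)) (e' a))
                  (arrow_map Y (hchart \<kappa> a) (hchart \<tau> (\<theta> a)) (e' a))
                  (hmap \<tau> (\<theta> a) (arrow_map X a (\<theta> a) (e a) x)))" if a: "a \<in> hsrc \<kappa>" for a
  proof (intro conjI ballI)
    fix x assume x: "x \<in> topspace (chart_top X a)"
    note m = map[OF a x]
    show "hmap \<tau> (\<theta> a) (arrow_map X a (\<theta> a) (e a) x)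
        \<in> arrow_range Y (hchart \<kappa> a) (hchart \<tau> (\<theta> a)) (e' a)"
      unfolding arrow_range_def using m by (metis imageI)
    show "hmap \<kappa> a x = inv_into (arrow_dom Y (hchart \<kappa> a) (hchart \<tau> (\<theta> a)) (e' a))
        (arrow_map Y (hchart \<kappa> a) (hchart \<tau> (\<theta> a)) (e' a))
        (hmap \<tau> (\<theta> a) (arrow_map X a (\<theta> a) (e a) x))"
      using m inv_into_f_f[OF Y.arrow_map_inj[OF hom_charts(2)[OF hom(1) a] hom_charts(2)[OF hom(2) \<theta>(1)[OF a]] e'[OF a]]] by metis
  qed (use \<theta> e e' a in blast)+
  show ?thesis
    unfolding is_induced_by_def Let_def
  proof (intro conjI exI[of _ \<theta>] exI[of _ e] exI[of _ e'] ballI)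
    fix a b \<eta> z assume "a \<in> hsrc \<kappa>" "b \<in> hsrc \<kappa>" "\<eta> \<in> arrows X a b" "z \<in> arrow_dom X a b \<eta>"
    then have "(a, z, \<eta>, b) \<in> germs_between X (hsrc \<kappa>) (hsrc \<kappa>)"
      using \<theta>c(2) by (simp add: germs_between_def germs_def)
    from F[OF this]
    show "hrho \<kappa> a b \<eta> =
     arrow_comp Y (hchart \<kappa> a) (hchart \<tau> (\<theta> b)) (hchart \<kappa> b)
       (arrow_inv Y (hchart \<kappa> b) (hchart \<tau> (\<theta> b)) (e' b))
       (arrow_comp Y (hchart \<kappa> a) (hchart \<tau> (\<theta> a)) (hchart \<tau> (\<theta> b))
         (hrho \<tau> (\<theta> a) (\<theta> b)
           (arrow_comp X (\<theta> a) a (\<theta> b) (arrow_comp X a b (\<theta> b) (e b) \<eta> z)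
             (arrow_inv X a (\<theta> a) (e a)) (arrow_map X a (\<theta> a) (e a) z)))
         (e' a) (hmap \<kappa> a z))
       (hmap \<kappa> a z)"
      by (simp add: restricted_germ_eq)
  qed (use \<kappa> \<tau> under data in blast)+
qed

text \<open>
  The existence statement behind both uses of refinement: passing to a common refinement keeps the
  target charts (\<open>V c\<close> is the old one and \<open>e' c\<close> a unit), whereas making a composite meaningful
  replaces them by charts from a prescribed cover.
\<close>

lemma restriction_hom_exists:
  assumes \<sigma>: "\<sigma> \<in> cover_homs X Y" and C: "is_cover X C" and W: "W \<subseteq> charts Y"
    and d: "\<And>c. c \<in> C \<Longrightarrow> V c \<in> W \<and> \<theta> c \<in> hsrc \<sigma> \<and> chart_set X c \<subseteq> chart_set X (\<theta> c) \<and>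
      e c \<in> arrows X c (\<theta> c) \<and> e' c \<in> arrows Y (V c) (hchart \<sigma> (\<theta> c))"
    and range: "\<And>c x. \<lbrakk>c \<in> C; x \<in> topspace (chart_top X c)\<rbrakk> \<Longrightarrow>
      hmap \<sigma> (\<theta> c) (arrow_map X c (\<theta> c) (e c) x) \<in> arrow_range Y (V c) (hchart \<sigma> (\<theta> c)) (e' c)"
  shows "\<exists>\<kappa>\<in>cover_homs X Y. hsrc \<kappa> = C \<and> (\<forall>c\<in>C. hchart \<kappa> c = V c) \<and> linked X Y \<kappa> \<sigma>"
proof -
  have hom: "is_hom X Y \<sigma>" using \<sigma> cover_homsD by blast
  define h where "h c x = arrow_map Y (hchart \<sigma> (\<theta> c)) (V c) (arrow_inv Y (V c) (hchart \<sigma> (\<theta> c)) (e' c))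
      (hmap \<sigma> (\<theta> c) (arrow_map X c (\<theta> c) (e c) x))" for c x
  \<comment> \<open>The restricted germs do not involve the \<open>hrho\<close> of \<open>\<kappa>0\<close>, so they may be computed with a dummy value first.\<close>
  define \<kappa>0 where "\<kappa>0 R = \<lparr>hsrc = C, htgt = W, hchart = V, hmap = h, hrho = R\<rparr>" for R :: "'i \<Rightarrow> 'i \<Rightarrow> 't \<Rightarrow> 's"
  have data: "restriction_data X Y \<sigma> (\<kappa>0 R) \<theta> e e'" for R
  proof
    fix c x assume "c \<in> hsrc (\<kappa>0 R)" and x: "x \<in> topspace (chart_top X c)"
    then have c: "c \<in> C" by (simp add: \<kappa>0_def)
    have ch: "V c \<in> charts Y" "hchart \<sigma> (\<theta> c) \<in> charts Y" "e' c \<in> arrows Y (V c) (hchart \<sigma> (\<theta> c))"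
      using d[OF c] W hom_charts(2)[OF hom] by blast+
    obtain y where y: "y \<in> arrow_dom Y (V c) (hchart \<sigma> (\<theta> c)) (e' c)"
      "hmap \<sigma> (\<theta> c) (arrow_map X c (\<theta> c) (e c) x) = arrow_map Y (V c) (hchart \<sigma> (\<theta> c)) (e' c) y"
      using range[OF c x] unfolding arrow_range_def by blast
    have "(V c, y, e' c, hchart \<sigma> (\<theta> c)) \<in> germs Y" using ch y by (simp add: germs_def)
    from Y.germ_inv_germ(2)[OF this] have "h c x = y" by (simp add: h_def y(2))
    then show "hmap (\<kappa>0 R) c x \<in> arrow_dom Y (hchart (\<kappa>0 R) c) (hchart \<sigma> (\<theta> c)) (e' c) \<and>
        arrow_map Y (hchart (\<kappa>0 R) c) (hchart \<sigma> (\<theta> c)) (e' c) (hmap (\<kappa>0 R) c x) =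
        hmap \<sigma> (\<theta> c) (arrow_map X c (\<theta> c) (e c) x)"
      using y by (simp add: \<kappa>0_def)
  next
    show "hsrc (\<kappa>0 R) \<subseteq> charts X" using C by (simp add: \<kappa>0_def is_cover_def)
  qed (use hom d W in \<open>auto simp: \<kappa>0_def\<close>)
  interpret K0: restriction_data X Y \<sigma> "\<kappa>0 undefined" \<theta> e e' by (rule data)
  obtain R where R: "\<And>a b \<xi> x. (a, x, \<xi>, b) \<in> germs_between X C C \<Longrightarrow>
      (V a, h a x, R a b \<xi>, V b) = K0.restricted_germ (a, x, \<xi>, b)"
    using K0.restriction_exists by (simp add: \<kappa>0_def) blast
  interpret K: restriction_data X Y \<sigma> "\<kappa>0 R" \<theta> e e' by (rule data)
  have F: "hom_germ (\<kappa>0 R) g = K.restricted_germ g" if "g \<in> germs_between X (hsrc (\<kappa>0 R)) (hsrc (\<kappa>0 R))" for g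
  proof -
    obtain a x \<xi> b where g: "g = (a, x, \<xi>, b)" by (cases g) auto
    then have "(a, x, \<xi>, b) \<in> germs_between X C C" using that by (simp add: \<kappa>0_def)
    from R[OF this] show ?thesis
      by (simp add: g K.restricted_germ_eq K0.restricted_germ_eq) (simp add: \<kappa>0_def)
  qed
  have "is_hom X Y (\<kappa>0 R)"
    unfolding is_hom_iff_link
    using K.restricted_link(1)[OF F] K.hmap_continuous K.src W d by (auto simp: \<kappa>0_def)
  moreover have "linked X Y (\<kappa>0 R) \<sigma>" by (rule K.restricted_link(2)[OF F])
  ultimately show ?thesis
    using C by (intro bexI[of _ "\<kappa>0 R"]) (auto simp: \<kappa>0_def cover_homs_def)
qed

end


text \<open>
  The intersection of two members need not be connected; its small connected open subsets around
  each point are members too.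
\<close>

lemma (in orbispace) refinement_covers:
  assumes "is_cover X A" "is_cover X B"
  shows "is_cover X {c \<in> charts X. (\<exists>a\<in>A. chart_set X c \<subseteq> chart_set X a) \<and> (\<exists>b\<in>B. chart_set X c \<subseteq> chart_set X b)}"
    (is "is_cover X ?C")
  unfolding is_cover_def
proof (intro conjI)
  show "(\<Union>c\<in>?C. chart_set X c) = topspace (orbi_top X)"
  proof
    show "(\<Union>c\<in>?C. chart_set X c) \<subseteq> topspace (orbi_top X)"
      using charts_cover by blast
    show "topspace (orbi_top X) \<subseteq> (\<Union>c\<in>?C. chart_set X c)"
    proof
      fix p assume p: "p \<in> topspace (orbi_top X)"
      obtain a b where ab: "a \<in> A" "b \<in> B" "p \<in> chart_set X a" "p \<in> chart_set X b"
        using assms p unfolding is_cover_def by blast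
      have ch: "a \<in> charts X" "b \<in> charts X" using ab assms by (auto simp: is_cover_def)
      obtain x where x: "x \<in> topspace (chart_top X a)" "chart_proj X a x = p"
        using chart_lift[OF ch(1) ab(3)] .
      let ?S = "{x \<in> topspace (chart_top X a). chart_proj X a x \<in> chart_set X b}"
      have "openin (chart_top X a) ?S"
        by (rule openin_continuous_map_preimage[OF chart_proj_quotient(1)[OF ch(1)] chart_set_open[OF ch(2)]])
      moreover have "x \<in> ?S" using x ab by simp
      ultimately obtain c where c: "c \<in> charts X" "p \<in> chart_set X c" "chart_set X c \<subseteq> chart_proj X a ` ?S"
        using small_chart_exists[OF ch(1), of ?S x] unfolding x(2) by blast
      then have "chart_set X c \<subseteq> chart_set X a" "chart_set X c \<subseteq> chart_set X b"
        using chart_proj_in[OF ch(1)] by blast+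
      then show "p \<in> (\<Union>c\<in>?C. chart_set X c)" using c ab by blast
    qed
  qed
qed blast

context orbispace_pair
begin

lemma linked_sym:
  "\<lbrakk>is_hom X Y \<sigma>; is_hom X Y \<tau>; linked X Y \<sigma> \<tau>\<rbrakk> \<Longrightarrow> linked X Y \<tau> \<sigma>"
  unfolding linked_def using link_sym by blast

lemma linked_trans:
  assumes "\<sigma> \<in> cover_homs X Y" "\<kappa> \<in> cover_homs X Y" "\<tau> \<in> cover_homs X Y"
    and "linked X Y \<sigma> \<kappa>" "linked X Y \<kappa> \<tau>"
  shows "linked X Y \<sigma> \<tau>"
  using assms link_trans cover_homsD unfolding linked_def by metis

lemma refining_hom_exists:
  assumes \<sigma>: "\<sigma> \<in> cover_homs X Y" and B: "is_cover X B"
  obtains \<kappa> where "\<kappa> \<in> cover_homs X Y" "linked X Y \<kappa> \<sigma>"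
    "\<And>c. c \<in> hsrc \<kappa> \<Longrightarrow> \<exists>a\<in>hsrc \<sigma>. chart_set X c \<subseteq> chart_set X a"
    "\<And>c. c \<in> hsrc \<kappa> \<Longrightarrow> \<exists>b\<in>B. chart_set X c \<subseteq> chart_set X b"
proof -
  have hom: "is_hom X Y \<sigma>" and cov: "is_cover X (hsrc \<sigma>)" using \<sigma> cover_homsD by blast+
  define C where "C = {c \<in> charts X. (\<exists>a\<in>hsrc \<sigma>. chart_set X c \<subseteq> chart_set X a) \<and> (\<exists>b\<in>B. chart_set X c \<subseteq> chart_set X b)}"
  have "\<exists>a \<xi>. a \<in> hsrc \<sigma> \<and> chart_set X c \<subseteq> chart_set X a \<and> \<xi> \<in> arrows X c a" if c: "c \<in> C" for c
  proof -
    obtain a where a: "a \<in> hsrc \<sigma>" "chart_set X c \<subseteq> chart_set X a" using c C_def by blast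
    have ch: "c \<in> charts X" "a \<in> charts X" using c C_def hom_charts(1)[OF hom] a by blast+
    obtain x where x: "x \<in> topspace (chart_top X c)" using X.chart_nonempty[OF ch(1)] by blast
    have "chart_proj X c x \<in> chart_set X a" using X.chart_proj_in[OF ch(1) x] a by blast
    then show ?thesis using X.arrow_exists[OF ch x] a by metis
  qed
  then obtain \<theta> e where \<theta>: "\<And>c. c \<in> C \<Longrightarrow> \<theta> c \<in> hsrc \<sigma> \<and> chart_set X c \<subseteq> chart_set X (\<theta> c) \<and> e c \<in> arrows X c (\<theta> c)"
    by metis
  have "\<exists>\<kappa>\<in>cover_homs X Y. hsrc \<kappa> = C \<and> (\<forall>c\<in>C. hchart \<kappa> c = hchart \<sigma> (\<theta> c)) \<and> linked X Y \<kappa> \<sigma>"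
  proof (rule restriction_hom_exists[OF \<sigma> X.refinement_covers[OF cov B, folded C_def] subset_refl])
    fix c assume c: "c \<in> C"
    have ch: "hchart \<sigma> (\<theta> c) \<in> charts Y" "c \<in> charts X" "\<theta> c \<in> charts X"
      using hom_charts[OF hom] \<theta>[OF c] c C_def by auto
    show "hchart \<sigma> (\<theta> c) \<in> charts Y \<and> \<theta> c \<in> hsrc \<sigma> \<and> chart_set X c \<subseteq> chart_set X (\<theta> c) \<and>
        e c \<in> arrows X c (\<theta> c) \<and>
        \<one>\<^bsub>chart_group Y (hchart \<sigma> (\<theta> c))\<^esub> \<in> arrows Y (hchart \<sigma> (\<theta> c)) (hchart \<sigma> (\<theta> c))"
      using ch \<theta>[OF c] Y.one_arrow(1) by blast
    fix x assume x: "x \<in> topspace (chart_top X c)"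
    have "arrow_dom X c (\<theta> c) (e c) = topspace (chart_top X c)"
      using X.arrow_dom_total[OF ch(2,3)] \<theta>[OF c] by blast
    then have "arrow_map X c (\<theta> c) (e c) x \<in> topspace (chart_top X (\<theta> c))"
      using X.arrow_map_in[OF ch(2,3)] \<theta>[OF c] x by blast
    moreover have "continuous_map (chart_top X (\<theta> c)) (chart_top Y (hchart \<sigma> (\<theta> c))) (hmap \<sigma> (\<theta> c))"
      using hom \<theta>[OF c] by (simp add: is_hom_iff_link)
    ultimately have "hmap \<sigma> (\<theta> c) (arrow_map X c (\<theta> c) (e c) x) \<in> topspace (chart_top Y (hchart \<sigma> (\<theta> c)))"
      by (auto simp: continuous_map_def)
    then show "hmap \<sigma> (\<theta> c) (arrow_map X c (\<theta> c) (e c) x) \<in>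
        arrow_range Y (hchart \<sigma> (\<theta> c)) (hchart \<sigma> (\<theta> c)) \<one>\<^bsub>chart_group Y (hchart \<sigma> (\<theta> c))\<^esub>"
      unfolding arrow_range_def Y.arrow_dom_same[OF ch(1) Y.one_arrow(1)[OF ch(1)]]
      using Y.one_arrow(2)[OF ch(1)] by force
  qed
  then show ?thesis using that C_def by blast
qed

text \<open>
  With this the relation inherits transitivity from links, where it needs no comparison of
  refinements.
\<close>

lemma hom_equiv_iff_linked:
  "(\<sigma>, \<tau>) \<in> hom_equiv X Y \<longleftrightarrow> \<sigma> \<in> cover_homs X Y \<and> \<tau> \<in> cover_homs X Y \<and> linked X Y \<sigma> \<tau>"
proof
  assume "(\<sigma>, \<tau>) \<in> hom_equiv X Y"
  then obtain \<kappa> where \<kappa>: "is_induced_by X Y \<kappa> \<sigma>" "is_induced_by X Y \<kappa> \<tau>"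
    unfolding hom_equiv_def by blast
  then have c: "\<sigma> \<in> cover_homs X Y" "\<tau> \<in> cover_homs X Y" "\<kappa> \<in> cover_homs X Y"
    by (simp_all add: is_induced_by_def)
  then show "\<sigma> \<in> cover_homs X Y \<and> \<tau> \<in> cover_homs X Y \<and> linked X Y \<sigma> \<tau>"
    using induced_linked[OF \<kappa>(1)] induced_linked[OF \<kappa>(2)] linked_sym linked_trans cover_homsD(1) by metis
next
  assume A: "\<sigma> \<in> cover_homs X Y \<and> \<tau> \<in> cover_homs X Y \<and> linked X Y \<sigma> \<tau>"
  then have "is_cover X (hsrc \<tau>)" using cover_homsD by blast
  then obtain \<kappa> where \<kappa>: "\<kappa> \<in> cover_homs X Y" "linked X Y \<kappa> \<sigma>"
    "\<And>c. c \<in> hsrc \<kappa> \<Longrightarrow> \<exists>a\<in>hsrc \<sigma>. chart_set X c \<subseteq> chart_set X a"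
    "\<And>c. c \<in> hsrc \<kappa> \<Longrightarrow> \<exists>b\<in>hsrc \<tau>. chart_set X c \<subseteq> chart_set X b"
    using refining_hom_exists[of \<sigma> "hsrc \<tau>"] A by blast
  have "is_induced_by X Y \<kappa> \<sigma>" using linked_induced[OF \<kappa>(1) _ \<kappa>(2,3)] A by blast
  moreover have "is_induced_by X Y \<kappa> \<tau>"
    using linked_induced[OF \<kappa>(1) _ _ \<kappa>(4)] linked_trans[OF \<kappa>(1) _ _ \<kappa>(2)] A by blast
  ultimately show "(\<sigma>, \<tau>) \<in> hom_equiv X Y" unfolding hom_equiv_def by blast
qed

lemma hom_equiv_equiv: "equiv (cover_homs X Y) (hom_equiv X Y)"
proof (rule equivI)
  show "hom_equiv X Y \<subseteq> cover_homs X Y \<times> cover_homs X Y" using hom_equiv_iff_linked by auto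
  show "refl_on (cover_homs X Y) (hom_equiv X Y)"
    using hom_link cover_homsD unfolding refl_on_def hom_equiv_iff_linked linked_def by blast
  show "sym (hom_equiv X Y)"
    using linked_sym cover_homsD unfolding sym_def hom_equiv_iff_linked by blast
  show "trans (hom_equiv X Y)"
    using linked_trans unfolding trans_def hom_equiv_iff_linked by blast
qed

lemma hom_class_eq:
  assumes "linked X Y \<sigma> \<tau>" "\<sigma> \<in> cover_homs X Y" "\<tau> \<in> cover_homs X Y"
  shows "hom_class X Y \<sigma> = hom_class X Y \<tau>"
  unfolding hom_class_def using equiv_class_eq[OF hom_equiv_equiv] assms hom_equiv_iff_linked by blast

lemma hom_class_map: "\<sigma> \<in> cover_homs X Y \<Longrightarrow> hom_class X Y \<sigma> \<in> orbi_maps X Y"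
  unfolding hom_class_def orbi_maps_def by (rule quotientI)

lemma hom_class_self: "\<sigma> \<in> cover_homs X Y \<Longrightarrow> \<sigma> \<in> hom_class X Y \<sigma>"
  unfolding hom_class_def using equiv_class_self[OF hom_equiv_equiv] .

lemma orbi_mapsD:
  assumes \<Phi>: "\<Phi> \<in> orbi_maps X Y"
  shows "\<exists>\<sigma>. \<sigma> \<in> \<Phi>"
    and "\<sigma> \<in> \<Phi> \<Longrightarrow> \<sigma> \<in> cover_homs X Y"
    and "\<sigma> \<in> \<Phi> \<Longrightarrow> hom_class X Y \<sigma> = \<Phi>"
    and "\<lbrakk>\<sigma> \<in> \<Phi>; \<tau> \<in> \<Phi>\<rbrakk> \<Longrightarrow> linked X Y \<sigma> \<tau>"
    and "\<lbrakk>\<sigma> \<in> \<Phi>; \<tau> \<in> cover_homs X Y; linked X Y \<sigma> \<tau>\<rbrakk> \<Longrightarrow> \<tau> \<in> \<Phi>"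
proof -
  obtain \<upsilon> where \<upsilon>: "\<upsilon> \<in> cover_homs X Y" "\<Phi> = hom_class X Y \<upsilon>"
    using \<Phi> unfolding orbi_maps_def hom_class_def by (rule quotientE)
  then show "\<exists>\<sigma>. \<sigma> \<in> \<Phi>" using hom_class_self by blast
  have *: "\<sigma> \<in> \<Phi> \<longleftrightarrow> \<sigma> \<in> cover_homs X Y \<and> linked X Y \<upsilon> \<sigma>" for \<sigma>
    using \<upsilon> by (auto simp: hom_class_def hom_equiv_iff_linked)
  then show "\<sigma> \<in> \<Phi> \<Longrightarrow> \<sigma> \<in> cover_homs X Y" by blast
  show "\<sigma> \<in> \<Phi> \<Longrightarrow> hom_class X Y \<sigma> = \<Phi>" using * hom_class_eq \<upsilon> by metis
  show "\<lbrakk>\<sigma> \<in> \<Phi>; \<tau> \<in> \<Phi>\<rbrakk> \<Longrightarrow> linked X Y \<sigma> \<tau>"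
    using * linked_sym linked_trans \<upsilon>(1) cover_homsD(1) by metis
  show "\<lbrakk>\<sigma> \<in> \<Phi>; \<tau> \<in> cover_homs X Y; linked X Y \<sigma> \<tau>\<rbrakk> \<Longrightarrow> \<tau> \<in> \<Phi>"
    using * linked_trans[OF \<upsilon>(1)] by blast
qed

end


section \<open>Composition\<close>

context orbispace_pair
begin

text \<open>
  Only the base is shrunk: the chart \<open>c\<close> lies over the open set of points that the underlying map
  carries into \<open>V\<^sub>b\<close>.  The image of its chart in that of \<open>V\<^sub>\<sigma>\<^sub>(\<^sub>a\<^sub>)\<close> is then connected, lies over \<open>V\<^sub>b\<close> and
  meets the range of \<open>\<epsilon>\<close>, hence is contained in it.
\<close>

lemma subordinate_chart_exists:
  assumes \<sigma>: "is_hom X Y \<sigma>" and cov: "is_cover X (hsrc \<sigma>)" and B: "is_cover Y B"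
    and p: "p \<in> topspace (orbi_top X)"
  shows "\<exists>c\<in>charts X. p \<in> chart_set X c \<and>
    (\<exists>b a \<xi> \<epsilon>. b \<in> B \<and> a \<in> hsrc \<sigma> \<and> chart_set X c \<subseteq> chart_set X a \<and> \<xi> \<in> arrows X c a \<and>
       \<epsilon> \<in> arrows Y b (hchart \<sigma> a) \<and>
       (\<forall>x\<in>topspace (chart_top X c). hmap \<sigma> a (arrow_map X c a \<xi> x) \<in> arrow_range Y b (hchart \<sigma> a) \<epsilon>))"
proof -
  obtain a where a: "a \<in> hsrc \<sigma>" "p \<in> chart_set X a" using cov p unfolding is_cover_def by blast
  have ch: "a \<in> charts X" "hchart \<sigma> a \<in> charts Y" using hom_charts[OF \<sigma>] a by blast+
  have cont: "continuous_map (chart_top X a) (chart_top Y (hchart \<sigma> a)) (hmap \<sigma> a)"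
    using \<sigma> a by (simp add: is_hom_iff_link)
  obtain x where x: "x \<in> topspace (chart_top X a)" "chart_proj X a x = p"
    using X.chart_lift[OF ch(1) a(2)] .
  define y where "y = hmap \<sigma> a x"
  have y: "y \<in> topspace (chart_top Y (hchart \<sigma> a))"
    using cont x by (auto simp: y_def continuous_map_def)
  obtain b \<zeta> where b: "b \<in> B" and "(hchart \<sigma> a, y, \<zeta>, b) \<in> germs Y"
    using Y.germ_to_cover_exists[OF _ B, of "(hchart \<sigma> a, y)"] ch y by (auto simp: germ_points_def)
  then have \<zeta>: "b \<in> charts Y" "\<zeta> \<in> arrows Y (hchart \<sigma> a) b" "y \<in> arrow_dom Y (hchart \<sigma> a) b \<zeta>"
    by (auto simp: germs_def)
  define \<epsilon> where "\<epsilon> = arrow_inv Y (hchart \<sigma> a) b \<zeta>"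
  have \<epsilon>: "\<epsilon> \<in> arrows Y b (hchart \<sigma> a)" "y \<in> arrow_range Y b (hchart \<sigma> a) \<epsilon>"
    using Y.arrow_inv[OF ch(2) \<zeta>(1,2)] \<zeta>(3) by (simp_all add: \<epsilon>_def)
  let ?S = "{z \<in> topspace (chart_top X a). chart_proj Y (hchart \<sigma> a) (hmap \<sigma> a z) \<in> chart_set Y b}"
  have "openin (chart_top X a) ?S"
    using openin_continuous_map_preimage[OF continuous_map_compose[OF cont Y.chart_proj_quotient(1)[OF ch(2)]]
        Y.chart_set_open[OF \<zeta>(1)]] by simp
  moreover have "x \<in> ?S"
    using x Y.arrow_proj[OF ch(2) \<zeta>] Y.chart_proj_in[OF \<zeta>(1) Y.arrow_map_in[OF ch(2) \<zeta>]]
    by (simp add: y_def)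
  ultimately obtain c where c: "c \<in> charts X" "p \<in> chart_set X c" "chart_set X c \<subseteq> chart_proj X a ` ?S"
    using X.small_chart_exists[OF ch(1), of ?S x] unfolding x(2) by blast
  have ca: "chart_set X c \<subseteq> chart_set X a" using c(3) X.chart_proj_in[OF ch(1)] by blast
  obtain w where w: "w \<in> topspace (chart_top X c)" "chart_proj X c w = p"
    using X.chart_lift[OF c(1,2)] .
  obtain \<xi> where \<xi>: "\<xi> \<in> arrows X c a" "arrow_map X c a \<xi> w = x"
    using X.same_image_iff[OF c(1) ch(1) w(1) x(1)] w(2) x(2) by auto
  have dom: "arrow_dom X c a \<xi> = topspace (chart_top X c)"
    by (rule X.arrow_dom_total[OF c(1) ch(1) \<xi>(1) ca])
  let ?f = "\<lambda>z. hmap \<sigma> a (arrow_map X c a \<xi> z)" and ?T = "topspace (chart_top X c)"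
  have "?f ` ?T \<subseteq> arrow_range Y b (hchart \<sigma> a) \<epsilon>"
  proof (rule Y.arrow_range_maximal[OF \<zeta>(1) ch(2) \<epsilon>(1)])
    have "continuous_map (chart_top X c) (chart_top X a) (arrow_map X c a \<xi>)"
      using X.arrow_map_continuous[OF c(1) ch(1) \<xi>(1)] dom by simp
    then have "continuous_map (chart_top X c) (chart_top Y (hchart \<sigma> a)) ?f"
      using continuous_map_compose[OF _ cont] by (simp add: o_def)
    then show "connectedin (chart_top Y (hchart \<sigma> a)) (?f ` ?T)"
      using X.chart_connected[OF c(1)] by (intro connectedin_continuous_map_image) (auto simp: connectedin_topspace)
    have "y \<in> ?f ` ?T" using w(1) \<xi>(2) y_def by force
    then show "?f ` ?T \<inter> arrow_range Y b (hchart \<sigma> a) \<epsilon> \<noteq> {}" using \<epsilon>(2) by blast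
    show "chart_proj Y (hchart \<sigma> a) ` ?f ` ?T \<subseteq> chart_set Y b"
    proof (clarify)
      fix z assume z: "z \<in> ?T"
      have zd: "z \<in> arrow_dom X c a \<xi>" using z dom by simp
      \<comment> \<open>The chart of \<open>c\<close> is only known to lie over the projection of \<open>?S\<close>; but \<open>?S\<close> is saturated,
        because points of \<open>X\<close>-charts with equal image in \<open>X\<close> have values with equal image in \<open>Y\<close>.\<close>
      obtain s where s: "s \<in> ?S" "chart_proj X c z = chart_proj X a s"
        using X.chart_proj_in[OF c(1) z] c(3) by blast
      have "chart_proj X a (arrow_map X c a \<xi> z) = chart_proj X a s"
        using X.arrow_proj[OF c(1) ch(1) \<xi>(1) zd] s(2) by simp
      then have "chart_proj Y (hchart \<sigma> a) (?f z) = chart_proj Y (hchart \<sigma> a) (hmap \<sigma> a s)"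
        using link_proj[OF \<sigma> \<sigma> hom_link[OF \<sigma>] a(1) a(1) X.arrow_map_in[OF c(1) ch(1) \<xi>(1) zd]] s(1)
        by blast
      then show "chart_proj Y (hchart \<sigma> a) (?f z) \<in> chart_set Y b" using s(1) by simp
    qed
  qed
  then show ?thesis using c(1,2) b a(1) ca \<xi>(1) \<epsilon>(1) by blast
qed

lemma subordinate_representative_exists:
  assumes \<Phi>: "\<Phi> \<in> orbi_maps X Y" and B: "is_cover Y B"
  shows "\<exists>\<kappa>\<in>\<Phi>. hchart \<kappa> ` hsrc \<kappa> \<subseteq> B"
proof -
  obtain \<sigma> where \<sigma>\<Phi>: "\<sigma> \<in> \<Phi>" using orbi_mapsD(1)[OF \<Phi>] by blast
  have \<sigma>: "\<sigma> \<in> cover_homs X Y" by (rule orbi_mapsD(2)[OF \<Phi> \<sigma>\<Phi>])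
  have hom: "is_hom X Y \<sigma>" and cov: "is_cover X (hsrc \<sigma>)" using \<sigma> cover_homsD by blast+
  define good where "good c b a \<xi> \<epsilon> \<longleftrightarrow> b \<in> B \<and> a \<in> hsrc \<sigma> \<and> chart_set X c \<subseteq> chart_set X a \<and> \<xi> \<in> arrows X c a \<and>
       \<epsilon> \<in> arrows Y b (hchart \<sigma> a) \<and>
       (\<forall>x\<in>topspace (chart_top X c). hmap \<sigma> a (arrow_map X c a \<xi> x) \<in> arrow_range Y b (hchart \<sigma> a) \<epsilon>)" for c b a \<xi> \<epsilon>
  define C where "C = {c \<in> charts X. \<exists>b a \<xi> \<epsilon>. good c b a \<xi> \<epsilon>}"
  have "topspace (orbi_top X) \<subseteq> (\<Union>c\<in>C. chart_set X c)"
  proof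
    fix p assume "p \<in> topspace (orbi_top X)"
    from subordinate_chart_exists[OF hom cov B this, folded good_def]
    obtain c b a \<xi> \<epsilon> where c: "c \<in> charts X" "p \<in> chart_set X c" "good c b a \<xi> \<epsilon>" by blast
    then have "c \<in> C" unfolding C_def by blast
    then show "p \<in> (\<Union>c\<in>C. chart_set X c)" using c(2) by blast
  qed
  moreover have "(\<Union>c\<in>C. chart_set X c) \<subseteq> topspace (orbi_top X)"
    using X.charts_cover unfolding C_def by blast
  ultimately have cover_C: "is_cover X C" by (auto simp: is_cover_def C_def)
  obtain V \<theta> e e' where good: "\<And>c. c \<in> C \<Longrightarrow> good c (V c) (\<theta> c) (e c) (e' c)"
  proof -
    have "\<forall>c\<in>C. \<exists>b a \<xi> \<epsilon>. good c b a \<xi> \<epsilon>" by (simp add: C_def)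
    then show ?thesis using that by metis
  qed
  note good = good[unfolded good_def]
  have "\<exists>\<kappa>\<in>cover_homs X Y. hsrc \<kappa> = C \<and> (\<forall>c\<in>C. hchart \<kappa> c = V c) \<and> linked X Y \<kappa> \<sigma>"
  proof (rule restriction_hom_exists[OF \<sigma> cover_C])
    show "B \<subseteq> charts Y" using B by (simp add: is_cover_def)
  qed (use good in blast)+
  then obtain \<kappa> where \<kappa>: "\<kappa> \<in> cover_homs X Y" "hsrc \<kappa> = C" "\<forall>c\<in>C. hchart \<kappa> c = V c" "linked X Y \<kappa> \<sigma>"
    by blast
  have "\<kappa> \<in> \<Phi>"
    using orbi_mapsD(5)[OF \<Phi> \<sigma>\<Phi> \<kappa>(1)] linked_sym \<kappa> hom cover_homsD(1) by blast
  moreover have "hchart \<kappa> ` hsrc \<kappa> \<subseteq> B" using \<kappa>(2,3) good by auto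
  ultimately show ?thesis by blast
qed

end

text \<open>
  Horizontal composition of links; composability says exactly that the value of \<open>N\<close> is something
  that \<open>M\<close> can be applied to.  For \<open>\<sigma> = \<sigma>'\<close> and \<open>\<tau> = \<tau>'\<close> it is the functoriality of the composite.
\<close>

lemma link_hom_comp:
  assumes X: "orbispace X" and Y: "orbispace Y" and Z: "orbispace Z"
    and N: "is_link X Y \<sigma> \<sigma>' N" and M: "is_link Y Z \<tau> \<tau>' M"
    and hom: "is_hom X Y \<sigma>" "is_hom X Y \<sigma>'"
    and c: "composable \<tau> \<sigma>" "composable \<tau>' \<sigma>'"
  shows "is_link X Z (hom_comp \<tau> \<sigma>) (hom_comp \<tau>' \<sigma>') (\<lambda>i j \<xi>. M (hchart \<sigma> i) (hchart \<sigma>' j) (N i j \<xi>))"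
proof -
  interpret XY: orbispace_pair X Y using X Y by (simp add: orbispace_pair_def)
  interpret YZ: orbispace_pair Y Z using Y Z by (simp add: orbispace_pair_def)
  have comp: "transport (hom_comp \<tau> \<sigma>) (hom_comp \<tau>' \<sigma>') (\<lambda>i j \<xi>. M (hchart \<sigma> i) (hchart \<sigma>' j) (N i j \<xi>)) g =
      transport \<tau> \<tau>' M (transport \<sigma> \<sigma>' N g)" for g \<tau> \<tau>' \<sigma> \<sigma>' M N
    by (cases g) (simp add: hom_comp_def)
  have comp': "hom_germ (hom_comp \<tau> \<sigma>) g = hom_germ \<tau> (hom_germ \<sigma> g)" for g \<tau> \<sigma>
    by (cases g) (simp add: hom_comp_def)
  have point: "hom_point (hom_comp \<tau> \<sigma>) p = hom_point \<tau> (hom_point \<sigma> p)" for p \<tau> \<sigma>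
    by (simp add: hom_point_def hom_comp_def)
  have src: "hsrc (hom_comp \<tau> \<sigma>) = hsrc \<sigma>" for \<tau> \<sigma>
    by (simp add: hom_comp_def)
  have between: "transport \<sigma> \<sigma>' N g \<in> germs_between Y (hsrc \<tau>) (hsrc \<tau>')"
    if "g \<in> germs_between X (hsrc \<sigma>) (hsrc \<sigma>')" "is_link X Y \<sigma> \<sigma>' N" "composable \<tau> \<sigma>" "composable \<tau>' \<sigma>'"
    for g \<sigma> \<sigma>' N \<tau> \<tau>'
    using XY.linkD(1,2)[OF that(2,1)] that by (auto simp: germs_between_def composable_def)
  note N\<sigma> = XY.hom_link[OF hom(1)] and N\<sigma>' = XY.hom_link[OF hom(2)]
  show ?thesis
    unfolding is_link_def src comp comp' point
    using XY.linkD[OF N] XY.linkD(1,2)[OF N\<sigma>] XY.linkD(1,2)[OF N\<sigma>'] YZ.linkD[OF M]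
      between[OF _ N c] between[OF _ N\<sigma> c(1) c(1)] between[OF _ N\<sigma>' c(2) c(2)]
    by simp
qed

lemma hom_comp_cover_hom:
  assumes X: "orbispace X" and Y: "orbispace Y" and Z: "orbispace Z"
    and \<sigma>: "\<sigma> \<in> cover_homs X Y" and \<tau>: "\<tau> \<in> cover_homs Y Z" and c: "composable \<tau> \<sigma>"
  shows "hom_comp \<tau> \<sigma> \<in> cover_homs X Z"
proof -
  interpret XY: orbispace_pair X Y using X Y by (simp add: orbispace_pair_def)
  interpret YZ: orbispace_pair Y Z using Y Z by (simp add: orbispace_pair_def)
  interpret XZ: orbispace_pair X Z using X Z by (simp add: orbispace_pair_def)
  have hom: "is_hom X Y \<sigma>" "is_hom Y Z \<tau>" using \<sigma> \<tau> by (simp_all add: cover_homs_def)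
  have "is_link X Z (hom_comp \<tau> \<sigma>) (hom_comp \<tau> \<sigma>) (hrho (hom_comp \<tau> \<sigma>))"
    using link_hom_comp[OF X Y Z XY.hom_link YZ.hom_link, OF hom hom(1) hom(1) c c]
    by (simp add: hom_comp_def)
  moreover have "continuous_map (chart_top X a) (chart_top Z (hchart (hom_comp \<tau> \<sigma>) a)) (hmap (hom_comp \<tau> \<sigma>) a)"
    if "a \<in> hsrc \<sigma>" for a
  proof -
    have "continuous_map (chart_top X a) (chart_top Y (hchart \<sigma> a)) (hmap \<sigma> a)"
      using hom that by (simp add: is_hom_def)
    moreover have "continuous_map (chart_top Y (hchart \<sigma> a)) (chart_top Z (hchart \<tau> (hchart \<sigma> a))) (hmap \<tau> (hchart \<sigma> a))"
      using hom that c by (auto simp: is_hom_def composable_def)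
    ultimately show ?thesis
      using continuous_map_compose by (fastforce simp: hom_comp_def o_def)
  qed
  moreover have "hchart \<tau> (hchart \<sigma> a) \<in> htgt \<tau>" if "a \<in> hsrc \<sigma>" for a
    using hom(2) c that unfolding is_hom_def composable_def by blast
  moreover have "htgt \<tau> \<subseteq> charts Z" using hom(2) by (simp add: is_hom_def)
  ultimately have "is_hom X Z (hom_comp \<tau> \<sigma>)"
    unfolding XZ.is_hom_iff_link
    using XY.hom_charts(1)[OF hom(1)] by (auto simp: hom_comp_def)
  then show ?thesis using \<sigma> by (simp add: cover_homs_def hom_comp_def)
qed

lemma composable_representative_exists:
  assumes "orbispace X" "orbispace Y" "\<Phi> \<in> orbi_maps X Y" "\<tau> \<in> cover_homs Y Z"
  shows "\<exists>\<sigma>\<in>\<Phi>. composable \<tau> \<sigma>"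
proof -
  interpret XY: orbispace_pair X Y using assms by (simp add: orbispace_pair_def)
  have "is_cover Y (hsrc \<tau>)" using assms by (simp add: cover_homs_def)
  then show ?thesis
    using XY.subordinate_representative_exists assms by (auto simp: composable_def)
qed

lemma orbi_comp_eq:
  assumes X: "orbispace X" and Y: "orbispace Y" and Z: "orbispace Z"
    and \<Phi>: "\<Phi> \<in> orbi_maps X Y" and \<Psi>: "\<Psi> \<in> orbi_maps Y Z"
    and \<tau>: "\<tau> \<in> \<Psi>" and \<sigma>: "\<sigma> \<in> \<Phi>" and c: "composable \<tau> \<sigma>"
  shows "orbi_comp X Z \<Psi> \<Phi> = hom_class X Z (hom_comp \<tau> \<sigma>)"
proof -
  interpret XY: orbispace_pair X Y using X Y by (simp add: orbispace_pair_def)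
  interpret YZ: orbispace_pair Y Z using Y Z by (simp add: orbispace_pair_def)
  interpret XZ: orbispace_pair X Z using X Z by (simp add: orbispace_pair_def)
  show ?thesis unfolding orbi_comp_def
  proof (rule the_equality)
    show "\<exists>\<tau>'\<in>\<Psi>. \<exists>\<sigma>'\<in>\<Phi>. composable \<tau>' \<sigma>' \<and> hom_class X Z (hom_comp \<tau> \<sigma>) = hom_class X Z (hom_comp \<tau>' \<sigma>')"
      using \<tau> \<sigma> c by blast
    fix \<Theta> assume "\<exists>\<tau>'\<in>\<Psi>. \<exists>\<sigma>'\<in>\<Phi>. composable \<tau>' \<sigma>' \<and> \<Theta> = hom_class X Z (hom_comp \<tau>' \<sigma>')"
    then obtain \<tau>' \<sigma>' where *: "\<tau>' \<in> \<Psi>" "\<sigma>' \<in> \<Phi>" "composable \<tau>' \<sigma>'" "\<Theta> = hom_class X Z (hom_comp \<tau>' \<sigma>')"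
      by blast
    note cov = XY.orbi_mapsD(2)[OF \<Phi>] YZ.orbi_mapsD(2)[OF \<Psi>]
    obtain N where N: "is_link X Y \<sigma>' \<sigma> N"
      using XY.orbi_mapsD(4)[OF \<Phi> *(2) \<sigma>] by (auto simp: linked_def)
    obtain M where M: "is_link Y Z \<tau>' \<tau> M"
      using YZ.orbi_mapsD(4)[OF \<Psi> *(1) \<tau>] by (auto simp: linked_def)
    have "is_hom X Y \<sigma>'" "is_hom X Y \<sigma>" using cov(1) * \<sigma> XY.cover_homsD by blast+
    then have "linked X Z (hom_comp \<tau>' \<sigma>') (hom_comp \<tau> \<sigma>)"
      unfolding linked_def using link_hom_comp[OF X Y Z N M _ _ *(3) c] by blast
    then show "\<Theta> = hom_class X Z (hom_comp \<tau> \<sigma>)"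
      unfolding *(4) using hom_comp_cover_hom[OF X Y Z] cov * \<tau> \<sigma> c by (intro XZ.hom_class_eq) blast+
  qed
qed

lemma orbi_comp_map:
  assumes "orbispace X" "orbispace Y" "orbispace Z" "\<Phi> \<in> orbi_maps X Y" "\<Psi> \<in> orbi_maps Y Z"
  shows "orbi_comp X Z \<Psi> \<Phi> \<in> orbi_maps X Z"
proof -
  interpret XY: orbispace_pair X Y using assms by (simp add: orbispace_pair_def)
  interpret YZ: orbispace_pair Y Z using assms by (simp add: orbispace_pair_def)
  interpret XZ: orbispace_pair X Z using assms by (simp add: orbispace_pair_def)
  obtain \<tau> where \<tau>: "\<tau> \<in> \<Psi>" "\<tau> \<in> cover_homs Y Z" using YZ.orbi_mapsD[OF assms(5)] by blast
  obtain \<sigma> where \<sigma>: "\<sigma> \<in> \<Phi>" "composable \<tau> \<sigma>"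
    using composable_representative_exists[OF assms(1,2,4) \<tau>(2)] by blast
  show ?thesis
    using orbi_comp_eq[OF assms \<tau>(1) \<sigma>] XZ.hom_class_map
      hom_comp_cover_hom[OF assms(1-3) XY.orbi_mapsD(2)[OF assms(4) \<sigma>(1)] \<tau>(2) \<sigma>(2)] by simp
qed

lemma orbi_comp_assoc:
  assumes W: "orbispace W" and X: "orbispace X" and Y: "orbispace Y" and Z: "orbispace Z"
    and \<Phi>: "\<Phi> \<in> orbi_maps W X" and \<Psi>: "\<Psi> \<in> orbi_maps X Y" and \<Xi>: "\<Xi> \<in> orbi_maps Y Z"
  shows "orbi_comp W Z \<Xi> (orbi_comp W Y \<Psi> \<Phi>) = orbi_comp W Z (orbi_comp X Z \<Xi> \<Psi>) \<Phi>"
proof -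
  interpret WX: orbispace_pair W X using W X by (simp add: orbispace_pair_def)
  interpret XY: orbispace_pair X Y using X Y by (simp add: orbispace_pair_def)
  interpret YZ: orbispace_pair Y Z using Y Z by (simp add: orbispace_pair_def)
  interpret WY: orbispace_pair W Y using W Y by (simp add: orbispace_pair_def)
  interpret XZ: orbispace_pair X Z using X Z by (simp add: orbispace_pair_def)
  obtain \<upsilon> where \<upsilon>: "\<upsilon> \<in> \<Xi>" "\<upsilon> \<in> cover_homs Y Z" using YZ.orbi_mapsD[OF \<Xi>] by blast
  obtain \<tau> where \<tau>: "\<tau> \<in> \<Psi>" "composable \<upsilon> \<tau>"
    using composable_representative_exists[OF X Y \<Psi> \<upsilon>(2)] by blast
  have \<tau>': "\<tau> \<in> cover_homs X Y" by (rule XY.orbi_mapsD(2)[OF \<Psi> \<tau>(1)])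
  obtain \<sigma> where \<sigma>: "\<sigma> \<in> \<Phi>" "composable \<tau> \<sigma>"
    using composable_representative_exists[OF W X \<Phi> \<tau>'] by blast
  have \<sigma>': "\<sigma> \<in> cover_homs W X" by (rule WX.orbi_mapsD(2)[OF \<Phi> \<sigma>(1)])
  have c: "composable \<upsilon> (hom_comp \<tau> \<sigma>)" "composable (hom_comp \<upsilon> \<tau>) \<sigma>"
    using \<tau>(2) \<sigma>(2) by (auto simp: composable_def hom_comp_def)
  have "hom_comp \<tau> \<sigma> \<in> orbi_comp W Y \<Psi> \<Phi>"
    using orbi_comp_eq[OF W X Y \<Phi> \<Psi> \<tau>(1) \<sigma>] WY.hom_class_self[OF hom_comp_cover_hom[OF W X Y \<sigma>' \<tau>' \<sigma>(2)]]
    by simp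
  then have "orbi_comp W Z \<Xi> (orbi_comp W Y \<Psi> \<Phi>) = hom_class W Z (hom_comp \<upsilon> (hom_comp \<tau> \<sigma>))"
    by (rule orbi_comp_eq[OF W Y Z orbi_comp_map[OF W X Y \<Phi> \<Psi>] \<Xi> \<upsilon>(1) _ c(1)])
  moreover have "hom_comp \<upsilon> \<tau> \<in> orbi_comp X Z \<Xi> \<Psi>"
    using orbi_comp_eq[OF X Y Z \<Psi> \<Xi> \<upsilon>(1) \<tau>] XZ.hom_class_self[OF hom_comp_cover_hom[OF X Y Z \<tau>' \<upsilon>(2) \<tau>(2)]]
    by simp
  then have "orbi_comp W Z (orbi_comp X Z \<Xi> \<Psi>) \<Phi> = hom_class W Z (hom_comp (hom_comp \<upsilon> \<tau>) \<sigma>)"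
    by (rule orbi_comp_eq[OF W X Z \<Phi> orbi_comp_map[OF X Y Z \<Psi> \<Xi>] _ \<sigma>(1) c(2)])
  moreover have "hom_comp \<upsilon> (hom_comp \<tau> \<sigma>) = hom_comp (hom_comp \<upsilon> \<tau>) \<sigma>"
    by (simp add: hom_comp_def)
  ultimately show ?thesis by simp
qed

lemma id_hom_simps:
  "hsrc (id_hom A) = A" "htgt (id_hom A) = A" "hchart (id_hom A) = (\<lambda>a. a)" "hmap (id_hom A) = (\<lambda>a x. x)"
  "hrho (id_hom A) = (\<lambda>a b \<xi>. \<xi>)"
  by (simp_all add: id_hom_def)

lemma hom_point_id: "hom_point (id_hom A) p = p"
  by (simp add: hom_point_def id_hom_simps)

lemma transport_id: "transport (id_hom A) (id_hom B) (\<lambda>i j \<xi>. \<xi>) g = g"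
  by (cases g) (simp add: id_hom_simps)

text \<open>
  The classes of the identities of all covers agree, by this link.
\<close>

lemma link_id_hom: "is_link X X (id_hom A) (id_hom B) (\<lambda>i j \<xi>. \<xi>)"
  unfolding is_link_def
  by (auto simp: germs_between_def id_hom_simps transport_id hom_point_id simp del: transport.simps)

lemma id_hom_cover_hom:
  assumes X: "orbispace X" and A: "is_cover X A"
  shows "id_hom A \<in> cover_homs X X"
proof -
  interpret orbispace_pair X X using X by (simp add: orbispace_pair_def)
  show ?thesis
    using A link_id_hom[of X A A]
    by (simp add: cover_homs_def is_hom_iff_link is_cover_def id_hom_simps)
qed

text \<open>
  The identity of the cover of a representative \<open>\<sigma>\<close> can be composed with \<open>\<sigma>\<close>, and the result is
  literally \<open>\<sigma>\<close>.
\<close>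

lemma orbi_comp_id_right:
  assumes X: "orbispace X" and Y: "orbispace Y" and \<Phi>: "\<Phi> \<in> orbi_maps X Y" and A: "is_cover X A"
  shows "orbi_comp X Y \<Phi> (hom_class X X (id_hom A)) = \<Phi>"
proof -
  interpret XX: orbispace_pair X X using X by (simp add: orbispace_pair_def)
  interpret XY: orbispace_pair X Y using X Y by (simp add: orbispace_pair_def)
  obtain \<sigma> where \<sigma>: "\<sigma> \<in> \<Phi>" using XY.orbi_mapsD(1)[OF \<Phi>] by blast
  have "is_cover X (hsrc \<sigma>)" using XY.orbi_mapsD(2)[OF \<Phi> \<sigma>] by (simp add: cover_homs_def)
  then have i: "id_hom (hsrc \<sigma>) \<in> cover_homs X X" by (rule id_hom_cover_hom[OF X])
  have "hom_class X X (id_hom A) = hom_class X X (id_hom (hsrc \<sigma>))"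
    using link_id_hom[of X] i id_hom_cover_hom[OF X A] by (intro XX.hom_class_eq) (auto simp: linked_def)
  then have "id_hom (hsrc \<sigma>) \<in> hom_class X X (id_hom A)" using XX.hom_class_self[OF i] by simp
  then have "orbi_comp X Y \<Phi> (hom_class X X (id_hom A)) = hom_class X Y (hom_comp \<sigma> (id_hom (hsrc \<sigma>)))"
    by (rule orbi_comp_eq[OF X X Y XX.hom_class_map[OF id_hom_cover_hom[OF X A]] \<Phi> \<sigma>])
      (simp add: composable_def id_hom_def)
  also have "hom_comp \<sigma> (id_hom (hsrc \<sigma>)) = \<sigma>" by (simp add: hom_comp_def id_hom_def)
  finally show ?thesis using XY.orbi_mapsD(3)[OF \<Phi> \<sigma>] by simp
qed

text \<open>
  Composing a representative \<open>\<sigma>\<close> whose target charts belong to \<open>B\<close> with the identity of \<open>B\<close> only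
  replaces its family of target charts by \<open>B\<close>; \<open>hrho \<sigma>\<close> is a link between the two.
\<close>

lemma orbi_comp_id_left:
  assumes X: "orbispace X" and Y: "orbispace Y" and \<Phi>: "\<Phi> \<in> orbi_maps X Y" and B: "is_cover Y B"
  shows "orbi_comp X Y (hom_class Y Y (id_hom B)) \<Phi> = \<Phi>"
proof -
  interpret YY: orbispace_pair Y Y using Y by (simp add: orbispace_pair_def)
  interpret XY: orbispace_pair X Y using X Y by (simp add: orbispace_pair_def)
  have i: "id_hom B \<in> cover_homs Y Y" by (rule id_hom_cover_hom[OF Y B])
  obtain \<sigma> where \<sigma>: "\<sigma> \<in> \<Phi>" "composable (id_hom B) \<sigma>"
    using composable_representative_exists[OF X Y \<Phi> i] by blast
  have \<sigma>': "\<sigma> \<in> cover_homs X Y" by (rule XY.orbi_mapsD(2)[OF \<Phi> \<sigma>(1)])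
  let ?\<sigma> = "hom_comp (id_hom B) \<sigma>"
  have eq: "orbi_comp X Y (hom_class Y Y (id_hom B)) \<Phi> = hom_class X Y ?\<sigma>"
    by (rule orbi_comp_eq[OF X Y Y \<Phi> YY.hom_class_map[OF i] YY.hom_class_self[OF i] \<sigma>])
  have fields: "hsrc ?\<sigma> = hsrc \<sigma>" "hrho ?\<sigma> = hrho \<sigma>" "transport \<sigma> ?\<sigma> N = transport \<sigma> \<sigma> N"
    "transport ?\<sigma> ?\<sigma> N = transport \<sigma> \<sigma> N" "hom_point ?\<sigma> = hom_point \<sigma>" for N
    by (auto simp: hom_comp_def id_hom_def hom_point_def)
  have "linked X Y \<sigma> ?\<sigma>"
    using XY.hom_link[OF XY.cover_homsD(1)[OF \<sigma>']] unfolding linked_def is_link_def fields by blast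
  then have "?\<sigma> \<in> \<Phi>"
    using XY.orbi_mapsD(5)[OF \<Phi> \<sigma>(1)] hom_comp_cover_hom[OF X Y Y \<sigma>' i \<sigma>(2)] by blast
  then show ?thesis using eq XY.orbi_mapsD(3)[OF \<Phi>] by simp
qed

lemma orbi_id_map:
  assumes "orbispace X" "is_cover X A"
  shows "hom_class X X (id_hom A) \<in> orbi_maps X X"
  using orbispace_pair.hom_class_map[of X X] id_hom_cover_hom[OF assms] assms
  by (simp add: orbispace_pair_def)

lemma orbi_comp_well_defined:
  assumes X: "orbispace X" and Y: "orbispace Y" and Z: "orbispace Z"
    and \<Phi>: "\<Phi> \<in> orbi_maps X Y" and \<Psi>: "\<Psi> \<in> orbi_maps Y Z"
  shows "(\<exists>\<tau>. \<tau> \<in> \<Psi>) \<and> (\<forall>\<tau>\<in>\<Psi>. \<exists>\<sigma>\<in>\<Phi>. composable \<tau> \<sigma>) \<and>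
    (\<forall>\<tau>\<in>\<Psi>. \<forall>\<sigma>\<in>\<Phi>. composable \<tau> \<sigma> \<longrightarrow>
       hom_comp \<tau> \<sigma> \<in> cover_homs X Z \<and> hom_class X Z (hom_comp \<tau> \<sigma>) = orbi_comp X Z \<Psi> \<Phi>) \<and>
    orbi_comp X Z \<Psi> \<Phi> \<in> orbi_maps X Z"
proof -
  interpret XY: orbispace_pair X Y using X Y by (simp add: orbispace_pair_def)
  interpret YZ: orbispace_pair Y Z using Y Z by (simp add: orbispace_pair_def)
  note cov = XY.orbi_mapsD(2)[OF \<Phi>] YZ.orbi_mapsD(2)[OF \<Psi>]
  show ?thesis
  proof (intro conjI ballI impI)
    show "\<exists>\<tau>. \<tau> \<in> \<Psi>" by (rule YZ.orbi_mapsD(1)[OF \<Psi>])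
    show "\<exists>\<sigma>\<in>\<Phi>. composable \<tau> \<sigma>" if "\<tau> \<in> \<Psi>" for \<tau>
      by (rule composable_representative_exists[OF X Y \<Phi> cov(2)[OF that]])
    show "hom_comp \<tau> \<sigma> \<in> cover_homs X Z" if "\<tau> \<in> \<Psi>" "\<sigma> \<in> \<Phi>" "composable \<tau> \<sigma>" for \<tau> \<sigma>
      using hom_comp_cover_hom[OF X Y Z] cov that by blast
    show "hom_class X Z (hom_comp \<tau> \<sigma>) = orbi_comp X Z \<Psi> \<Phi>" if "\<tau> \<in> \<Psi>" "\<sigma> \<in> \<Phi>" "composable \<tau> \<sigma>" for \<tau> \<sigma>
      using orbi_comp_eq[OF X Y Z \<Phi> \<Psi>] that by simp
    show "orbi_comp X Z \<Psi> \<Phi> \<in> orbi_maps X Z" by (rule orbi_comp_map[OF X Y Z \<Phi> \<Psi>])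
  qed
qed

theorem theorem1p2:
  fixes X :: "('x, 'i, 'p, 't) orbi_atlas"
    and Y :: "('y, 'j, 'q, 's) orbi_atlas"
    and Z :: "('z, 'k, 'r, 'u) orbi_atlas"
    and W :: "('w, 'l, 'v, 'n) orbi_atlas"
  assumes "orbispace X" and "orbispace Y" and "orbispace Z" and "orbispace W"
  shows
    "(\<forall>\<Phi>\<in>orbi_maps X Y. \<forall>\<Psi>\<in>orbi_maps Y Z.
        (\<exists>\<tau>. \<tau> \<in> \<Psi>) \<and>
        (\<forall>\<tau>\<in>\<Psi>. \<exists>\<sigma>\<in>\<Phi>. composable \<tau> \<sigma>) \<and>
        (\<forall>\<tau>\<in>\<Psi>. \<forall>\<sigma>\<in>\<Phi>. composable \<tau> \<sigma> \<longrightarrow>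
           hom_comp \<tau> \<sigma> \<in> cover_homs X Z \<and>
           hom_class X Z (hom_comp \<tau> \<sigma>) = orbi_comp X Z \<Psi> \<Phi>) \<and>
        orbi_comp X Z \<Psi> \<Phi> \<in> orbi_maps X Z) \<and>
     (\<forall>\<Phi>\<in>orbi_maps X Y. \<forall>\<Psi>\<in>orbi_maps Y Z. \<forall>\<Xi>\<in>orbi_maps Z W.
        orbi_comp X W \<Xi> (orbi_comp X Z \<Psi> \<Phi>) = orbi_comp X W (orbi_comp Y W \<Xi> \<Psi>) \<Phi>) \<and>
     (\<forall>A. is_cover X A \<longrightarrow> hom_class X X (id_hom A) \<in> orbi_maps X X) \<and>
     (\<forall>\<Phi>\<in>orbi_maps X Y. \<forall>A. is_cover X A \<longrightarrow>
        orbi_comp X Y \<Phi> (hom_class X X (id_hom A)) = \<Phi>) \<and>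
     (\<forall>\<Phi>\<in>orbi_maps X Y. \<forall>B. is_cover Y B \<longrightarrow>
        orbi_comp X Y (hom_class Y Y (id_hom B)) \<Phi> = \<Phi>) \<and>
     is_category {V :: ('x, 'i, 'p, 't) orbi_atlas. orbispace V}
       orbi_maps
       (\<lambda>V. hom_class V V (id_hom (charts V)))
       (\<lambda>V\<^sub>1 V\<^sub>2 V\<^sub>3. orbi_comp V\<^sub>1 V\<^sub>3)"
proof -
  have full: "is_cover V (charts V)" if "orbispace V" for V :: "('x, 'i, 'p, 't) orbi_atlas"
    using orbispace.charts_cover[OF that] by (simp add: is_cover_def)
  have "is_category {V :: ('x, 'i, 'p, 't) orbi_atlas. orbispace V} orbi_maps
       (\<lambda>V. hom_class V V (id_hom (charts V))) (\<lambda>V\<^sub>1 V\<^sub>2 V\<^sub>3. orbi_comp V\<^sub>1 V\<^sub>3)"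
    unfolding is_category_def mem_Collect_eq
    by (intro conjI ballI orbi_id_map full orbi_comp_map orbi_comp_assoc orbi_comp_id_right orbi_comp_id_left)
      (simp_all add: mem_Collect_eq)
  then show ?thesis
    using assms
    by (intro conjI ballI allI impI orbi_comp_well_defined orbi_comp_assoc orbi_id_map
        orbi_comp_id_right orbi_comp_id_left)
qed

end
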